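(* Let $X_1,X_2,\ldots$ be i.i.d. with mean $0$, variance $1$ and common distribution $F$, $\bm X_n=(X_1,\ldots,X_n)^\top$, and let $\{G_n\}$ be graphs with $G_n\in\mathscr G_n$ and $|E(G_n)|\to\infty$. (1) $S_{G_n}(\bm X_n)\xrightarrow{D}N(0,1)$ if and only if $\lim_{M\to\infty}\lim_{n\to\infty}\mathbb E[(S_{G_n}(\bm X_{n,M}))^4]=3$. (2) If moreover $\mathbb E[X_1^4]<\infty$, then $S_{G_n}(\bm X_n)\xrightarrow{D}N(0,1)$ if and only if $\lim_{n\to\infty}\mathbb E[(S_{G_n}(\bm X_n))^4]=3$.
   Context: $\mathscr G_n$: simple undirected graphs on $\{1,\ldots,n\}$ labeled so that degrees satisfy $d_1\ge\cdots\ge d_n$; $A(G_n)=((a_{u,v}))$ adjacency matrix, $E(G_n)$ edge set. $S_{G_n}(\bm x):=\frac{1}{\sqrt{|E(G_n)|}}\sum_{1\le u<v\le n}a_{u,v}x_ux_v$. Truncation: for $M>0$ let $a_M=\mathbb E[X_1\mathbf 1\{|X_1|\le M\}]$, $b_M=\operatorname{Var}[X_1\mathbf 1\{|X_1|\le M\}]$, and for $M$ large enough that $b_M>0$ set $X_{u,M}:=b_M^{-1/2}(X_u\mathbf 1\{|X_u|\le M\}-a_M)$ and $\bm X_{n,M}=(X_{1,M},\ldots,X_{n,M})^\top$. *)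

theory Defs
  imports "HOL-Probability.Probability"
begin

definition simple_graph_on :: "nat \<Rightarrow> (nat \<Rightarrow> nat \<Rightarrow> bool) \<Rightarrow> bool" where
  "simple_graph_on n G \<longleftrightarrow>
     (\<forall>u v. G u v \<longrightarrow> G v u) \<and> (\<forall>u. \<not> G u u) \<and>
     (\<forall>u v. G u v \<longrightarrow> u \<in> {1..n} \<and> v \<in> {1..n})"

definition degree :: "nat \<Rightarrow> (nat \<Rightarrow> nat \<Rightarrow> bool) \<Rightarrow> nat \<Rightarrow> nat" where
  "degree n G u = card {v \<in> {1..n}. G u v}"

definition graph_class :: "nat \<Rightarrow> (nat \<Rightarrow> nat \<Rightarrow> bool) \<Rightarrow> bool" where
  "graph_class n G \<longleftrightarrow> simple_graph_on n G \<and>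
     (\<forall>u v. 1 \<le> u \<longrightarrow> u \<le> v \<longrightarrow> v \<le> n \<longrightarrow> degree n G v \<le> degree n G u)"

definition edges :: "nat \<Rightarrow> (nat \<Rightarrow> nat \<Rightarrow> bool) \<Rightarrow> (nat \<times> nat) set" where
  "edges n G = {(u, v). 1 \<le> u \<and> u < v \<and> v \<le> n \<and> G u v}"

definition S_G :: "nat \<Rightarrow> (nat \<Rightarrow> nat \<Rightarrow> bool) \<Rightarrow> (nat \<Rightarrow> real) \<Rightarrow> real" where
  "S_G n G x = (1 / sqrt (real (card (edges n G)))) *
     (\<Sum>u\<in>{1..n}. \<Sum>v\<in>{u<..n}. (if G u v then 1 else 0) * x u * x v)"

definition trunc_mean :: "'a measure \<Rightarrow> (nat \<Rightarrow> 'a \<Rightarrow> real) \<Rightarrow> real \<Rightarrow> real" where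
  "trunc_mean P X K = integral\<^sup>L P (\<lambda>w. X 1 w * indicator {y. \<bar>y\<bar> \<le> K} (X 1 w))"

definition trunc_var :: "'a measure \<Rightarrow> (nat \<Rightarrow> 'a \<Rightarrow> real) \<Rightarrow> real \<Rightarrow> real" where
  "trunc_var P X K = integral\<^sup>L P (\<lambda>w. (X 1 w * indicator {y. \<bar>y\<bar> \<le> K} (X 1 w) - trunc_mean P X K)\<^sup>2)"

definition trunc_X :: "'a measure \<Rightarrow> (nat \<Rightarrow> 'a \<Rightarrow> real) \<Rightarrow> real \<Rightarrow> nat \<Rightarrow> 'a \<Rightarrow> real" where
  "trunc_X P X K u w = (X u w * indicator {y. \<bar>y\<bar> \<le> K} (X u w) - trunc_mean P X K) / sqrt (trunc_var P X K)"

end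

(*
  Order the vertices by decreasing degree and add them one at a time. The quadratic form then
  grows by martingale differences x_k l_k, where l_k is the sum of the variables at the earlier
  neighbours of k. Its fourth moment can be computed exactly: with m edges,
    E S^4 = 3 + 6 (E x^4 - 1) R / m^2 + 12 Q / m^2 + o(1),
  where R counts the paths of length two that end in their largest vertex and Q counts every
  4-cycle twice; the degree ordering is used only in the error term, through
  (number of earlier neighbours)^2 <= 2 m. For bounded variables, R / m^2 and Q / m^2 also control
  the variance of the quadratic variation of the martingale, so their vanishing yields the normal
  limit by a characteristic function computation for the stopped martingale; an L^2 approximation
  removes the boundedness.

  Conversely, suppose that S is asymptotically normal. Truncate x by replacing it with the constant
  E(x | |x| > K) on {|x| > K}. The form in the truncated variables is a conditional expectation
  of S, so Jensen's inequality for convex functions of linear growth that agree with s^4 on [-T, T],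
  together with a sixth moment bound, gives limsup E S_K^4 <= 3. As the variance of the truncated
  variables tends to 1, the moment formula forces Q / m^2 -> 0, and R / m^2 -> 0 unless x^2 = 1
  almost surely. Both fourth moment conditions are equivalent to the same pair of conditions on the
  graphs.
*)

theory Submission
  imports Defs
begin

text \<open>Weak convergence by itself says nothing about E S^4: x has only two moments, and forms
  in truncated variables are not known to have a normal limit. What survives is an upper bound for
  convex functions of a conditional expectation, and an upper bound is enough: in the moment formula
  the coefficients of both graph ratios are nonnegative (E x^4 - 1 is the variance of x^2), so
  limsup <= 3 squeezes the ratios themselves. Averaging the tail of x keeps the variables bounded
  for each K, hence the sixth moment is bounded uniformly in n; the centred and rescaled truncation
  of the statement is in general not a conditional expectation of x. The two truncations are never
  compared with each other, because each is tied to the graph conditions separately.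

  The martingale is stopped because its exponential is compensated by exp (t^2 V / 2), which has to
  stay bounded. In the normal limit theorem only the product (E x^4 - 1) R / m^2 is assumed to
  vanish, which keeps the symmetric two-point law inside the general argument.\<close>

abbreviation "hbi \<equiv> has_bochner_integral"

text \<open>\<open>hbi\<close> states integrability and value together, so a moment is assembled
  term by term and only afterwards brought into closed form with this rule.\<close>

lemma hbi_eqI:
  "hbi M f c \<Longrightarrow> (\<And>x. f x = g x) \<Longrightarrow> c = d \<Longrightarrow> hbi M g d"
  by (simp cong: has_bochner_integral_cong)

lemmas integrable_bound = Bochner_Integration.integrable_bound
lemmas hbi_iff = has_bochner_integral_iff
lemmas hbi_zero = has_bochner_integral_zero
lemmas hbi_integral_eq = has_bochner_integral_integral_eq
lemmas hbi_add = has_bochner_integral_add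
lemmas hbi_diff = has_bochner_integral_diff
lemmas hbi_sum = has_bochner_integral_sum
lemmas hbi_mult_right = has_bochner_integral_mult_right
lemmas hbi_mult_left = has_bochner_integral_mult_left
lemmas hbi_divide = has_bochner_integral_divide_zero
lemmas hbi_integral = has_bochner_integral_integrable

section \<open>Sequences of independent variables\<close>

locale iid_seq = D: real_distribution D for D :: "real measure"
begin

abbreviation M :: "(nat \<Rightarrow> real) measure" where "M \<equiv> PiM UNIV (\<lambda>_. D)"

sublocale P: product_prob_space "\<lambda>_. D" "UNIV :: nat set"
  by unfold_locales

sublocale DM: pair_sigma_finite D M
  by unfold_locales

text \<open>Resampling one coordinate from an independent copy stands in for conditioning on all the
  others; this invariance of the product law is what makes it work.\<close>

lemma distr_upd: "distr (D \<Otimes>\<^sub>M M) M (\<lambda>(y, x). x(k := y)) = M"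
  using distr_pair_PiM_eq_PiM[of UNIV "\<lambda>_. D" k] D.prob_space_axioms by simp

lemma measurable_upd: "(\<lambda>(y, x). x(k := y)) \<in> measurable (D \<Otimes>\<^sub>M M) M"
proof -
  have "(\<lambda>p. (snd p)(k := fst p)) \<in> measurable (D \<Otimes>\<^sub>M M) M"
    by (rule measurable_fun_upd[where J = UNIV]) auto
  then show ?thesis
    by (simp add: case_prod_beta')
qed

lemma integrable_upd:
  fixes f :: "(nat \<Rightarrow> real) \<Rightarrow> 'b :: {banach, second_countable_topology}"
  assumes "integrable M f"
  shows "integrable (D \<Otimes>\<^sub>M M) (\<lambda>(y, x). f (x(k := y)))"
proof -
  have "integrable (distr (D \<Otimes>\<^sub>M M) M (\<lambda>(y, x). x(k := y))) f"
    using assms by (simp add: distr_upd)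
  from integrable_distr[OF measurable_upd this] show ?thesis
    by (simp add: case_prod_beta')
qed

lemma integral_upd:
  fixes f :: "(nat \<Rightarrow> real) \<Rightarrow> 'b :: {banach, second_countable_topology}"
  assumes "integrable M f"
  shows "(\<integral>x. f x \<partial>M) = (\<integral>x. \<integral>y. f (x(k := y)) \<partial>D \<partial>M)"
proof -
  have f: "f \<in> borel_measurable M"
    using assms by auto
  have "(\<integral>x. f x \<partial>M) = (\<integral>x. f x \<partial>distr (D \<Otimes>\<^sub>M M) M (\<lambda>(y, x). x(k := y)))"
    by (simp add: distr_upd)
  also have "\<dots> = (\<integral>p. f ((\<lambda>(y, x). x(k := y)) p) \<partial>(D \<Otimes>\<^sub>M M))"
    by (rule integral_distr[OF measurable_upd f])
  also have "\<dots> = (\<integral>(y, x). f (x(k := y)) \<partial>(D \<Otimes>\<^sub>M M))"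
    by (simp add: case_prod_beta')
  also have "\<dots> = (\<integral>x. \<integral>y. f (x(k := y)) \<partial>D \<partial>M)"
    by (rule DM.integral_snd[symmetric, OF integrable_upd[OF assms]])
  finally show ?thesis .
qed

text \<open>Independence of coordinate \<open>k\<close>, expressed through functions instead of
  sigma-algebras; it also serves to encode predictability along the order of the vertices.\<close>

definition nodep :: "nat \<Rightarrow> ((nat \<Rightarrow> real) \<Rightarrow> 'b) \<Rightarrow> bool" where
  "nodep k Z \<longleftrightarrow> (\<forall>x y. Z (x(k := y)) = Z x)"

text \<open>After resampling coordinate \<open>k\<close> the integrand is a function of
  \<open>y\<close> times a function of \<open>x\<close>, so Fubini applies. The exact moments of the
  forms below all rest on this factorisation.\<close>

lemma hbi_nodep:
  fixes Z :: "(nat \<Rightarrow> real) \<Rightarrow> real"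
  assumes \<phi>: "hbi D \<phi> a" and Z: "hbi M Z b" and n: "nodep k Z"
  shows "hbi M (\<lambda>x. \<phi> (x k) * Z x) (a * b)"
proof -
  have [measurable]: "\<phi> \<in> borel_measurable D" "Z \<in> borel_measurable M"
    using \<phi> Z by (auto simp: hbi_iff)
  have i\<phi>: "integrable D \<phi>" and iZ: "integrable M Z"
    using \<phi> Z by (auto simp: hbi_iff)
  have prod: "integrable (D \<Otimes>\<^sub>M M) (\<lambda>(y, x). \<phi> y * Z x)"
  proof (rule DM.Fubini_integrable)
    show "integrable D (\<lambda>y. \<integral>x. norm (case (y, x) of (y, x) \<Rightarrow> \<phi> y * Z x) \<partial>M)"
      using i\<phi> by (simp add: abs_mult)
    show "AE y in D. integrable M (\<lambda>x. case (y, x) of (y, x) \<Rightarrow> \<phi> y * Z x)"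
      using iZ by simp
  qed measurable
  have eq: "(\<lambda>p. \<phi> (((\<lambda>(y, x). x(k := y)) p) k) * Z ((\<lambda>(y, x). x(k := y)) p)) = (\<lambda>(y, x). \<phi> y * Z x)"
    using n by (auto simp: nodep_def fun_eq_iff)
  have meas: "(\<lambda>x. \<phi> (x k) * Z x) \<in> borel_measurable M"
    by measurable
  have "integrable M (\<lambda>x. \<phi> (x k) * Z x)"
    using integrable_distr_eq[OF measurable_upd[of k] meas] prod unfolding eq distr_upd by simp
  moreover have "(\<integral>x. \<phi> (x k) * Z x \<partial>M) = a * b"
    using integral_distr[OF measurable_upd[of k] meas] unfolding eq distr_upd
    using DM.integral_fst[OF prod] \<phi> Z by (simp add: hbi_iff)
  ultimately show ?thesis
    by (simp add: hbi_iff)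
qed

text \<open>For integrands that do not split into a factor in coordinate \<open>k\<close> and a
  factor in the others, but whose partial integral over that coordinate vanishes.\<close>

lemma integral_eq_0_upd:
  fixes f :: "(nat \<Rightarrow> real) \<Rightarrow> 'b :: {banach, second_countable_topology}"
  assumes "integrable M f" "\<And>x. (\<integral>y. f (x(k := y)) \<partial>D) = 0"
  shows "(\<integral>x. f x \<partial>M) = 0"
  using integral_upd[OF assms(1), of k] assms(2) by simp

lemma hbi_coord:
  fixes \<phi> :: "real \<Rightarrow> real"
  assumes "hbi D \<phi> a"
  shows "hbi M (\<lambda>x. \<phi> (x k)) a"
proof -
  have "hbi M (\<lambda>x. 1::real) 1"
    using P.P.prob_space by (simp add: hbi_iff)
  from hbi_nodep[OF assms this, of k] show ?thesis
    by (simp add: nodep_def)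
qed

end

text \<open>The given variables are controlled only from index 1 on, while the product space is
  indexed by all of \<open>nat\<close>. Hence \<open>f\<close> has to factor through the restriction
  to \<open>{1..}\<close>, and the two laws are compared on the product over that set.\<close>

lemma distr_iid_eq:
  fixes X :: "nat \<Rightarrow> 'a \<Rightarrow> real" and f :: "(nat \<Rightarrow> real) \<Rightarrow> real"
  assumes prob: "prob_space P"
    and rv: "\<And>i. i \<ge> 1 \<Longrightarrow> X i \<in> borel_measurable P"
    and indep: "prob_space.indep_vars P (\<lambda>_. borel) X {1..}"
    and ident: "\<And>i. i \<ge> 1 \<Longrightarrow> distr P borel (X i) = D"
    and f: "f \<in> borel_measurable (PiM {1..} (\<lambda>_. borel))"
    and f_restrict: "\<And>x. f (restrict x {1..}) = f x"
  shows "distr P borel (\<lambda>w. f (\<lambda>u. X u w)) = distr (PiM UNIV (\<lambda>_. D)) borel f"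
proof -
  interpret prob_space P by fact
  have ps: "prob_space D"
    using ident[of 1] rv[of 1] by (metis le_refl prob_space_distr)
  have [simp]: "sets D = sets borel"
    using ident[of 1] by (metis le_refl sets_distr)
  have sp: "sets (PiM J (\<lambda>_. D)) = sets (PiM J (\<lambda>_. borel :: real measure))" for J :: "nat set"
    by (intro sets_PiM_cong) auto
  have f': "f \<in> borel_measurable (PiM {1..} (\<lambda>_. D))"
    using f by (simp cong: measurable_cong_sets add: measurable_cong_sets[OF sp refl])
  have m1: "(\<lambda>w. \<lambda>i\<in>{1..}. X i w) \<in> measurable P (PiM {1..} (\<lambda>_. borel))"
    by (intro measurable_restrict rv) auto
  have "distr P borel (\<lambda>w. f (\<lambda>u. X u w)) = distr P borel (\<lambda>w. f (\<lambda>i\<in>{1..}. X i w))"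
    by (simp only: f_restrict)
  also have "\<dots> = distr (distr P (PiM {1..} (\<lambda>_. borel)) (\<lambda>w. \<lambda>i\<in>{1..}. X i w)) borel f"
    by (subst distr_distr[OF f m1]) (simp add: comp_def)
  also have "distr P (PiM {1..} (\<lambda>_. borel)) (\<lambda>w. \<lambda>i\<in>{1..}. X i w) = PiM {1..} (\<lambda>i. distr P borel (X i))"
    using indep rv by (subst indep_vars_iff_distr_eq_PiM'[symmetric]) auto
  also have "\<dots> = PiM {1..} (\<lambda>i. D)"
    by (intro PiM_cong) (use ident in auto)
  also have "\<dots> = distr (PiM UNIV (\<lambda>_. D)) (PiM {1..} (\<lambda>_. D)) (\<lambda>x. \<lambda>n\<in>{1..}. x n)"
    using distr_PiM_reindex[of UNIV "\<lambda>_. D" "\<lambda>i. i" "{1..}", symmetric] ps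
    by (simp del: One_nat_def)
  also have "distr \<dots> borel f = distr (PiM UNIV (\<lambda>_. D)) borel (\<lambda>x. f (restrict x {1..}))"
    by (subst distr_distr[OF f']) (auto simp: comp_def intro!: measurable_restrict)
  finally show ?thesis
    by (simp only: f_restrict)
qed

section \<open>Moments of linear and quadratic forms\<close>

definition lin :: "(nat \<Rightarrow> real) \<Rightarrow> nat set \<Rightarrow> (nat \<Rightarrow> real) \<Rightarrow> real" where
  "lin b I x = (\<Sum>i\<in>I. b i * x i)"

text \<open>Ordered pairs are counted, hence the half. The form is thus symmetric in the vertices,
  and any vertex can be split off, not only the largest.\<close>

definition qf :: "(nat \<Rightarrow> nat \<Rightarrow> real) \<Rightarrow> nat set \<Rightarrow> (nat \<Rightarrow> real) \<Rightarrow> real" where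
  "qf a I x = (\<Sum>i\<in>I. \<Sum>j\<in>I. a i j * x i * x j) / 2"

definition weights :: "(nat \<Rightarrow> nat \<Rightarrow> real) \<Rightarrow> bool" where
  "weights a \<longleftrightarrow> (\<forall>i j. a i j = a j i) \<and> (\<forall>i. a i i = 0)"

lemma lin_empty [simp]: "lin b {} = (\<lambda>_. 0)"
  by (simp add: lin_def fun_eq_iff)

lemma lin_insert: "finite I \<Longrightarrow> k \<notin> I \<Longrightarrow> lin b (insert k I) x = lin b I x + x k * b k"
  by (simp add: lin_def)

lemma lin_upd [simp]: "k \<notin> I \<Longrightarrow> lin b I (x(k := y)) = lin b I x"
  by (auto simp: lin_def intro!: sum.cong)

lemma qf_empty [simp]: "qf a {} = (\<lambda>_. 0)"
  by (simp add: qf_def fun_eq_iff)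

lemma qf_upd [simp]: "k \<notin> I \<Longrightarrow> qf a I (x(k := y)) = qf a I x"
  by (auto simp: qf_def intro!: sum.cong)

lemma weights_sym: "weights a \<Longrightarrow> a i j = a j i"
  and weights_diag: "weights a \<Longrightarrow> a i i = 0"
  by (auto simp: weights_def)

lemma sum_sum_insert:
  fixes g :: "nat \<Rightarrow> nat \<Rightarrow> real"
  assumes "finite I" "k \<notin> I" "\<And>i j. g i j = g j i" "g k k = 0"
  shows "(\<Sum>i\<in>insert k I. \<Sum>j\<in>insert k I. g i j) = (\<Sum>i\<in>I. \<Sum>j\<in>I. g i j) + 2 * (\<Sum>i\<in>I. g k i)"
proof -
  have "(\<Sum>i\<in>I. g i k) = (\<Sum>i\<in>I. g k i)"
    by (rule sum.cong) (auto simp: assms(3))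
  then show ?thesis
    using assms(1,2,4) by (simp add: sum.distrib)
qed

text \<open>The cofactor of the new variable is linear in the old ones. This drives the inductions
  on the vertex set and also the computations that isolate one or two given vertices.\<close>

lemma qf_insert:
  assumes "finite I" "k \<notin> I" "weights a"
  shows "qf a (insert k I) x = qf a I x + x k * lin (a k) I x"
proof -
  have "(\<Sum>i\<in>insert k I. \<Sum>j\<in>insert k I. a i j * x i * x j)
      = (\<Sum>i\<in>I. \<Sum>j\<in>I. a i j * x i * x j) + 2 * (\<Sum>i\<in>I. a k i * x k * x i)"
    using assms(3) by (intro sum_sum_insert assms) (auto simp: weights_diag dest: weights_sym)
  also have "(\<Sum>i\<in>I. a k i * x k * x i) = x k * lin (a k) I x"
    unfolding lin_def sum_distrib_left by (rule sum.cong) simp_all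
  finally show ?thesis
    by (simp add: qf_def)
qed

lemma (in iid_seq) measurable_coord [measurable]: "(\<lambda>x. x i) \<in> borel_measurable M"
  by measurable

lemma (in iid_seq) measurable_lin [measurable]: "lin b I \<in> borel_measurable M"
  unfolding lin_def by measurable

lemma (in iid_seq) measurable_qf [measurable]: "qf a I \<in> borel_measurable M"
  unfolding qf_def by measurable

section \<open>Exact moments under a finite fourth moment\<close>

locale std_iid = iid_seq +
  assumes integrable_4: "integrable D (\<lambda>x. x ^ 4)"
    and mean_0: "(\<integral>x. x \<partial>D) = 0"
    and variance_1: "(\<integral>x. x^2 \<partial>D) = 1"
begin

definition mu :: "nat \<Rightarrow> real" where "mu p = (\<integral>x. x ^ p \<partial>D)"

lemma mu_simps [simp]: "mu 0 = 1" "mu 1 = 0" "mu (Suc 0) = 0" "mu 2 = 1"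
  using D.prob_space mean_0 variance_1 by (auto simp: mu_def)

lemma hbi_mu: assumes "p \<le> 4" shows "hbi D (\<lambda>x. x ^ p) (mu p)"
proof -
  have bound: "\<bar>x ^ p\<bar> \<le> \<bar>1 + x ^ 4\<bar>" for x :: real
  proof (cases "\<bar>x\<bar> \<le> 1")
    case True
    then have "\<bar>x ^ p\<bar> \<le> 1" unfolding power_abs by (intro power_le_one) auto
    moreover have "0 \<le> x ^ 4" by simp
    ultimately show ?thesis by linarith
  next
    case False
    have "\<bar>x\<bar> ^ p \<le> \<bar>x\<bar> ^ 4" using assms False by (intro power_increasing) auto
    moreover have "\<bar>x\<bar> ^ 4 = x ^ 4" by (rule power_even_abs) simp
    ultimately have "\<bar>x ^ p\<bar> \<le> x ^ 4" by (simp only: power_abs)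
    then show ?thesis by linarith
  qed
  have "integrable D (\<lambda>x. x ^ p)"
  proof (rule integrable_bound)
    show "integrable D (\<lambda>x. 1 + x ^ 4)"
      using integrable_4 by simp
    show "AE x in D. norm (x ^ p) \<le> norm (1 + x ^ 4)"
      unfolding real_norm_def by (intro AE_I2 bound)
  qed simp
  then show ?thesis
    by (simp add: hbi_iff mu_def)
qed

lemma hbi_pow:
  assumes "hbi M Z b" "nodep k Z" "p \<le> 4"
  shows "hbi M (\<lambda>x. x k ^ p * Z x) (mu p * b)"
  using hbi_nodep[OF hbi_mu[OF assms(3)] assms(1,2)] .

lemma hbi_1:
  assumes "integrable M Z" "nodep k Z"
  shows "hbi M (\<lambda>x. x k * Z x) 0"
  using hbi_pow[OF hbi_integral[OF assms(1)] assms(2), of 1] by simp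

lemma hbi_2:
  assumes "hbi M Z b" "nodep k Z"
  shows "hbi M (\<lambda>x. (x k)^2 * Z x) b"
  using hbi_pow[OF assms, of 2] by simp

lemma hbi_const: "hbi M (\<lambda>x. c :: real) c"
  using P.P.prob_space by (simp add: hbi_iff)

text \<open>A product of four such functions is integrable, and four factors are the most that an
  expansion leaves once the independent powers of single variables are split off.\<close>

definition L4 :: "((nat \<Rightarrow> real) \<Rightarrow> real) \<Rightarrow> bool" where
  "L4 f \<longleftrightarrow> f \<in> borel_measurable M \<and> integrable M (\<lambda>x. f x ^ 4)"

lemma prod4_le: "\<bar>a * b * c * d\<bar> \<le> a ^ 4 + b ^ 4 + c ^ 4 + d ^ 4" for a b c d :: real
proof -
  have 1: "2 * \<bar>u * v\<bar> \<le> u^2 + v^2" for u v :: real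
    using zero_le_power2[of "\<bar>u\<bar> - \<bar>v\<bar>"] by (simp add: power2_diff abs_mult)
  have "2 * \<bar>a * b * c * d\<bar> \<le> (a * b)^2 + (c * d)^2"
    using 1[of "a * b" "c * d"] by (simp add: mult.assoc)
  moreover have "2 * (a * b)^2 \<le> a ^ 4 + b ^ 4" "2 * (c * d)^2 \<le> c ^ 4 + d ^ 4"
    using 1[of "a^2" "b^2"] 1[of "c^2" "d^2"] by (simp_all add: power_mult_distrib)
  moreover have "0 \<le> a ^ 4 + b ^ 4 + c ^ 4 + d ^ 4" by simp
  ultimately show ?thesis by linarith
qed

lemma integrable_prod4:
  assumes "L4 f" "L4 g" "L4 h" "L4 k"
  shows "integrable M (\<lambda>x. f x * g x * h x * k x)"
proof (rule integrable_bound)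
  show "integrable M (\<lambda>x. f x ^ 4 + g x ^ 4 + h x ^ 4 + k x ^ 4)"
    using assms by (auto simp: L4_def)
  show "(\<lambda>x. f x * g x * h x * k x) \<in> borel_measurable M"
    using assms by (auto simp: L4_def)
  show "AE x in M. norm (f x * g x * h x * k x) \<le> norm (f x ^ 4 + g x ^ 4 + h x ^ 4 + k x ^ 4)"
    unfolding real_norm_def by (intro AE_I2 order_trans[OF prod4_le abs_ge_self])
qed

lemma L4_const [simp]: "L4 (\<lambda>_. c)"
  using hbi_const[of "c ^ 4"] by (simp add: L4_def hbi_iff)

lemma integrable_prod3: "L4 f \<Longrightarrow> L4 g \<Longrightarrow> L4 h \<Longrightarrow> integrable M (\<lambda>x. f x * g x * h x)"
  using integrable_prod4[of f g h "\<lambda>_. 1"] by simp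

lemma integrable_prod2: "L4 f \<Longrightarrow> L4 g \<Longrightarrow> integrable M (\<lambda>x. f x * g x)"
  using integrable_prod3[of f g "\<lambda>_. 1"] by simp

lemma integrable_prod1: "L4 f \<Longrightarrow> integrable M f"
  using integrable_prod2[of f "\<lambda>_. 1"] by simp

lemma L4_add: assumes "L4 f" "L4 g" shows "L4 (\<lambda>x. f x + g x)"
proof -
  have "integrable M (\<lambda>x. f x * f x * f x * f x + 4 * (f x * f x * f x * g x) + 6 * (f x * f x * g x * g x)
      + 4 * (f x * g x * g x * g x) + g x * g x * g x * g x)"
    using assms by (intro Bochner_Integration.integrable_add integrable_mult_right integrable_prod4)
  moreover have "(\<lambda>x. f x * f x * f x * f x + 4 * (f x * f x * f x * g x) + 6 * (f x * f x * g x * g x)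
      + 4 * (f x * g x * g x * g x) + g x * g x * g x * g x) = (\<lambda>x. (f x + g x) ^ 4)"
    by (rule ext) algebra
  ultimately show ?thesis
    using assms by (auto simp: L4_def)
qed

lemma L4_mult_const: "L4 f \<Longrightarrow> L4 (\<lambda>x. f x * c)"
  by (auto simp: L4_def power_mult_distrib)

text \<open>A product of two functions with fourth moments has in general only two moments;
  independence keeps it in \<open>L4\<close>.\<close>

lemma L4_coord_mult: "L4 f \<Longrightarrow> nodep k f \<Longrightarrow> L4 (\<lambda>x. x k * f x)"
  using hbi_pow[OF hbi_integral, of "\<lambda>x. f x ^ 4" k 4]
  by (auto simp: L4_def power_mult_distrib hbi_iff nodep_def)

lemma L4_coord: "L4 (\<lambda>x. x k)"
  using L4_coord_mult[of "\<lambda>_. 1" k] by (simp add: nodep_def)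

lemma L4_lin: "finite I \<Longrightarrow> L4 (lin b I)"
proof (induction I rule: finite_induct)
  case (insert k I)
  have "lin b (insert k I) = (\<lambda>x. lin b I x + x k * b k)"
    using insert by (auto simp: lin_insert)
  then show ?case
    using insert by (auto intro!: L4_add L4_coord_mult simp: nodep_def)
qed (simp add: hbi_zero)

lemma L4_qf: "finite I \<Longrightarrow> weights a \<Longrightarrow> L4 (qf a I)"
proof (induction I rule: finite_induct)
  case (insert k I)
  have "qf a (insert k I) = (\<lambda>x. qf a I x + x k * lin (a k) I x)"
    using insert by (auto simp: qf_insert)
  then show ?case
    using insert by (auto intro!: L4_add L4_coord_mult L4_lin simp: nodep_def)
qed (simp add: hbi_zero)

lemmas L4_intros = L4_lin L4_qf L4_coord L4_const L4_add L4_mult_const L4_coord_mult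
lemmas integrable_prods = integrable_prod4 integrable_prod3 integrable_prod2 integrable_prod1
lemmas integrable_rules = Bochner_Integration.integrable_add integrable_mult_right integrable_prods L4_intros

lemma hbi_lin: assumes "finite I" shows "hbi M (lin b I) 0"
proof -
  have "hbi M (\<lambda>x. \<Sum>i\<in>I. x i * b i) (\<Sum>i\<in>I. 0)"
    by (intro hbi_sum hbi_1) (auto simp: nodep_def)
  then show ?thesis
    by (simp add: lin_def mult.commute[of "b _"] cong: has_bochner_integral_cong)
qed

lemma hbi_lin_lin:
  assumes "finite I"
  shows "hbi M (\<lambda>x. lin b I x * lin c I x) (\<Sum>i\<in>I. b i * c i)"
  using assms
proof (induction I rule: finite_induct)
  case (insert k I)
  have "hbi M (\<lambda>x. lin b I x * lin c I x + x k * (lin b I x * c k + lin c I x * b k) + (x k)^2 * (b k * c k))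
     ((\<Sum>i\<in>I. b i * c i) + 0 + b k * c k)"
    using insert by (intro hbi_add hbi_1 hbi_2 hbi_const)
      ((rule integrable_rules | simp add: nodep_def)+)
  then show ?case
    using insert by (simp add: lin_insert algebra_simps power2_eq_square cong: has_bochner_integral_cong)
qed (simp add: hbi_zero)

text \<open>The Gaussian value, corrected by the fourth cumulant \<open>mu 4 - 3\<close> of each
  summand. In the induction the third moment of the new variable meets a linear form of mean zero
  and disappears.\<close>

lemma hbi_lin4:
  assumes "finite I"
  shows "hbi M (\<lambda>x. lin b I x ^ 4) (3 * (\<Sum>i\<in>I. (b i)^2)^2 + (mu 4 - 3) * (\<Sum>i\<in>I. b i ^ 4))"
  using assms
proof (induction I rule: finite_induct)
  case (insert k I)
  have *: "hbi M (\<lambda>x. lin b I x ^ 4 + x k * (lin b I x * lin b I x * lin b I x * (4 * b k))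
       + (x k)^2 * (6 * (b k)^2 * (lin b I x * lin b I x)) + (x k)^3 * (4 * b k ^ 3 * lin b I x) + (x k)^4 * (b k ^ 4))
     ((3 * (\<Sum>i\<in>I. (b i)^2)^2 + (mu 4 - 3) * (\<Sum>i\<in>I. b i ^ 4)) + 0 +
      6 * (b k)^2 * (\<Sum>i\<in>I. b i * b i) + mu 3 * (4 * b k ^ 3 * 0) + mu 4 * b k ^ 4)"
    using insert by (intro hbi_add hbi_1 hbi_2 hbi_const hbi_pow hbi_mult_right hbi_lin hbi_lin_lin)
      ((rule integrable_rules | simp add: nodep_def)+)
  show ?case
    by (rule hbi_eqI[OF *], unfold lin_insert[OF insert(1,2)] sum.insert[OF insert(1,2)] power2_eq_square[of "b _"]; algebra)
qed (simp add: hbi_zero)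

text \<open>Every monomial of the product contains some variable exactly once, whatever the third
  moment is.\<close>

lemma hbi_qf_lin:
  assumes "finite I" "weights a"
  shows "hbi M (\<lambda>x. qf a I x * lin b I x) 0"
  using assms
proof (induction I rule: finite_induct)
  case (insert k I)
  have "hbi M (\<lambda>x. qf a I x * lin b I x + x k * (qf a I x * b k + lin (a k) I x * lin b I x) + (x k)^2 * (b k * lin (a k) I x))
     (0 + 0 + b k * 0)"
    using insert by (intro hbi_add hbi_1 hbi_2 hbi_mult_right hbi_lin)
      ((rule integrable_rules | simp add: nodep_def)+)
  then show ?case
    using insert by (simp add: lin_insert qf_insert algebra_simps power2_eq_square cong: has_bochner_integral_cong)
qed (simp add: hbi_zero)

lemma hbi_qf:
  assumes "finite I" "weights a"
  shows "hbi M (qf a I) 0"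
  using assms
proof (induction I rule: finite_induct)
  case (insert k I)
  have "hbi M (\<lambda>x. qf a I x + x k * lin (a k) I x) (0 + 0)"
    using insert by (intro hbi_add hbi_1)
      ((rule integrable_rules | simp add: nodep_def)+)
  then show ?case
    using insert by (simp add: qf_insert cong: has_bochner_integral_cong)
qed (simp add: hbi_zero)

lemma hbi_qf2:
  assumes "finite I" "weights a"
  shows "hbi M (\<lambda>x. (qf a I x)^2) ((\<Sum>i\<in>I. \<Sum>j\<in>I. (a i j)^2) / 2)"
  using assms
proof (induction I rule: finite_induct)
  case (insert k I)
  have *: "hbi M (\<lambda>x. (qf a I x)^2 + x k * (2 * (qf a I x * lin (a k) I x)) + (x k)^2 * (lin (a k) I x * lin (a k) I x))
     ((\<Sum>i\<in>I. \<Sum>j\<in>I. (a i j)^2) / 2 + 0 + (\<Sum>i\<in>I. a k i * a k i))"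
    using insert by (intro hbi_add hbi_1 hbi_2 hbi_lin_lin)
      ((rule integrable_rules | simp add: nodep_def)+)
  show ?case
    by (rule hbi_eqI[OF *])
       (use insert sum_sum_insert[of I k "\<lambda>i j. (a i j)^2"] in \<open>auto simp: weights_def qf_insert power2_eq_square algebra_simps\<close>)
qed (simp add: hbi_zero)

text \<open>With \<open>i\<close> split off, the term with \<open>mu 3\<close> is a quadratic times
  a linear form and vanishes. The edges at \<open>i\<close> get the weight \<open>mu 4\<close>
  instead of the 1 they have in the plain second moment, hence the correction
  \<open>mu 4 - 1\<close>.\<close>

lemma hbi_sq_qf2:
  assumes "finite I" "weights a" "i \<in> I"
  shows "hbi M (\<lambda>x. x i * x i * (qf a I x)^2)
    ((\<Sum>i\<in>I. \<Sum>j\<in>I. (a i j)^2) / 2 + (mu 4 - 1) * (\<Sum>l\<in>I. (a i l)^2))"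
proof -
  define J where "J = I - {i}"
  have J: "finite J" "i \<notin> J" "I = insert i J"
    using assms by (auto simp: J_def)
  have ss: "(\<Sum>p\<in>insert i J. \<Sum>q\<in>insert i J. (a p q)^2) = (\<Sum>p\<in>J. \<Sum>q\<in>J. (a p q)^2) + 2 * (\<Sum>l\<in>J. (a i l)^2)"
    by (rule sum_sum_insert[OF J(1,2)]) (use assms(2) in \<open>auto simp: weights_def\<close>)
  have *: "hbi M (\<lambda>x. (x i)^2 * (qf a J x)^2 + (x i) ^ 3 * (2 * (qf a J x * lin (a i) J x)) + (x i) ^ 4 * (lin (a i) J x * lin (a i) J x))
     ((\<Sum>i\<in>J. \<Sum>j\<in>J. (a i j)^2) / 2 + mu 3 * (2 * 0) + mu 4 * (\<Sum>l\<in>J. a i l * a i l))"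
    using assms J by (intro hbi_add hbi_2 hbi_pow hbi_mult_right hbi_lin_lin hbi_qf_lin hbi_qf2)
      ((rule integrable_rules | simp add: nodep_def)+)
  show ?thesis
  proof (rule hbi_eqI[OF *])
    show "(\<Sum>i\<in>J. \<Sum>j\<in>J. (a i j)^2) / 2 + mu 3 * (2 * 0) + mu 4 * (\<Sum>l\<in>J. a i l * a i l)
      = (\<Sum>i\<in>I. \<Sum>j\<in>I. (a i j)^2) / 2 + (mu 4 - 1) * (\<Sum>l\<in>I. (a i l)^2)"
      unfolding J(3) ss using J assms(2) by (simp add: weights_diag power2_eq_square algebra_simps)
  qed (unfold J(3) qf_insert[OF J(1,2) assms(2)], algebra)
qed

text \<open>A monomial of the square survives only if it supplies both missing factors
  \<open>x i\<close> and \<open>x j\<close>: either two edges to a common neighbour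
  \<open>l\<close>, in two orders, or the edge between \<open>i\<close> and \<open>j\<close> taken
  twice, which gives a third moment at each end.\<close>

lemma hbi_cross_qf2:
  assumes "finite I" "weights a" "i \<in> I" "j \<in> I" "i \<noteq> j"
  shows "hbi M (\<lambda>x. x i * x j * (qf a I x)^2)
    (2 * (\<Sum>l\<in>I. a i l * a j l) + (mu 3)^2 * (a i j)^2)"
proof -
  define J where "J = I - {i, j}"
  have J: "finite J" "i \<notin> J" "j \<notin> J" "I = insert i (insert j J)"
    using assms by (auto simp: J_def)
  let ?G = "qf a J" and ?u = "lin (a i) J" and ?v = "lin (a j) J" and ?a = "a i j"
  have qI: "qf a I x = ?G x + x j * ?v x + x i * (?u x + x j * ?a)" for x
    using J assms by (simp add: qf_insert lin_insert)
  have *: "hbi M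
     (\<lambda>x. x i * (x j * (?G x * ?G x) + (x j)^2 * (2 * (?G x * ?v x)) + (x j)^3 * (?v x * ?v x)) +
      (x i)^2 * (x j * (2 * (?G x * ?u x)) + (x j)^2 * (2 * (?a * ?G x + ?u x * ?v x)) + (x j)^3 * (2 * ?a * ?v x)) +
      (x i)^3 * (x j * (?u x * ?u x) + (x j)^2 * (2 * ?a * ?u x) + (x j)^3 * ?a^2))
     (0 +
      (0 + 2 * (?a * 0 + (\<Sum>l\<in>J. a i l * a j l)) + mu 3 * (2 * ?a * 0)) +
      mu 3 * (0 + (2 * ?a * 0) + mu 3 * ?a^2))"
  proof (intro hbi_add)
    have "integrable M (\<lambda>x. ?G x * ?G x)" "integrable M (\<lambda>x. ?G x * ?v x)" "integrable M (\<lambda>x. ?v x * ?v x)"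
      using J(1) assms(2) by (auto intro: integrable_prod2 L4_qf L4_lin)
    note * = this[THEN hbi_integral]
    have "integrable M (\<lambda>x. x j * (?G x * ?G x) + (x j)^2 * (2 * (?G x * ?v x)) + (x j)^3 * (?v x * ?v x))"
      using hbi_pow[OF *(1), of j 1] hbi_pow[OF *(2), of j 2] hbi_pow[OF *(3), of j 3] J
      by (auto simp: nodep_def hbi_iff mult.left_commute[of "(_::real)^_" 2])
    then show "hbi M (\<lambda>x. x i * (x j * (?G x * ?G x) + (x j)^2 * (2 * (?G x * ?v x)) + (x j)^3 * (?v x * ?v x))) 0"
      using J assms by (intro hbi_1) (auto simp: nodep_def)
  next
    show "hbi M (\<lambda>x. (x i)^2 * (x j * (2 * (?G x * ?u x)) + (x j)^2 * (2 * (?a * ?G x + ?u x * ?v x)) + (x j)^3 * (2 * ?a * ?v x)))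
       (0 + 2 * (?a * 0 + (\<Sum>l\<in>J. a i l * a j l)) + mu 3 * (2 * ?a * 0))"
      using J assms by (intro hbi_2 hbi_add hbi_1 hbi_pow hbi_mult_right hbi_lin hbi_qf hbi_lin_lin) ((rule integrable_rules | simp add: nodep_def)+)
  next
    show "hbi M (\<lambda>x. (x i) ^ 3 * (x j * (?u x * ?u x) + (x j)^2 * (2 * ?a * ?u x) + (x j)^3 * ?a^2))
       (mu 3 * (0 + (2 * ?a * 0) + mu 3 * ?a^2))"
      using J assms by (intro hbi_pow[of _ _ i 3] hbi_add hbi_1 hbi_2 hbi_pow[of _ _ j 3] hbi_mult_right hbi_lin hbi_const) ((rule integrable_rules | simp add: nodep_def)+)
  qed
  show ?thesis
    by (rule hbi_eqI[OF *], unfold qI, algebra) (use J assms in \<open>simp add: weights_diag power2_eq_square\<close>)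
qed

text \<open>Only the monomials \<open>x i * (x j)^2\<close> and \<open>(x i)^2 * x j\<close> of the
  cube survive, each with multiplicity 3; every other one leaves some variable to the first
  power.\<close>

lemma hbi_cross_lin3:
  assumes "finite I" "i \<in> I" "j \<in> I" "i \<noteq> j"
  shows "hbi M (\<lambda>x. x i * x j * lin b I x ^ 3)
    (3 * mu 3 * (b i * (b j)^2 + (b i)^2 * b j))"
proof -
  define J where "J = I - {i, j}"
  have J: "finite J" "i \<notin> J" "j \<notin> J" "I = insert i (insert j J)"
    using assms by (auto simp: J_def)
  let ?l = "lin b J"
  have lI: "lin b I x = ?l x + x j * b j + x i * b i" for x
    using J assms by (simp add: lin_insert)
  have *: "hbi M
     (\<lambda>x. x i * (x j * (lin b (insert j J) x * lin b (insert j J) x * lin b (insert j J) x)) +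
      (x i)^2 * (3 * b i * (x j * (?l x * ?l x) + (x j)^2 * (2 * b j * ?l x) + (x j)^3 * (b j)^2)) +
      (x i)^3 * (3 * (b i)^2 * (x j * ?l x + (x j)^2 * b j)) + (x i)^4 * (x j * b i ^ 3))
     (0 + 3 * b i * (0 + 2 * b j * 0 + mu 3 * (b j)^2) + mu 3 * (3 * (b i)^2 * (0 + b j)) + mu 4 * 0)"
  proof (intro hbi_add)
    have "integrable M (\<lambda>x. x j * lin b (insert j J) x * lin b (insert j J) x * lin b (insert j J) x)"
      using J(1) by (intro integrable_prod4 L4_coord L4_lin) auto
    then show "hbi M (\<lambda>x. x i * (x j * (lin b (insert j J) x * lin b (insert j J) x * lin b (insert j J) x))) 0"
      using J assms by (intro hbi_1) (auto simp: nodep_def mult.assoc)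
  next
    show "hbi M (\<lambda>x. (x i)^2 * (3 * b i * (x j * (?l x * ?l x) + (x j)^2 * (2 * b j * ?l x) + (x j)^3 * (b j)^2)))
       (3 * b i * (0 + 2 * b j * 0 + mu 3 * (b j)^2))"
      using J assms by (intro hbi_2 hbi_mult_right hbi_add hbi_1 hbi_pow hbi_lin hbi_const) ((rule integrable_rules | simp add: nodep_def)+)
  next
    show "hbi M (\<lambda>x. (x i) ^ 3 * (3 * (b i)^2 * (x j * ?l x + (x j)^2 * b j))) (mu 3 * (3 * (b i)^2 * (0 + b j)))"
      using J assms by (intro hbi_pow[of _ _ i 3] hbi_mult_right hbi_add hbi_1 hbi_2 hbi_const) ((rule integrable_rules | simp add: nodep_def)+)
  next
    show "hbi M (\<lambda>x. (x i) ^ 4 * (x j * b i ^ 3)) (mu 4 * 0)"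
      using J assms by (intro hbi_pow hbi_1) ((rule integrable_rules | simp add: nodep_def)+)
  qed
  show ?thesis
    by (rule hbi_eqI[OF *], unfold lI lin_insert[OF J(1,3)], algebra) (simp add: algebra_simps)
qed

text \<open>Only the square of the linear form is expanded; each pair of its variables then meets
  the squared quadratic form in one of the two ways computed above.\<close>

lemma hbi_qf2_lin2:
  assumes "finite I" "weights a"
  shows "hbi M (\<lambda>x. (qf a I x)^2 * (lin b I x)^2)
    (\<Sum>i\<in>I. \<Sum>j\<in>I. b i * b j * (if i = j then (\<Sum>i\<in>I. \<Sum>j\<in>I. (a i j)^2) / 2 + (mu 4 - 1) * (\<Sum>l\<in>I. (a i l)^2)
        else 2 * (\<Sum>l\<in>I. a i l * a j l) + (mu 3)^2 * (a i j)^2))"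
    (is "hbi M _ (\<Sum>i\<in>I. \<Sum>j\<in>I. b i * b j * ?e i j)")
proof -
  have "hbi M (\<lambda>x. x i * x j * (qf a I x)^2) (?e i j)" if "i \<in> I" "j \<in> I" for i j
    using hbi_sq_qf2[OF assms that(1)] hbi_cross_qf2[OF assms that] by auto
  then have *: "hbi M (\<lambda>x. \<Sum>i\<in>I. \<Sum>j\<in>I. b i * b j * (x i * x j * (qf a I x)^2)) (\<Sum>i\<in>I. \<Sum>j\<in>I. b i * b j * ?e i j)"
    by (intro hbi_sum hbi_mult_right)
  show ?thesis
    by (rule hbi_eqI[OF *])
       (simp_all add: lin_def power2_eq_square[of "sum _ _"] sum_product sum_distrib_left mult_ac)
qed

lemma hbi_qf_lin3:
  assumes "finite I" "weights a"
  shows "hbi M (\<lambda>x. qf a I x * lin b I x ^ 3)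
    ((\<Sum>i\<in>I. \<Sum>j\<in>I. a i j * (3 * mu 3 * (b i * (b j)^2 + (b i)^2 * b j))) / 2)"
proof -
  have "hbi M (\<lambda>x. a i j * (x i * x j * lin b I x ^ 3)) (a i j * (3 * mu 3 * (b i * (b j)^2 + (b i)^2 * b j)))"
    if "i \<in> I" "j \<in> I" for i j
    using hbi_mult_right[of "a i j" M, OF hbi_cross_lin3[OF assms(1) that, of b]] weights_diag[OF assms(2)]
    by (cases "i = j") (auto intro: hbi_zero)
  then have *: "hbi M (\<lambda>x. (\<Sum>i\<in>I. \<Sum>j\<in>I. a i j * (x i * x j * lin b I x ^ 3)) / 2)
      ((\<Sum>i\<in>I. \<Sum>j\<in>I. a i j * (3 * mu 3 * (b i * (b j)^2 + (b i)^2 * b j))) / 2)"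
    by (intro hbi_sum hbi_divide)
  show ?thesis
    by (rule hbi_eqI[OF *]) (simp_all add: qf_def sum_distrib_right sum_distrib_left mult_ac)
qed

definition qf4 :: "(nat \<Rightarrow> nat \<Rightarrow> real) \<Rightarrow> nat set \<Rightarrow> real" where
  "qf4 a I = (\<integral>x. qf a I x ^ 4 \<partial>M)"

text \<open>Binomial expansion of \<open>(F + x k * l)^4\<close>: the term linear in
  \<open>x k\<close> has mean zero, the others separate into moments of \<open>x k\<close> and mixed
  moments of \<open>F\<close> and \<open>l\<close>.\<close>

lemma qf4_insert:
  assumes "finite I" "k \<notin> I" "weights a"
  shows "qf4 a (insert k I) = qf4 a I
     + 6 * (\<Sum>i\<in>I. \<Sum>j\<in>I. a k i * a k j * (if i = j then (\<Sum>i\<in>I. \<Sum>j\<in>I. (a i j)^2) / 2 + (mu 4 - 1) * (\<Sum>l\<in>I. (a i l)^2)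
        else 2 * (\<Sum>l\<in>I. a i l * a j l) + (mu 3)^2 * (a i j)^2))
     + mu 3 * (4 * ((\<Sum>i\<in>I. \<Sum>j\<in>I. a i j * (3 * mu 3 * (a k i * (a k j)^2 + (a k i)^2 * a k j))) / 2))
     + mu 4 * (3 * (\<Sum>i\<in>I. (a k i)^2)^2 + (mu 4 - 3) * (\<Sum>i\<in>I. a k i ^ 4))" (is "_ = qf4 a I + 6 * ?A + mu 3 * (4 * ?B) + mu 4 * ?C")
proof -
  let ?F = "qf a I" and ?l = "lin (a k) I"
  have "integrable M (\<lambda>x. ?F x ^ 4)"
    using L4_qf[OF assms(1,3)] by (simp add: L4_def)
  then have *: "hbi M (\<lambda>x. ?F x ^ 4 + x k * (?F x * ?F x * ?F x * ?l x * 4)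
      + (x k)^2 * (6 * ((?F x)^2 * (?l x)^2)) + (x k)^3 * (4 * (?F x * ?l x ^ 3)) + (x k)^4 * ?l x ^ 4)
      (qf4 a I + 0 + 6 * ?A + mu 3 * (4 * ?B) + mu 4 * ?C)"
    using assms
    by (intro hbi_add hbi_1 hbi_2 hbi_pow hbi_mult_right hbi_qf2_lin2 hbi_qf_lin3 hbi_lin4)
       (auto simp: nodep_def qf4_def hbi_iff intro!: integrable_mult_left integrable_prod4 L4_qf L4_lin)
  have "hbi M (\<lambda>x. qf a (insert k I) x ^ 4) (qf4 a I + 0 + 6 * ?A + mu 3 * (4 * ?B) + mu 4 * ?C)"
    by (rule hbi_eqI[OF * _ refl]) (unfold qf_insert[OF assms], algebra)
  then show ?thesis
    by (simp only: hbi_iff qf4_def)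
qed

end

section \<open>The fourth moment on a graph\<close>

definition adj :: "(nat \<Rightarrow> nat \<Rightarrow> real) \<Rightarrow> bool" where
  "adj a \<longleftrightarrow> weights a \<and> (\<forall>i j. a i j = 0 \<or> a i j = 1)"

text \<open>Intervals are half-open: the argument \<open>Suc n\<close> belongs to the graph on
  \<open>{1..n}\<close>, and \<open>{1..<k}\<close> is the set of vertices before
  \<open>k\<close>.\<close>

definition nedges :: "(nat \<Rightarrow> nat \<Rightarrow> real) \<Rightarrow> nat \<Rightarrow> real" where
  "nedges a n = (\<Sum>i\<in>{1..<n}. \<Sum>j\<in>{1..<n}. a i j) / 2"

definition lowdeg :: "(nat \<Rightarrow> nat \<Rightarrow> real) \<Rightarrow> nat \<Rightarrow> real" where
  "lowdeg a k = (\<Sum>i\<in>{1..<k}. a k i)"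

definition lowdeg_sq :: "(nat \<Rightarrow> nat \<Rightarrow> real) \<Rightarrow> nat \<Rightarrow> real" where
  "lowdeg_sq a n = (\<Sum>k\<in>{1..<n}. (lowdeg a k)^2)"

definition cherries :: "(nat \<Rightarrow> nat \<Rightarrow> real) \<Rightarrow> nat \<Rightarrow> real" where
  "cherries a n = (\<Sum>k\<in>{1..<n}. \<Sum>i\<in>{1..<k}. a k i * (\<Sum>l\<in>{1..<k}. a i l))"

definition triangles :: "(nat \<Rightarrow> nat \<Rightarrow> real) \<Rightarrow> nat \<Rightarrow> real" where
  "triangles a n = (\<Sum>k\<in>{1..<n}. \<Sum>i\<in>{1..<k}. \<Sum>j\<in>{1..<k}. a k i * a k j * a i j)"

definition four_cycles :: "(nat \<Rightarrow> nat \<Rightarrow> real) \<Rightarrow> nat \<Rightarrow> real" where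
  "four_cycles a n = (\<Sum>k\<in>{1..<n}. \<Sum>i\<in>{1..<k}. \<Sum>j\<in>{1..<k}.
     if i = j then 0 else a k i * a k j * (\<Sum>l\<in>{1..<k}. a i l * a j l))"

lemma adj_weights: "adj a \<Longrightarrow> weights a"
  by (simp add: adj_def)

lemma adj_square: "adj a \<Longrightarrow> a i j * a i j = a i j"
  by (metis adj_def mult_zero_left mult_1)

lemma adj_power: "adj a \<Longrightarrow> p > 0 \<Longrightarrow> a i j ^ p = a i j"
  by (metis adj_def power_one zero_power)

lemma adj_nonneg: "adj a \<Longrightarrow> 0 \<le> a i j"
  by (metis adj_def order_refl zero_le_one)

lemma adj_le_1: "adj a \<Longrightarrow> a i j \<le> 1"
  by (metis adj_def order_refl zero_le_one)

lemma insert_interval: "k \<ge> 1 \<Longrightarrow> {1..<Suc k} = insert k {1..<k}"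
  by auto

lemma nedges_Suc:
  assumes "weights a" "k \<ge> 1"
  shows "nedges a (Suc k) = nedges a k + lowdeg a k"
  unfolding nedges_def lowdeg_def insert_interval[OF assms(2)]
  by (subst sum_sum_insert) (use assms(1) in \<open>auto simp: weights_def\<close>)

lemma nedges_1 [simp]: "nedges a (Suc 0) = 0"
  by (simp add: nedges_def)

lemma nedges_eq_sum_lowdeg: "weights a \<Longrightarrow> nedges a (Suc n) = (\<Sum>k\<in>{1..<Suc n}. lowdeg a k)"
  by (induction n) (simp_all add: nedges_Suc)

context std_iid
begin

text \<open>Powers of 0/1 weights collapse, which turns the sums into counts. The coefficient 18 of
  the triangles is 6 from \<open>F^2 * l^2\<close> plus 12 from \<open>F * l^3\<close>, both with
  the factor \<open>(mu 3)^2\<close>.\<close>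

lemma qf4_Suc:
  assumes "adj a" "k \<ge> 1"
  shows "qf4 a {1..<Suc k} = qf4 a {1..<k} + 6 * lowdeg a k * nedges a k
    + 6 * (mu 4 - 1) * (\<Sum>i\<in>{1..<k}. a k i * (\<Sum>l\<in>{1..<k}. a i l))
    + 12 * (\<Sum>i\<in>{1..<k}. \<Sum>j\<in>{1..<k}. if i = j then 0 else a k i * a k j * (\<Sum>l\<in>{1..<k}. a i l * a j l))
    + 18 * (mu 3)^2 * (\<Sum>i\<in>{1..<k}. \<Sum>j\<in>{1..<k}. a k i * a k j * a i j)
    + mu 4 * (3 * (lowdeg a k)^2 + (mu 4 - 3) * lowdeg a k)"
proof -
  let ?I = "{1..<k}"
  note w = adj_weights[OF assms(1)] and sq = adj_power[OF assms(1)]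
  let ?t = "\<lambda>i j. a k i * a k j * (if i = j then (\<Sum>i\<in>?I. \<Sum>j\<in>?I. (a i j)^2) / 2 + (mu 4 - 1) * (\<Sum>l\<in>?I. (a i l)^2)
        else 2 * (\<Sum>l\<in>?I. a i l * a j l) + (mu 3)^2 * (a i j)^2)"
  define A where "A = (\<Sum>i\<in>?I. \<Sum>j\<in>?I. ?t i j)"
  define B where "B = (\<Sum>i\<in>?I. \<Sum>j\<in>?I. a i j * (3 * mu 3 * (a k i * (a k j)^2 + (a k i)^2 * a k j)))"
  define R where "R = (\<Sum>i\<in>?I. a k i * (\<Sum>l\<in>?I. a i l))"
  define Q where "Q = (\<Sum>i\<in>?I. \<Sum>j\<in>?I. if i = j then 0 else a k i * a k j * (\<Sum>l\<in>?I. a i l * a j l))"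
  define T where "T = (\<Sum>i\<in>?I. \<Sum>j\<in>?I. a k i * a k j * a i j)"
  have "?t i j
    = (if i = j then a k i * (nedges a k + (mu 4 - 1) * (\<Sum>l\<in>?I. a i l)) else 0)
      + 2 * (if i = j then 0 else a k i * a k j * (\<Sum>l\<in>?I. a i l * a j l)) + (mu 3)^2 * (a k i * a k j * a i j)" for i j
  proof (cases "i = j")
    case True
    then show ?thesis
      by (simp add: adj_square[OF assms(1)] sq weights_diag[OF w] nedges_def)
  next
    case False
    then show ?thesis
      by (simp add: sq algebra_simps)
  qed
  then have "A = (\<Sum>i\<in>?I. a k i * (nedges a k + (mu 4 - 1) * (\<Sum>l\<in>?I. a i l))) + 2 * Q + (mu 3)^2 * T"
    by (simp add: A_def sum.distrib sum_distrib_left[symmetric] Q_def T_def)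
  moreover have "(\<Sum>i\<in>?I. a k i * (nedges a k + c * s i)) = lowdeg a k * nedges a k + c * (\<Sum>i\<in>?I. a k i * s i)" for c s
    by (simp add: lowdeg_def distrib_left sum.distrib sum_distrib_right sum_distrib_left mult_ac)
  ultimately have A: "A = lowdeg a k * nedges a k + (mu 4 - 1) * R + 2 * Q + (mu 3)^2 * T"
    by (simp add: R_def)
  have "B = (\<Sum>i\<in>?I. \<Sum>j\<in>?I. 6 * mu 3 * (a k i * a k j * a i j))"
    unfolding B_def by (intro sum.cong refl) (simp add: sq)
  then have B: "B = 6 * mu 3 * T"
    by (simp add: T_def sum_distrib_left)
  have "qf4 a {1..<Suc k} = qf4 a ?I + 6 * A + mu 3 * (4 * (B / 2)) + mu 4 * (3 * (\<Sum>i\<in>?I. (a k i)^2)^2 + (mu 4 - 3) * (\<Sum>i\<in>?I. a k i ^ 4))"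
    unfolding insert_interval[OF assms(2)] A_def B_def by (rule qf4_insert) (use w in auto)
  then show ?thesis
    unfolding A B R_def[symmetric] Q_def[symmetric] T_def[symmetric]
    by (simp add: sq lowdeg_def[symmetric] power2_eq_square[of "mu 3"] algebra_simps del: One_nat_def)
qed

text \<open>As \<open>nedges\<close> grows by \<open>lowdeg\<close>, three times its square grows by
  \<open>6 * lowdeg * nedges + 3 * lowdeg^2\<close>. This uses up 3 of the \<open>3 * mu 4\<close>
  squares of \<open>lowdeg\<close> in each step and leaves the coefficient
  \<open>3 * (mu 4 - 1)\<close>.\<close>

theorem qf4_eq:
  assumes "adj a"
  shows "qf4 a {1..<Suc n} = 3 * (nedges a (Suc n))^2 + 6 * (mu 4 - 1) * cherries a (Suc n)
    + 12 * four_cycles a (Suc n) + 18 * (mu 3)^2 * triangles a (Suc n)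
    + 3 * (mu 4 - 1) * lowdeg_sq a (Suc n) + mu 4 * (mu 4 - 3) * nedges a (Suc n)"
proof (induction n)
  case 0
  then show ?case
    by (simp add: qf4_def cherries_def four_cycles_def triangles_def lowdeg_sq_def)
next
  case (Suc n)
  have S: "sum f {1..<Suc (Suc n)} = sum f {1..<Suc n} + f (Suc n)" for f :: "nat \<Rightarrow> real"
    by simp
  have le: "1 \<le> Suc n"
    by simp
  show ?case
    unfolding qf4_Suc[OF assms le] Suc nedges_Suc[OF adj_weights[OF assms] le]
      cherries_def four_cycles_def triangles_def lowdeg_sq_def S
    by algebra
qed

text \<open>Identifies \<open>mu 4 - 1\<close> as the variance of \<open>x^2\<close>. It is
  nonnegative and vanishes only if \<open>x^2 = 1\<close> almost surely, the one case in which the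
  cherries drop out of the moment formula.\<close>

lemma hbi_sq_minus_1: "hbi D (\<lambda>x. (x^2 - 1)^2) (mu 4 - 1)"
proof -
  have *: "hbi D (\<lambda>x. x ^ 4 - 2 * x ^ 2 + x ^ 0) (mu 4 - 2 * mu 2 + mu 0)"
    by (intro hbi_add hbi_diff hbi_mult_right hbi_mu) auto
  show ?thesis
    by (rule hbi_eqI[OF *], algebra) simp
qed

lemma integral_sq_minus_1: "(\<integral>x. (x^2 - 1)^2 \<partial>D) = mu 4 - 1"
  using hbi_sq_minus_1 by (simp add: hbi_iff)

lemma mu4_ge_1: "mu 4 \<ge> 1"
  using Bochner_Integration.integral_nonneg[of D "\<lambda>x. (x^2 - 1)^2"] by (simp add: integral_sq_minus_1)

end

lemma lowdeg_nonneg: "adj a \<Longrightarrow> 0 \<le> lowdeg a k"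
  by (auto simp: lowdeg_def adj_nonneg intro!: sum_nonneg)

lemma nedges_nonneg: "adj a \<Longrightarrow> 0 \<le> nedges a k"
  by (auto simp: nedges_def adj_nonneg intro!: sum_nonneg)

lemma cherries_nonneg: "adj a \<Longrightarrow> 0 \<le> cherries a k"
  by (auto simp: cherries_def adj_nonneg intro!: sum_nonneg mult_nonneg_nonneg)

lemma four_cycles_nonneg: "adj a \<Longrightarrow> 0 \<le> four_cycles a k"
  by (auto simp: four_cycles_def adj_nonneg intro!: sum_nonneg mult_nonneg_nonneg)

lemma triangles_nonneg: "adj a \<Longrightarrow> 0 \<le> triangles a k"
  by (auto simp: triangles_def adj_nonneg intro!: sum_nonneg mult_nonneg_nonneg)

lemma lowdeg_sq_nonneg: "0 \<le> lowdeg_sq a k"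
  by (auto simp: lowdeg_sq_def intro!: sum_nonneg)

lemma triangles_le_lowdeg_sq:
  assumes "adj a" shows "triangles a n \<le> lowdeg_sq a n"
  unfolding triangles_def lowdeg_sq_def lowdeg_def power2_eq_square sum_product
  using assms by (intro sum_mono mult_left_le mult_nonneg_nonneg adj_le_1 adj_nonneg) auto

definition degree_ordered :: "(nat \<Rightarrow> nat \<Rightarrow> real) \<Rightarrow> nat \<Rightarrow> bool" where
  "degree_ordered a n \<longleftrightarrow> (\<forall>u v. 1 \<le> u \<longrightarrow> u \<le> v \<longrightarrow> v < n \<longrightarrow> (\<Sum>j\<in>{1..<n}. a v j) \<le> (\<Sum>j\<in>{1..<n}. a u j))"

text \<open>The earlier neighbours of \<open>k\<close> are \<open>lowdeg a k\<close> vertices, each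
  of degree at least that of \<open>k\<close> and so at least \<open>lowdeg a k\<close>; all degrees
  together add up to twice the number of edges.\<close>

lemma lowdeg_le:
  assumes "adj a" "degree_ordered a n" "k \<in> {1..<n}"
  shows "lowdeg a k \<le> sqrt (2 * nedges a n)"
proof (rule real_le_rsqrt)
  let ?d = "\<lambda>i. \<Sum>j\<in>{1..<n}. a i j"
  note nn = adj_nonneg[OF assms(1)]
  have "lowdeg a k \<le> ?d k"
    unfolding lowdeg_def using assms(3) by (intro sum_mono2) (auto simp: nn)
  then have "(lowdeg a k)^2 \<le> lowdeg a k * ?d k"
    unfolding power2_eq_square by (intro mult_left_mono lowdeg_nonneg assms)
  also have "\<dots> = (\<Sum>i\<in>{1..<k}. a k i * ?d k)"
    by (simp add: lowdeg_def sum_distrib_right)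
  also have "\<dots> \<le> (\<Sum>i\<in>{1..<k}. ?d i)"
  proof (intro sum_mono)
    fix i assume i: "i \<in> {1..<k}"
    have "a k i * ?d k \<le> 1 * ?d k"
      by (intro mult_right_mono adj_le_1 assms sum_nonneg nn)
    also have "\<dots> \<le> ?d i"
      using assms(2,3) i by (simp add: degree_ordered_def)
    finally show "a k i * ?d k \<le> ?d i" .
  qed
  also have "\<dots> \<le> (\<Sum>i\<in>{1..<n}. ?d i)"
    using assms(3) by (intro sum_mono2) (auto intro!: sum_nonneg nn)
  finally show "(lowdeg a k)^2 \<le> 2 * nedges a n"
    by (simp add: nedges_def)
qed

text \<open>One factor is bounded uniformly in the vertex; the other sums to the number of edges, as
  every edge is counted at its larger end.\<close>

lemma lowdeg_sq_le:
  assumes "adj a" "degree_ordered a (Suc n)"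
  shows "lowdeg_sq a (Suc n) \<le> sqrt (2 * nedges a (Suc n)) * nedges a (Suc n)"
proof -
  have "lowdeg_sq a (Suc n) \<le> (\<Sum>k\<in>{1..<Suc n}. sqrt (2 * nedges a (Suc n)) * lowdeg a k)"
    unfolding lowdeg_sq_def power2_eq_square
    using assms by (intro sum_mono mult_right_mono lowdeg_le lowdeg_nonneg) auto
  also have "\<dots> = sqrt (2 * nedges a (Suc n)) * nedges a (Suc n)"
    unfolding sum_distrib_left[symmetric] nedges_eq_sum_lowdeg[OF adj_weights[OF assms(1)]] ..
  finally show ?thesis .
qed

section \<open>Graphs as 0/1 weights, and the graph ratios along the sequence\<close>

definition adjm :: "(nat \<Rightarrow> nat \<Rightarrow> bool) \<Rightarrow> nat \<Rightarrow> nat \<Rightarrow> real" where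
  "adjm G i j = of_bool (G i j)"

lemma sum_upper_triangle:
  fixes g :: "nat \<Rightarrow> nat \<Rightarrow> real"
  assumes "\<And>i j. g i j = g j i" "\<And>i. g i i = 0"
  shows "(\<Sum>u\<in>{1..n}. \<Sum>v\<in>{u<..n}. g u v) = (\<Sum>u\<in>{1..<Suc n}. \<Sum>v\<in>{1..<Suc n}. g u v) / 2"
proof (induction n)
  case (Suc n)
  have *: "{u<..Suc n} = insert (Suc n) {u<..n}" if "u \<in> {1..n}" for u
    using that by auto
  have "(\<Sum>u\<in>{1..Suc n}. \<Sum>v\<in>{u<..Suc n}. g u v) = (\<Sum>u\<in>{1..n}. \<Sum>v\<in>{u<..Suc n}. g u v)"
    by simp
  also have "\<dots> = (\<Sum>u\<in>{1..n}. g u (Suc n) + (\<Sum>v\<in>{u<..n}. g u v))"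
    by (intro sum.cong refl) (simp add: *)
  also have "\<dots> = (\<Sum>i\<in>{1..<Suc n}. g (Suc n) i) + (\<Sum>u\<in>{1..<Suc n}. \<Sum>v\<in>{1..<Suc n}. g u v) / 2"
    unfolding sum.distrib Suc by (simp add: atLeastLessThanSuc_atLeastAtMost assms(1)[of _ "Suc n"])
  also have "\<dots> = (\<Sum>u\<in>insert (Suc n) {1..<Suc n}. \<Sum>v\<in>insert (Suc n) {1..<Suc n}. g u v) / 2"
    by (subst sum_sum_insert) (use assms in auto)
  also have "insert (Suc n) {1..<Suc n} = {1..<Suc (Suc n)}"
    by auto
  finally show ?case .
qed simp

lemma adj_adjm: "graph_class n G \<Longrightarrow> adj (adjm G)"
  by (auto simp: graph_class_def simple_graph_on_def adj_def weights_def adjm_def of_bool_def)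

lemma card_edges_eq:
  assumes "graph_class n G"
  shows "real (card (edges n G)) = nedges (adjm G) (Suc n)"
proof -
  have "edges n G = (SIGMA u:{1..n}. {v\<in>{u<..n}. G u v})"
    by (auto simp: edges_def)
  then have "real (card (edges n G)) = (\<Sum>u\<in>{1..n}. \<Sum>v\<in>{u<..n}. adjm G u v)"
    by (simp add: card_SigmaI adjm_def of_bool_def sum.If_cases Int_def)
  then show ?thesis
    unfolding nedges_def using adj_weights[OF adj_adjm[OF assms]]
    by (subst (asm) sum_upper_triangle) (auto simp: weights_def)
qed

lemma S_G_eq:
  assumes "graph_class n G"
  shows "S_G n G x = qf (adjm G) {1..<Suc n} x / sqrt (nedges (adjm G) (Suc n))"
proof -
  have "(\<Sum>u\<in>{1..n}. \<Sum>v\<in>{u<..n}. (if G u v then 1 else 0) * x u * x v) = (\<Sum>u\<in>{1..n}. \<Sum>v\<in>{u<..n}. adjm G u v * x u * x v)"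
    by (simp add: adjm_def of_bool_def)
  also have "\<dots> = qf (adjm G) {1..<Suc n} x"
    unfolding qf_def using adj_weights[OF adj_adjm[OF assms]]
    by (subst sum_upper_triangle) (auto simp: weights_def)
  finally show ?thesis
    by (simp add: S_G_def card_edges_eq[OF assms])
qed

lemma degree_ordered_adjm:
  assumes "graph_class n G" shows "degree_ordered (adjm G) (Suc n)"
proof -
  have "(\<Sum>j\<in>{1..<Suc n}. adjm G u j) = real (degree n G u)" for u
    by (simp add: degree_def adjm_def of_bool_def sum.If_cases Int_def atLeastLessThanSuc_atLeastAtMost)
  then show ?thesis
    using assms by (auto simp: degree_ordered_def graph_class_def)
qed

locale graph_seq =
  fixes G :: "nat \<Rightarrow> nat \<Rightarrow> nat \<Rightarrow> bool"
  assumes graphs: "\<And>n. graph_class n (G n)"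
    and edges_inf: "filterlim (\<lambda>n. card (edges n (G n))) at_top sequentially"
begin

definition a where "a n = adjm (G n)"
definition m where "m n = nedges (a n) (Suc n)"
definition cherry_ratio where "cherry_ratio n = cherries (a n) (Suc n) / (m n)^2"
definition cycle_ratio where "cycle_ratio n = four_cycles (a n) (Suc n) / (m n)^2"
definition S :: "nat \<Rightarrow> (nat \<Rightarrow> real) \<Rightarrow> real" where "S n x = S_G n (G n) x"
text \<open>The variables are transformed but live on the same product space, so that original and
  truncated forms can be subtracted.\<close>

abbreviation Sf :: "(real \<Rightarrow> real) \<Rightarrow> nat \<Rightarrow> (nat \<Rightarrow> real) \<Rightarrow> real" where "Sf v n x \<equiv> S n (\<lambda>u. v (x u))"

lemma adj_a: "adj (a n)"
  unfolding a_def by (rule adj_adjm[OF graphs])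

lemma weights_a: "weights (a n)"
  by (rule adj_weights[OF adj_a])

lemma m_nonneg: "0 \<le> m n"
  unfolding m_def by (rule nedges_nonneg[OF adj_a])

lemma S_eq: "S n x = qf (a n) {1..<Suc n} x / sqrt (m n)"
  unfolding S_def a_def m_def by (rule S_G_eq[OF graphs])

lemma m_at_top: "filterlim m at_top sequentially"
proof -
  have "m = (\<lambda>n. real (card (edges n (G n))))"
    unfolding m_def a_def card_edges_eq[OF graphs] ..
  then show ?thesis
    using filterlim_compose[OF filterlim_real_sequentially edges_inf] by simp
qed

lemma eventually_m_pos: "\<forall>\<^sub>F n in sequentially. m n > 0"
  using m_at_top by (auto simp: filterlim_at_top_dense)

lemma cherry_ratio_nonneg: "0 \<le> cherry_ratio n"
  unfolding cherry_ratio_def using cherries_nonneg[OF adj_a] by simp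

lemma cycle_ratio_nonneg: "0 \<le> cycle_ratio n"
  unfolding cycle_ratio_def using four_cycles_nonneg[OF adj_a] by simp

lemma inverse_m_tendsto: "(\<lambda>n. c / m n) \<longlonglongrightarrow> 0"
  by (rule tendsto_divide_0[OF tendsto_const filterlim_at_top_imp_at_infinity[OF m_at_top]])

lemma lowdeg_sq_ratio_le: "lowdeg_sq (a n) (Suc n) / (m n)^2 \<le> sqrt (2 / m n)"
proof (cases "m n = 0")
  case False
  with m_nonneg have m: "m n > 0"
    by (simp add: order_le_neq_trans)
  have "lowdeg_sq (a n) (Suc n) \<le> sqrt (2 * m n) * m n"
    unfolding m_def using degree_ordered_adjm[OF graphs, of n] by (intro lowdeg_sq_le adj_a) (simp add: a_def)
  then have "lowdeg_sq (a n) (Suc n) / (m n)^2 \<le> sqrt (2 * m n) * m n / (m n)^2"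
    by (intro divide_right_mono) auto
  also have "\<dots> = sqrt (2 / m n)"
    using m by (simp add: power2_eq_square real_sqrt_mult real_sqrt_divide field_simps)
  finally show ?thesis .
qed simp

lemma lowdeg_sq_ratio_tendsto: "(\<lambda>n. lowdeg_sq (a n) (Suc n) / (m n)^2) \<longlonglongrightarrow> 0"
proof (rule tendsto_sandwich[OF _ _ tendsto_const[of 0]])
  show "(\<lambda>n. sqrt (2 / m n)) \<longlonglongrightarrow> 0"
    using tendsto_real_sqrt[OF inverse_m_tendsto[of 2]] by simp
qed (auto simp: lowdeg_sq_nonneg lowdeg_sq_ratio_le)

lemma triangle_ratio_tendsto: "(\<lambda>n. triangles (a n) (Suc n) / (m n)^2) \<longlonglongrightarrow> 0"
proof (rule tendsto_sandwich[OF _ _ tendsto_const[of 0]])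
  show "(\<lambda>n. lowdeg_sq (a n) (Suc n) / (m n)^2) \<longlonglongrightarrow> 0"
    by (rule lowdeg_sq_ratio_tendsto)
  show "\<forall>\<^sub>F n in sequentially. triangles (a n) (Suc n) / (m n)^2 \<le> lowdeg_sq (a n) (Suc n) / (m n)^2"
    by (intro always_eventually allI divide_right_mono triangles_le_lowdeg_sq adj_a) simp
qed (simp add: triangles_nonneg[OF adj_a])

lemma measurable_S: "S n \<in> borel_measurable (PiM {1..} (\<lambda>_. borel))"
  unfolding S_def[abs_def] S_G_def[abs_def] by measurable

lemma S_restrict: "S n (restrict x {1..}) = S n x"
  unfolding S_def S_G_def by (auto intro!: arg_cong2[where f = "(*)"] sum.cong)

end

locale std_graph_seq = std_iid D + graph_seq G for D G
begin

lemma integral_S4: "(\<integral>x. S n x ^ 4 \<partial>M) = qf4 (a n) {1..<Suc n} / (m n)^2"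
proof -
  have "S n x ^ 4 = qf (a n) {1..<Suc n} x ^ 4 / (m n)^2" for x
  proof -
    have "sqrt (m n) ^ 4 = (m n)^2"
      using power_mult[of "sqrt (m n)" 2 2] m_nonneg by simp
    then show ?thesis
      by (simp add: S_eq power_divide)
  qed
  then show ?thesis
    by (simp add: qf4_def)
qed

text \<open>By the degree ordering triangles and \<open>lowdeg_sq\<close> are of order at most
  \<open>m^(3/2)\<close>, and the last term of the exact formula is of order \<open>m\<close>;
  division by \<open>m^2\<close> removes them.\<close>

theorem fourth_moment_asymptotics:
  "(\<lambda>n. (\<integral>x. S n x ^ 4 \<partial>M) - (3 + 6 * (mu 4 - 1) * cherry_ratio n + 12 * cycle_ratio n)) \<longlonglongrightarrow> 0"
proof -
  let ?T = "\<lambda>n. triangles (a n) (Suc n) / (m n)^2" and ?L = "\<lambda>n. lowdeg_sq (a n) (Suc n) / (m n)^2"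
  have "(\<lambda>n. 18 * (mu 3)^2 * ?T n + 3 * (mu 4 - 1) * ?L n + mu 4 * (mu 4 - 3) / m n)
      \<longlonglongrightarrow> 18 * (mu 3)^2 * 0 + 3 * (mu 4 - 1) * 0 + 0"
    by (intro tendsto_intros triangle_ratio_tendsto lowdeg_sq_ratio_tendsto inverse_m_tendsto)
  moreover have "\<forall>\<^sub>F n in sequentially.
      18 * (mu 3)^2 * ?T n + 3 * (mu 4 - 1) * ?L n + mu 4 * (mu 4 - 3) / m n
      = (\<integral>x. S n x ^ 4 \<partial>M) - (3 + 6 * (mu 4 - 1) * cherry_ratio n + 12 * cycle_ratio n)"
    using eventually_m_pos
  proof eventually_elim
    case (elim n)
    have "mu 4 * (mu 4 - 3) / m n = mu 4 * (mu 4 - 3) * m n / (m n)^2" "3 = 3 * (m n)^2 / (m n)^2"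
      using elim by (simp_all add: power2_eq_square)
    then show ?case
      unfolding integral_S4 qf4_eq[OF adj_a] cherry_ratio_def cycle_ratio_def m_def[symmetric]
      by (simp only: add_divide_distrib) simp
  qed
  ultimately show ?thesis
    by (auto intro: Lim_transform_eventually)
qed

end

section \<open>Sixth moments\<close>

text \<open>The variance is left free, since the sixth moment bound is applied to tail-averaged
  variables before they are standardised.\<close>

locale bounded_iid = iid_seq +
  fixes B :: real
  assumes AE_bounded: "AE x in D. \<bar>x\<bar> \<le> B"
    and B_ge_1: "B \<ge> 1"
    and mean_zero: "(\<integral>x. x \<partial>D) = 0"
begin

definition Linf :: "((nat \<Rightarrow> real) \<Rightarrow> real) \<Rightarrow> bool" where
  "Linf f \<longleftrightarrow> f \<in> borel_measurable M \<and> (\<exists>C. AE x in M. \<bar>f x\<bar> \<le> C)"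

lemma Linf_integrable: "Linf f \<Longrightarrow> integrable M f"
  unfolding Linf_def real_norm_def[symmetric] by (blast intro: P.P.integrable_const_bound)

lemma Linf_const: "Linf (\<lambda>_. c)"
  unfolding Linf_def by (auto intro: exI[of _ "\<bar>c\<bar>"])

lemma AE_coord: "AE x in M. \<bar>x k\<bar> \<le> B"
  by (rule P.AE_component) (auto intro: AE_bounded)

lemma Linf_coord: "Linf (\<lambda>x. x k)"
  unfolding Linf_def using AE_coord by auto

lemma Linf_add: assumes "Linf f" "Linf g" shows "Linf (\<lambda>x. f x + g x)"
proof -
  obtain C1 C2 where C: "AE x in M. \<bar>f x\<bar> \<le> C1" "AE x in M. \<bar>g x\<bar> \<le> C2"
    using assms by (auto simp: Linf_def)
  have "AE x in M. \<bar>f x + g x\<bar> \<le> C1 + C2"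
    using C by eventually_elim linarith
  then show ?thesis
    using assms by (auto simp: Linf_def)
qed

lemma Linf_mult: assumes "Linf f" "Linf g" shows "Linf (\<lambda>x. f x * g x)"
proof -
  obtain C1 C2 where C: "AE x in M. \<bar>f x\<bar> \<le> C1" "AE x in M. \<bar>g x\<bar> \<le> C2"
    using assms by (auto simp: Linf_def)
  have "AE x in M. \<bar>f x * g x\<bar> \<le> C1 * C2"
    using C by eventually_elim (auto simp: abs_mult intro!: mult_mono elim: order_trans[OF abs_ge_zero])
  then show ?thesis
    using assms by (auto simp: Linf_def)
qed

lemma Linf_power: "Linf f \<Longrightarrow> Linf (\<lambda>x. f x ^ p)"
  by (induction p) (auto intro: Linf_const Linf_mult)

lemma Linf_sum: "(\<And>i. i \<in> I \<Longrightarrow> Linf (f i)) \<Longrightarrow> Linf (\<lambda>x. \<Sum>i\<in>I. f i x)"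
  by (induction I rule: infinite_finite_induct) (auto intro: Linf_const Linf_add)

lemmas Linf_intros = Linf_power Linf_mult Linf_add Linf_coord Linf_const

lemma Linf_lin: "Linf (lin b I)"
  unfolding lin_def[abs_def] by (intro Linf_sum Linf_intros)

lemma Linf_qf: "Linf (qf a I)"
  unfolding qf_def[abs_def] divide_inverse by (intro Linf_sum Linf_intros)

lemma integrable_D_id: "integrable D (\<lambda>x. x)"
  using AE_bounded by (auto intro!: D.integrable_const_bound[where B = B])

lemma integral_coord_mult:
  assumes "Linf Z" "nodep k Z"
  shows "(\<integral>x. x k * Z x \<partial>M) = 0"
  using hbi_nodep[of "\<lambda>x. x" 0 Z "\<integral>x. Z x \<partial>M" k] integrable_D_id mean_zero Linf_integrable[OF assms(1)] assms(2)
  by (simp add: hbi_iff)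

text \<open>The term linear in \<open>y\<close> is kept because it has mean zero. The terms of order
  three to five are absorbed into the two even ones: 39 = 15 + 24 and 18 = 1 + 17 are the binomial
  coefficients plus what the sum of squares in the proof costs.\<close>

lemma sixth_power_le:
  "(g + y * h) ^ 6 \<le> g ^ 6 + y * (6 * g ^ 5 * h) + 39 * y^2 * (g ^ 4 * h^2) + 18 * y ^ 6 * h ^ 6" for g y h :: real
proof -
  have "g ^ 6 + y * (6 * g ^ 5 * h) + 39 * y^2 * (g ^ 4 * h^2) + 18 * y ^ 6 * h ^ 6 - (g + y * h) ^ 6
      = 10 * (g * (y * h))^2 * (g - y * h)^2 + 14 * (y * h)^2 * (g^2 - (y * h)^2)^2 + 3 * (y * h) ^ 4 * (g - y * h)^2"
    by algebra
  also have "\<dots> \<ge> 0"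
    by simp
  finally show ?thesis
    by simp
qed

text \<open>Young's inequality with exponents 3/2 and 3 for \<open>g^4\<close> and
  \<open>h^2\<close>, with crude constants; the parameter is left free in order to be balanced
  later.\<close>

lemma young_three: "\<beta> > 0 \<Longrightarrow> g ^ 4 * h^2 \<le> \<beta> * g ^ 6 + h ^ 6 / \<beta>^2" for g h \<beta> :: real
proof -
  assume \<beta>: "\<beta> > 0"
  define u v where "u = g^2" and "v = h^2"
  have uv: "u \<ge> 0" "v \<ge> 0"
    by (auto simp: u_def v_def)
  have "u^2 * v \<le> \<beta> * u ^ 3 + v ^ 3 / \<beta>^2"
  proof (cases "v \<le> \<beta> * u")
    case True
    then have "u^2 * v \<le> u^2 * (\<beta> * u)"
      by (intro mult_left_mono) auto
    also have "\<dots> = \<beta> * u ^ 3"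
      by algebra
    also have "\<dots> \<le> \<beta> * u ^ 3 + v ^ 3 / \<beta>^2"
      using uv by simp
    finally show ?thesis .
  next
    case False
    then have "u \<le> v / \<beta>"
      using \<beta> by (simp add: field_simps)
    then have "u^2 * v \<le> (v / \<beta>)^2 * v"
      using uv by (intro mult_right_mono power_mono) auto
    also have "\<dots> = v ^ 3 / \<beta>^2"
      by (simp add: power_divide power2_eq_square power3_eq_cube)
    also have "\<dots> \<le> \<beta> * u ^ 3 + v ^ 3 / \<beta>^2"
      using uv \<beta> by simp
    finally show ?thesis .
  qed
  then show ?thesis
    by (simp add: u_def v_def flip: power_mult)
qed

text \<open>The first summand is what the Young term leaves after its parameter is chosen, the
  second comes from the pure sixth power.\<close>

definition C6 :: real where "C6 = (39 * B^2) ^ 3 + 18 * B ^ 6"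

text \<open>\<open>p\<close> and \<open>q\<close> are proxies for the variances of \<open>g\<close>
  and \<open>h\<close>, which add up. Since the mean of the linear term is zero, all mixed terms fit
  into the room of order \<open>p^2 * q\<close> that the cube of \<open>p + q\<close> provides, so
  the constant does not grow along the induction.\<close>

lemma sixth_moment_step:
  assumes g: "Linf g" "nodep k g" and h: "Linf h" "nodep k h"
    and pq: "p \<ge> 0" "q > 0" and H: "H \<ge> 0"
    and 1: "(\<integral>x. g x ^ 6 \<partial>M) \<le> C6 * H * p ^ 3" and 2: "(\<integral>x. h x ^ 6 \<partial>M) \<le> H * q ^ 3"
  shows "(\<integral>x. (g x + x k * h x) ^ 6 \<partial>M) \<le> C6 * H * (p + q) ^ 3"
proof -
  define b where "b = 39 * B^2"
  have b: "b \<ge> 1"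
    using power_mono[OF B_ge_1, of 2] by (simp add: b_def)
  define g6 h6 where "g6 = (\<integral>x. g x ^ 6 \<partial>M)" and "h6 = (\<integral>x. h x ^ 6 \<partial>M)"
  have bound: "(\<integral>x. (g x + x k * h x) ^ 6 \<partial>M) \<le> g6 + b * (\<beta> * g6 + h6 / \<beta>^2) + 18 * B ^ 6 * h6" if \<beta>: "\<beta> > 0" for \<beta>
  proof -
    let ?u = "\<lambda>x. g x ^ 6 + x k * (6 * g x ^ 5 * h x) + b * (\<beta> * g x ^ 6 + h x ^ 6 * (1 / \<beta>^2)) + 18 * B ^ 6 * h x ^ 6"
    have "(\<integral>x. (g x + x k * h x) ^ 6 \<partial>M) \<le>
        (\<integral>x. ?u x \<partial>M)"
    proof (rule integral_mono_AE)
      show "integrable M (\<lambda>x. (g x + x k * h x) ^ 6)"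
        by (intro Linf_integrable Linf_intros g h)
      show "integrable M ?u"
        by (intro Linf_integrable Linf_intros g h)
      show "AE x in M. (g x + x k * h x) ^ 6 \<le> ?u x"
        using AE_coord[of k]
      proof eventually_elim
        case (elim x)
        have "(x k)^2 \<le> B^2"
          using elim by (simp add: abs_le_square_iff[symmetric])
        then have "39 * (x k)^2 * (g x ^ 4 * (h x)^2) \<le> b * (g x ^ 4 * (h x)^2)"
          unfolding b_def by (intro mult_right_mono mult_left_mono) auto
        also have "\<dots> \<le> b * (\<beta> * g x ^ 6 + h x ^ 6 / \<beta>^2)"
          using b by (intro mult_left_mono young_three \<beta>) auto
        finally have 1: "39 * (x k)^2 * (g x ^ 4 * (h x)^2) \<le> b * (\<beta> * g x ^ 6 + h x ^ 6 / \<beta>^2)" .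
        have "x k ^ 6 = \<bar>x k\<bar> ^ 6"
          by (simp add: power_even_abs)
        also have "\<dots> \<le> B ^ 6"
          using elim by (intro power_mono) auto
        finally have "18 * x k ^ 6 * h x ^ 6 \<le> 18 * B ^ 6 * h x ^ 6"
          by (intro mult_right_mono mult_left_mono) auto
        then show ?case
          using sixth_power_le[of "g x" "x k" "h x"] 1 by simp
      qed
    qed
    also have "\<dots> = g6 + 0 + b * (\<beta> * g6 + h6 * (1 / \<beta>^2)) + 18 * B ^ 6 * h6"
    proof (rule hbi_integral_eq, intro hbi_add hbi_mult_right hbi_mult_left)
      show "hbi M (\<lambda>x. g x ^ 6) g6" "hbi M (\<lambda>x. h x ^ 6) h6"
        unfolding g6_def h6_def by (intro hbi_integral Linf_integrable Linf_intros g h)+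
      then show "hbi M (\<lambda>x. g x ^ 6) g6" "hbi M (\<lambda>x. h x ^ 6) h6" .
      show "hbi M (\<lambda>x. x k * (6 * g x ^ 5 * h x)) 0"
        unfolding hbi_iff
        by (intro conjI Linf_integrable integral_coord_mult Linf_intros g h) (use g h in \<open>simp add: nodep_def\<close>)
    qed
    finally show ?thesis
      by simp
  qed
  have g60: "g6 \<ge> 0" and h60: "h6 \<ge> 0"
    by (auto simp: g6_def h6_def)
  have C6: "C6 = b ^ 3 + 18 * B ^ 6"
    by (simp add: C6_def b_def)
  have B6: "B ^ 6 \<ge> 0"
    by simp
  have h6: "18 * B ^ 6 * h6 \<le> 18 * B ^ 6 * (H * q ^ 3)"
    using 2 by (intro mult_left_mono) (auto simp: h6_def)
  show ?thesis
  proof (cases "p = 0")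
    \<comment> \<open>There is no room for a mixed term here, but \<open>p = 0\<close> forces
      \<open>g6 = 0\<close>, and the parameter 1 serves.\<close>
    case True
    then have "g6 = 0"
      using 1 g60 unfolding g6_def by (intro antisym) simp_all
    then have "(\<integral>x. (g x + x k * h x) ^ 6 \<partial>M) \<le> b * h6 + 18 * B ^ 6 * h6"
      using bound[of 1] by simp
    also have "\<dots> \<le> b ^ 3 * h6 + 18 * B ^ 6 * h6"
      using h60 b power_increasing[of 1 3 b] by (intro add_right_mono mult_right_mono) auto
    also have "\<dots> = C6 * h6"
      by (simp add: C6 algebra_simps)
    also have "\<dots> \<le> C6 * (H * q ^ 3)"
      using 2 b by (intro mult_left_mono) (auto simp: h6_def C6)
    finally show ?thesis
      using True by simp
  next
    case False
    with pq have p: "p > 0"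
      by simp
    \<comment> \<open>Balances the two halves of Young's inequality: both become at most
      \<open>C6 * H * p^2 * q\<close>, of which the cube of \<open>p + q\<close> contains
      three.\<close>
    define \<beta> where "\<beta> = q / (b * p)"
    have \<beta>: "\<beta> > 0"
      using p pq b by (simp add: \<beta>_def)
    have "b * (\<beta> * g6) \<le> b * (\<beta> * (C6 * H * p ^ 3))"
      using 1 b \<beta> by (intro mult_left_mono) (auto simp: g6_def)
    also have "\<dots> = C6 * H * p^2 * q"
      using p pq b by (simp add: \<beta>_def power2_eq_square power3_eq_cube field_simps)
    finally have i: "b * (\<beta> * g6) \<le> C6 * H * p^2 * q" .
    have "b * (h6 / \<beta>^2) \<le> b * (H * q ^ 3 / \<beta>^2)"
      using 2 b by (intro mult_left_mono divide_right_mono) (auto simp: h6_def)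
    also have "\<dots> = b ^ 3 * H * p^2 * q"
      using p pq b by (simp add: \<beta>_def power2_eq_square power3_eq_cube field_simps)
    also have "\<dots> \<le> C6 * H * p^2 * q"
      using pq H by (intro mult_right_mono) (auto simp: C6)
    finally have ii: "b * (h6 / \<beta>^2) \<le> C6 * H * p^2 * q" .
    have "18 * B ^ 6 * (H * q ^ 3) \<le> C6 * (H * q ^ 3)"
      using pq H b by (intro mult_right_mono) (auto simp: C6)
    then have iii: "18 * B ^ 6 * h6 \<le> C6 * H * q ^ 3"
      using h6 by simp
    have iv: "0 \<le> C6 * H * p^2 * q" "0 \<le> C6 * H * p * q^2"
      using pq H b B6 by (auto simp: C6 intro!: mult_nonneg_nonneg add_nonneg_nonneg)
    have "(\<integral>x. (g x + x k * h x) ^ 6 \<partial>M) \<le> g6 + (b * (\<beta> * g6) + b * (h6 / \<beta>^2)) + 18 * B ^ 6 * h6"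
      using bound[OF \<beta>] by (simp add: distrib_left)
    also have "\<dots> \<le> C6 * H * p ^ 3 + (C6 * H * p^2 * q + C6 * H * p^2 * q) + C6 * H * q ^ 3"
      by (intro add_mono 1[folded g6_def] i ii iii)
    also have "\<dots> \<le> C6 * H * p ^ 3 + 3 * (C6 * H * p^2 * q) + 3 * (C6 * H * p * q^2) + C6 * H * q ^ 3"
      using iv by linarith
    also have "\<dots> = C6 * H * (p + q) ^ 3"
      by algebra
    finally show ?thesis .
  qed
qed

lemma C6_nonneg: "C6 \<ge> 0"
  by (simp add: C6_def)

lemma sixth_moment_lin:
  assumes "finite I" "\<And>i. b i = 0 \<or> b i = 1"
  shows "(\<integral>x. lin b I x ^ 6 \<partial>M) \<le> C6 * (\<Sum>i\<in>I. b i) ^ 3"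
  using assms(1)
proof (induction I rule: finite_induct)
  case (insert k I)
  show ?case
  proof (cases "b k = 0")
    case True
    then show ?thesis
      using insert by (simp add: lin_insert)
  next
    case False
    then have bk: "b k = 1"
      using assms(2)[of k] by auto
    have "(\<integral>x. (lin b I x + x k * 1) ^ 6 \<partial>M) \<le> C6 * 1 * ((\<Sum>i\<in>I. b i) + 1) ^ 3"
    proof (rule sixth_moment_step)
      show "0 \<le> (\<Sum>i\<in>I. b i)"
        using assms(2) by (intro sum_nonneg) (metis order_refl zero_le_one)
    qed (use insert P.P.prob_space in \<open>auto simp: nodep_def intro: Linf_lin Linf_const\<close>)
    then show ?thesis
      using insert bk by (simp add: lin_insert add.commute)
  qed
qed simp

text \<open>The step is used at two levels: for linear forms with \<open>H = 1\<close>, then for the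
  quadratic form with \<open>H = C6\<close>. Vertices without earlier neighbours are treated apart,
  because the step divides by a power of \<open>q\<close>.\<close>

lemma sixth_moment_qf:
  assumes "adj a"
  shows "(\<integral>x. qf a {1..<Suc n} x ^ 6 \<partial>M) \<le> C6 * C6 * nedges a (Suc n) ^ 3"
proof (induction n)
  case (Suc n)
  have eq: "qf a {1..<Suc (Suc n)} x = qf a {1..<Suc n} x + x (Suc n) * lin (a (Suc n)) {1..<Suc n} x" for x
    by (subst insert_interval) (use adj_weights[OF assms] in \<open>auto simp: qf_insert\<close>)
  show ?case
  proof (cases "lowdeg a (Suc n) = 0")
    case True
    then have "a (Suc n) i = 0" if "i \<in> {1..<Suc n}" for i
      using that adj_nonneg[OF assms] unfolding lowdeg_def by (subst (asm) sum_nonneg_eq_0_iff) auto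
    then have "lin (a (Suc n)) {1..<Suc n} x = 0" for x
      unfolding lin_def by (intro sum.neutral) simp
    then show ?thesis
      unfolding eq nedges_Suc[OF adj_weights[OF assms], of "Suc n", simplified]
      using Suc True by simp
  next
    case False
    then have pos: "lowdeg a (Suc n) > 0"
      using lowdeg_nonneg[OF assms, of "Suc n"] by simp
    have "1 \<le> Suc n" by simp
    show ?thesis
      unfolding eq nedges_Suc[OF adj_weights[OF assms] \<open>1 \<le> Suc n\<close>]
    proof (rule sixth_moment_step)
      show "(\<integral>x. lin (a (Suc n)) {1..<Suc n} x ^ 6 \<partial>M) \<le> C6 * lowdeg a (Suc n) ^ 3"
        unfolding lowdeg_def using assms by (intro sixth_moment_lin) (auto simp: adj_def)
    qed (use Suc pos C6_nonneg nedges_nonneg[OF assms] in \<open>auto simp: nodep_def intro: Linf_lin Linf_qf\<close>)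
  qed
qed simp

end

section \<open>The stopped martingale\<close>

lemma norm_integral_le:
  fixes f :: "'a \<Rightarrow> 'b :: {banach, second_countable_topology}"
  assumes "integrable M f" "integrable M g" "\<And>x. norm (f x) \<le> g x"
  shows "norm (\<integral>x. f x \<partial>M) \<le> (\<integral>x. g x \<partial>M)"
  using order_trans[OF integral_norm_bound integral_mono[OF integrable_norm[OF assms(1)] assms(2,3)]] .

text \<open>Replaces Cauchy-Schwarz: integrated against a second moment of at most
  \<open>W^2\<close>, it bounds the first absolute moment by \<open>W\<close>.\<close>

lemma abs_le_mean_square:
  fixes v W :: real
  assumes "W > 0" shows "\<bar>v\<bar> \<le> (W + v^2 * (1 / W)) / 2"
proof -
  have "0 \<le> (W - \<bar>v\<bar>)^2 / W"
    using assms by simp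
  also have "\<dots> = W + v^2 * (1 / W) - 2 * \<bar>v\<bar>"
    using assms by (simp add: power2_diff power2_eq_square field_simps)
  finally show ?thesis
    by simp
qed

lemma exp_neg_approx: "\<bar>exp (- x) - (1 - x)\<bar> \<le> x^2 / 2" if "x \<ge> 0" for x :: real
proof -
  have "1 - x \<le> exp (- x)"
    using exp_ge_add_one_self[of "- x"] by simp
  moreover have "exp (- x) \<le> 1 - x + x^2 / 2"
  proof -
    have "\<exists>z. 0 \<le> z \<and> 1 - x + x^2 / 2 - exp (- x) = x * (- 1 + z + exp (- z))"
    proof (cases "x = 0")
      case False
      then have "0 < x" using that by simp
      moreover have "((\<lambda>x. 1 - x + x^2 / 2 - exp (- x)) has_real_derivative - 1 + z + exp (- z)) (at z)" for z :: real
        by (auto intro!: derivative_eq_intros)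
      ultimately obtain z where "0 < z" "1 - x + x^2 / 2 - exp (- x) - (1 - 0 + 0^2 / 2 - exp (- 0)) = (x - 0) * (- 1 + z + exp (- z))"
        using MVT2[of 0 x "\<lambda>x. 1 - x + x^2 / 2 - exp (- x)" "\<lambda>z. - 1 + z + exp (- z)"] by blast
      then show ?thesis
        by (intro exI[of _ z]) simp
    qed (intro exI[of _ 0], simp)
    then obtain z where z: "0 \<le> z" "1 - x + x^2 / 2 - exp (- x) = x * (- 1 + z + exp (- z))"
      by blast
    have "0 \<le> x * (- 1 + z + exp (- z))"
      using exp_ge_add_one_self[of "- z"] that by (intro mult_nonneg_nonneg) auto
    then show ?thesis
      using z(2) by simp
  qed
  ultimately show ?thesis
    using zero_le_power2[of x] by (auto simp: abs_le_iff)
qed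

lemma abs_exp_minus_one_le: "\<bar>exp u - 1\<bar> \<le> \<bar>u\<bar> * exp \<bar>u\<bar>" for u :: real
proof (cases "u \<ge> 0")
  case True
  have "1 - u \<le> exp (- u)"
    using exp_ge_add_one_self[of "- u"] by simp
  then have "(1 - u) * exp u \<le> exp (- u) * exp u"
    by (intro mult_right_mono) auto
  then show ?thesis
    using True by (simp add: algebra_simps exp_minus)
next
  case False
  have "1 + u \<le> exp u"
    by (rule exp_ge_add_one_self)
  moreover have "exp u \<le> 1"
    using False by simp
  ultimately have "\<bar>exp u - 1\<bar> \<le> \<bar>u\<bar> * 1"
    using False unfolding abs_le_iff by linarith
  also have "\<dots> \<le> \<bar>u\<bar> * exp \<bar>u\<bar>"
    by (intro mult_left_mono) auto
  finally show ?thesis .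
qed

locale bounded_std = std_iid D + bounded_iid D B for D B
begin

text \<open>Both \<open>char D s\<close> and the normal characteristic function agree with
  \<open>1 - s^2 / 2\<close> up to higher order. The bound
  \<open>\<bar>x\<bar> ^ 3 \<le> B * x^2\<close> reduces the third absolute moment to the
  variance.\<close>

lemma char_bound:
  "cmod (char D s * complex_of_real (exp (s^2 / 2)) - 1) \<le> exp (s^2 / 2) * (B * \<bar>s\<bar> ^ 3 / 6 + s ^ 4 / 8)"
proof -
  have D2: "integrable D (\<lambda>x. x^2)" and D1: "integrable D (\<lambda>x. x)"
    using hbi_mu[of 2] hbi_mu[of 1] by (auto simp: hbi_iff)
  have 1: "cmod (char D s - complex_of_real (1 - s^2 / 2)) \<le> (s^2 / 6) * D.expectation (\<lambda>x. min (6 * x^2) (\<bar>s\<bar> * \<bar>x\<bar> ^ 3))"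
    using D.char_approx3[of 1 s] D1 D2 mean_0 variance_1 by simp
  have "D.expectation (\<lambda>x. min (6 * x^2) (\<bar>s\<bar> * \<bar>x\<bar> ^ 3)) \<le> D.expectation (\<lambda>x. \<bar>s\<bar> * B * x^2)"
  proof (rule integral_mono_AE)
    show "AE x in D. min (6 * x^2) (\<bar>s\<bar> * \<bar>x\<bar> ^ 3) \<le> \<bar>s\<bar> * B * x^2"
      using AE_bounded
    proof eventually_elim
      case (elim x)
      have "\<bar>s\<bar> * \<bar>x\<bar> ^ 3 = \<bar>s\<bar> * (\<bar>x\<bar> * x^2)"
        by (simp add: power3_eq_cube power2_eq_square)
      also have "\<dots> \<le> \<bar>s\<bar> * (B * x^2)"
        using elim by (intro mult_left_mono mult_right_mono) auto
      finally show ?case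
        by (simp add: mult.assoc)
    qed
    show "integrable D (\<lambda>x. \<bar>s\<bar> * B * x^2)"
      using D2 by simp
    show "integrable D (\<lambda>x. min (6 * x^2) (\<bar>s\<bar> * \<bar>x\<bar> ^ 3))"
      by (rule integrable_bound[where f = "\<lambda>x. 6 * x^2"]) (use D2 in auto)
  qed
  also have "\<dots> = \<bar>s\<bar> * B"
    using variance_1 by simp
  finally have 2: "D.expectation (\<lambda>x. min (6 * x^2) (\<bar>s\<bar> * \<bar>x\<bar> ^ 3)) \<le> \<bar>s\<bar> * B" .
  have "cmod (char D s - complex_of_real (1 - s^2 / 2)) \<le> s^2 / 6 * (\<bar>s\<bar> * B)"
    using 1 mult_left_mono[OF 2, of "s^2 / 6"] by simp
  also have "\<dots> = B * \<bar>s\<bar> ^ 3 / 6"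
    by (simp add: power3_eq_cube power2_eq_square flip: abs_mult)
  finally have 3: "cmod (char D s - complex_of_real (1 - s^2 / 2)) \<le> B * \<bar>s\<bar> ^ 3 / 6" .
  have "cmod (complex_of_real (1 - s^2 / 2) - complex_of_real (exp (- (s^2 / 2)))) = \<bar>exp (- (s^2 / 2)) - (1 - s^2 / 2)\<bar>"
    unfolding of_real_diff[symmetric] norm_of_real by (rule abs_minus_commute)
  also have "\<dots> \<le> (s^2 / 2)^2 / 2"
    by (rule exp_neg_approx) simp
  also have "\<dots> = s ^ 4 / 8"
    by (simp add: power_divide)
  finally have 4: "cmod (complex_of_real (1 - s^2 / 2) - complex_of_real (exp (- (s^2 / 2)))) \<le> s ^ 4 / 8" .
  have 5: "cmod (char D s - complex_of_real (exp (- (s^2 / 2)))) \<le> B * \<bar>s\<bar> ^ 3 / 6 + s ^ 4 / 8"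
    using norm_triangle_mono[OF 3 4] by simp
  have "char D s * complex_of_real (exp (s^2 / 2)) - 1 = complex_of_real (exp (s^2 / 2)) * (char D s - complex_of_real (exp (- (s^2 / 2))))"
    by (simp add: right_diff_distrib exp_minus mult.commute)
  also have "cmod \<dots> = exp (s^2 / 2) * cmod (char D s - complex_of_real (exp (- (s^2 / 2))))"
    by (simp only: norm_mult norm_of_real abs_exp_cancel)
  also have "\<dots> \<le> exp (s^2 / 2) * (B * \<bar>s\<bar> ^ 3 / 6 + s ^ 4 / 8)"
    by (intro mult_left_mono 5) auto
  finally show ?thesis .
qed

end

text \<open>Third powers of the increments are traded for second powers, whose sum is bounded by
  stopping, and fourth powers, whose sum tends to zero; \<eta> tunes the exchange.\<close>

lemma cube_le: "\<bar>s\<bar> ^ 3 \<le> (\<eta> * s^2 + s ^ 4 / \<eta>) / 2" if "\<eta> > 0" for s \<eta> :: real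
proof -
  have "0 \<le> (\<eta> - \<bar>s\<bar>)^2 * s^2 / \<eta>"
    using that by simp
  also have "(\<eta> - \<bar>s\<bar>)^2 * s^2 / \<eta> = \<eta> * s^2 + s ^ 4 / \<eta> - 2 * \<bar>s\<bar> ^ 3"
  proof -
    have "(\<eta> - \<bar>s\<bar>)^2 * s^2 = (\<eta> - \<bar>s\<bar>)^2 * \<bar>s\<bar>^2" "s ^ 4 = \<bar>s\<bar> ^ 4" "s^2 = \<bar>s\<bar>^2"
      by (simp_all add: power_even_abs)
    then show ?thesis
      using that by (simp only:) (simp add: field_simps power2_eq_square power3_eq_cube power4_eq_xxxx del: abs_mult_self_eq)
  qed
  finally show ?thesis by simp
qed

abbreviation gauss :: "real \<Rightarrow> complex" where "gauss t \<equiv> complex_of_real (exp (- (t^2 / 2)))"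

text \<open>\<open>h_nodep\<close> says that \<open>h k\<close> ignores the coordinates from
  \<open>k\<close> on, which is predictability for the natural filtration.\<close>

locale predictable = bounded_std +
  fixes h :: "nat \<Rightarrow> (nat \<Rightarrow> real) \<Rightarrow> real" and t :: real
  assumes h_measurable [measurable]: "\<And>k. h k \<in> borel_measurable M"
    and h_nodep: "\<And>j k. k \<le> j \<Longrightarrow> nodep j (h k)"
begin

definition V where "V n x = (\<Sum>k\<in>{1..n}. (h k x)^2)"
definition T where "T n x = (\<Sum>k\<in>{1..n}. x k * h k x)"
text \<open>The martingale is stopped before its quadratic variation exceeds 2.\<close>

definition hs where "hs k x = (if V k x \<le> 2 then h k x else 0)"
definition Vs where "Vs n x = (\<Sum>k\<in>{1..n}. (hs k x)^2)"
definition Ts where "Ts n x = (\<Sum>k\<in>{1..n}. x k * hs k x)"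
text \<open>The exponential of the stopped martingale with its Gaussian compensator: for standard
  normal variables it would be an exact martingale of mean 1.\<close>

definition Z where
  "Z n x = iexp (t * Ts n x) * complex_of_real (exp (t^2 * Vs n x / 2))"

lemma measurables [measurable]: "V n \<in> borel_measurable M" "T n \<in> borel_measurable M" "hs n \<in> borel_measurable M"
  "Vs n \<in> borel_measurable M" "Ts n \<in> borel_measurable M" "Z n \<in> borel_measurable M"
proof -
  show [measurable]: "V n \<in> borel_measurable M" for n
    unfolding V_def[abs_def] by measurable
  show "T n \<in> borel_measurable M"
    unfolding T_def[abs_def] by measurable
  show [measurable]: "hs n \<in> borel_measurable M" for n
    unfolding hs_def[abs_def] by measurable
  show [measurable]: "Vs n \<in> borel_measurable M"
    unfolding Vs_def[abs_def] by measurable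
  show [measurable]: "Ts n \<in> borel_measurable M"
    unfolding Ts_def[abs_def] by measurable
  show "Z n \<in> borel_measurable M"
    unfolding Z_def[abs_def] by measurable
qed

lemma upd_simps:
  assumes "k \<le> j"
  shows "h k (x(j := y)) = h k x" "V k (x(j := y)) = V k x" "hs k (x(j := y)) = hs k x"
    "Vs k (x(j := y)) = Vs k x" "k < j \<Longrightarrow> Ts k (x(j := y)) = Ts k x" "k < j \<Longrightarrow> Z k (x(j := y)) = Z k x"
proof -
  have h: "h k (x(j := y)) = h k x" if "k \<le> j" for k
    using h_nodep[OF that] by (simp add: nodep_def)
  have V: "V k (x(j := y)) = V k x" if "k \<le> j" for k
    unfolding V_def using that by (intro sum.cong) (auto simp: h)
  have hs: "hs k (x(j := y)) = hs k x" if "k \<le> j" for k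
    using that by (simp add: hs_def h V)
  have Vs: "Vs k (x(j := y)) = Vs k x" if "k \<le> j" for k
    unfolding Vs_def using that by (intro sum.cong) (auto simp: hs)
  have Ts: "Ts k (x(j := y)) = Ts k x" if "k < j" for k
    unfolding Ts_def using that by (intro sum.cong) (auto simp: hs)
  show "h k (x(j := y)) = h k x" "V k (x(j := y)) = V k x" "hs k (x(j := y)) = hs k x"
    "Vs k (x(j := y)) = Vs k x" "k < j \<Longrightarrow> Ts k (x(j := y)) = Ts k x" "k < j \<Longrightarrow> Z k (x(j := y)) = Z k x"
    using assms by (auto simp: h V hs Vs Ts Z_def)
qed

text \<open>\<open>V\<close> is nondecreasing in \<open>n\<close>. So \<open>V n x \<le> 2\<close>
  means that no increment has been dropped so far, and otherwise the last increment is zero and the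
  bound is inherited.\<close>

lemma stopped: "Vs n x \<le> 2 \<and> (V n x \<le> 2 \<longrightarrow> Vs n x = V n x \<and> Ts n x = T n x)"
proof (induction n)
  case 0
  then show ?case by (simp add: Vs_def V_def Ts_def T_def)
next
  case (Suc n)
  have V: "V (Suc n) x = V n x + (h (Suc n) x)^2"
    and Vs: "Vs (Suc n) x = Vs n x + (hs (Suc n) x)^2"
    and T: "T (Suc n) x = T n x + x (Suc n) * h (Suc n) x" "Ts (Suc n) x = Ts n x + x (Suc n) * hs (Suc n) x"
    by (simp_all add: V_def Vs_def T_def Ts_def)
  show ?case
  proof (cases "V (Suc n) x \<le> 2")
    case True
    then have "V n x \<le> 2"
      using V zero_le_power2[of "h (Suc n) x"] by linarith
    then show ?thesis
      using Suc True V Vs T by (simp add: hs_def)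
  next
    case False
    then show ?thesis
      using Suc Vs by (simp add: hs_def)
  qed
qed

lemma Vs_nonneg: "0 \<le> Vs n x"
  by (auto simp: Vs_def intro: sum_nonneg)

lemma hs_sq_le: assumes "k \<ge> 1" shows "(hs k x)^2 \<le> 2"
proof -
  have "(hs k x)^2 \<le> Vs k x"
    unfolding Vs_def using assms by (intro member_le_sum) auto
  then show ?thesis
    using stopped[of k x] by linarith
qed

lemma norm_Z: "cmod (Z n x) \<le> exp (t^2)"
proof -
  have "cmod (Z n x) = exp (t^2 * Vs n x / 2)"
    by (simp add: Z_def norm_mult)
  also have "\<dots> \<le> exp (t^2)"
    using mult_left_mono[of "Vs n x" 2 "t^2"] stopped[of n x] by simp
  finally show ?thesis .
qed

lemma integrable_Z: "integrable M (Z n)"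
  by (rule P.P.integrable_const_bound[where B = "exp (t^2)"]) (auto simp: norm_Z)

lemma Z_Suc: "Z (Suc n) x = Z n x * (iexp (t * hs (Suc n) x * x (Suc n)) * complex_of_real (exp ((t * hs (Suc n) x)^2 / 2)))"
proof -
  have "\<i> * complex_of_real (t * Ts (Suc n) x) = \<i> * complex_of_real (t * Ts n x) + \<i> * complex_of_real (t * hs (Suc n) x * x (Suc n))"
    by (simp add: Ts_def algebra_simps)
  moreover have "t^2 * Vs (Suc n) x / 2 = t^2 * Vs n x / 2 + (t * hs (Suc n) x)^2 / 2"
    by (simp add: Vs_def algebra_simps power_mult_distrib add_divide_distrib)
  ultimately show ?thesis
    unfolding Z_def by (simp only: exp_add of_real_mult mult_ac)
qed

lemma hs_power4_le: "hs k x ^ 4 \<le> h k x ^ 4"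
  by (auto simp: hs_def)

text \<open>Integrating out coordinate \<open>Suc n\<close> turns the new factor of \<open>Z\<close>
  into \<open>char D s * exp (s^2 / 2)\<close>, which is close to 1. The second moment of the
  stopped increment is retained, because these sum to at most 2; in the fourth moment stopping may
  be forgotten.\<close>

lemma Z_increment:
  assumes \<eta>: "\<eta> > 0" and h4: "integrable M (\<lambda>x. h (Suc n) x ^ 4)"
  shows "cmod ((\<integral>x. Z (Suc n) x \<partial>M) - (\<integral>x. Z n x \<partial>M))
    \<le> exp (2 * t^2) * (B * \<eta> * t^2 / 12 * (\<integral>x. (hs (Suc n) x)^2 \<partial>M) + (B / (12 * \<eta>) + 1 / 8) * t ^ 4 * (\<integral>x. h (Suc n) x ^ 4 \<partial>M))"
    (is "_ \<le> ?rhs")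
proof -
  let ?e = "\<lambda>x. B * \<eta> * t^2 / 12 * (hs (Suc n) x)^2 + (B / (12 * \<eta>) + 1 / 8) * t ^ 4 * h (Suc n) x ^ 4"
  let ?k = "Suc n"
  define s where "s x = t * hs ?k x" for x
  have [measurable]: "s \<in> borel_measurable M"
    unfolding s_def by measurable
  have "(\<integral>x. Z ?k x \<partial>M) - (\<integral>x. Z n x \<partial>M) = (\<integral>x. Z ?k x - Z n x \<partial>M)"
    by (simp add: integrable_Z)
  also have "\<dots> = (\<integral>x. \<integral>y. Z ?k (x(?k := y)) - Z n (x(?k := y)) \<partial>D \<partial>M)"
    by (rule integral_upd) (simp add: integrable_Z)
  also have "\<dots> = (\<integral>x. Z n x * (char D (s x) * complex_of_real (exp ((s x)^2 / 2)) - 1) \<partial>M)"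
  proof (rule Bochner_Integration.integral_cong[OF refl])
    fix x
    have int: "integrable D (\<lambda>y. iexp (s x * y))"
      by (rule D.integrable_iexp) auto
    have "(\<integral>y. Z ?k (x(?k := y)) - Z n (x(?k := y)) \<partial>D) = (\<integral>y. Z n x * (iexp (s x * y) * complex_of_real (exp ((s x)^2 / 2)) - 1) \<partial>D)"
      by (simp add: Z_Suc upd_simps s_def algebra_simps)
    also have "\<dots> = Z n x * (char D (s x) * complex_of_real (exp ((s x)^2 / 2)) - 1)"
      using int D.prob_space by (simp add: char_def)
    finally show "(\<integral>y. Z ?k (x(?k := y)) - Z n (x(?k := y)) \<partial>D) = Z n x * (char D (s x) * complex_of_real (exp ((s x)^2 / 2)) - 1)" .
  qed
  finally have eq: "(\<integral>x. Z ?k x \<partial>M) - (\<integral>x. Z n x \<partial>M)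
      = (\<integral>x. Z n x * (char D (s x) * complex_of_real (exp ((s x)^2 / 2)) - 1) \<partial>M)" .
  have "cmod ((\<integral>x. Z ?k x \<partial>M) - (\<integral>x. Z n x \<partial>M)) \<le> (\<integral>x. exp (2 * t^2) * (?e x) \<partial>M)"
    unfolding eq
  proof (rule norm_integral_le)
    have bound: "cmod (Z n x * (char D (s x) * complex_of_real (exp ((s x)^2 / 2)) - 1))
      \<le> exp (2 * t^2) * (?e x)" for x
    proof -
      \<comment> \<open>The stopping level 2 enters here: this exponent and the bound on
        \<open>Z\<close> contribute a factor \<open>exp (t^2)\<close> each.\<close>
      have s2: "(s x)^2 / 2 \<le> t^2"
        using mult_left_mono[OF hs_sq_le[of ?k x], of "t^2"] by (simp add: s_def power_mult_distrib)
      have "B * \<bar>s x\<bar> ^ 3 / 6 + s x ^ 4 / 8 \<le> B * ((\<eta> * (s x)^2 + s x ^ 4 / \<eta>) / 2) / 6 + s x ^ 4 / 8"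
        using B_ge_1 by (intro add_right_mono divide_right_mono mult_left_mono cube_le \<eta>) auto
      also have "\<dots> = B * \<eta> / 12 * (s x)^2 + (B / (12 * \<eta>) + 1 / 8) * s x ^ 4"
        using \<eta> by (simp add: field_simps)
      also have "\<dots> = B * \<eta> * t^2 / 12 * (hs ?k x)^2 + (B / (12 * \<eta>) + 1 / 8) * t ^ 4 * hs ?k x ^ 4"
        by (simp add: s_def power_mult_distrib)
      also have "\<dots> \<le> ?e x"
        using B_ge_1 \<eta> by (intro add_left_mono mult_left_mono hs_power4_le) auto
      finally have b: "B * \<bar>s x\<bar> ^ 3 / 6 + s x ^ 4 / 8 \<le> ?e x" .
      have "cmod (Z n x * (char D (s x) * complex_of_real (exp ((s x)^2 / 2)) - 1)) \<le> exp (t^2) * (exp ((s x)^2 / 2) * (B * \<bar>s x\<bar> ^ 3 / 6 + s x ^ 4 / 8))"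
        unfolding norm_mult by (intro mult_mono norm_Z char_bound) auto
      also have "\<dots> \<le> exp (t^2) * (exp (t^2) * (?e x))"
        using B_ge_1 s2 b by (intro mult_left_mono mult_mono) (auto intro!: add_nonneg_nonneg)
      finally show ?thesis
        by (simp only: mult_2 exp_add mult.assoc)
    qed
    then show "cmod (Z n x * (char D (s x) * complex_of_real (exp ((s x)^2 / 2)) - 1))
      \<le> exp (2 * t^2) * (?e x)" for x .
    have hs2: "integrable M (\<lambda>x. (hs ?k x)^2)"
      by (rule P.P.integrable_const_bound[where B = 2]) (auto simp: hs_sq_le)
    show i: "integrable M (\<lambda>x. exp (2 * t^2) * (?e x))"
      using hs2 h4 by (intro integrable_mult_right Bochner_Integration.integrable_add)
    have "char D \<in> borel_measurable borel"
      by (intro borel_measurable_continuous_onI continuous_at_imp_continuous_on ballI D.isCont_char)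
    then have [measurable]: "(\<lambda>x. char D (s x)) \<in> borel_measurable M"
      by measurable
    show "integrable M (\<lambda>x. Z n x * (char D (s x) * complex_of_real (exp ((s x)^2 / 2)) - 1))"
      by (rule integrable_bound[OF i]) (auto intro!: AE_I2 order_trans[OF bound abs_ge_self] simp del: norm_mult times_divide_eq_left times_divide_eq_right)
  qed
  also have "\<dots> = ?rhs"
  proof -
    have "integrable M (\<lambda>x. (hs ?k x)^2)"
      by (rule P.P.integrable_const_bound[where B = 2]) (auto simp: hs_sq_le)
    then show ?thesis
      using h4 by simp
  qed
  finally show ?thesis .
qed

abbreviation lyapunov where "lyapunov n \<equiv> \<Sum>k\<in>{1..n}. \<integral>x. h k x ^ 4 \<partial>M"

text \<open>The increments telescope from \<open>Z 0 = 1\<close>; the second moments of the stopped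
  increments sum to the mean of \<open>Vs\<close>, at most 2, which turns 12 into 6.\<close>

lemma integral_Z_bound:
  assumes \<eta>: "\<eta> > 0" and h4: "\<And>k. integrable M (\<lambda>x. h k x ^ 4)"
  shows "cmod ((\<integral>x. Z n x \<partial>M) - 1)
    \<le> exp (2 * t^2) * (B * \<eta> * t^2 / 6 + (B / (12 * \<eta>) + 1 / 8) * t ^ 4 * lyapunov n)"
proof -
  have hs2: "integrable M (\<lambda>x. (hs k x)^2)" if "k \<ge> 1" for k
    by (rule P.P.integrable_const_bound[where B = 2]) (use that in \<open>auto intro!: AE_I2 hs_sq_le\<close>)
  have Vs: "(\<integral>x. Vs n x \<partial>M) = (\<Sum>k\<in>{1..n}. \<integral>x. (hs k x)^2 \<partial>M)"
    unfolding Vs_def by (intro Bochner_Integration.integral_sum hs2) auto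
  have "cmod ((\<integral>x. Z n x \<partial>M) - 1)
    \<le> (\<Sum>k\<in>{1..n}. exp (2 * t^2) * (B * \<eta> * t^2 / 12 * (\<integral>x. (hs k x)^2 \<partial>M) + (B / (12 * \<eta>) + 1 / 8) * t ^ 4 * (\<integral>x. h k x ^ 4 \<partial>M)))"
  proof (induction n)
    case 0
    then show ?case
      using P.P.prob_space by (simp add: Z_def Ts_def Vs_def)
  next
    case (Suc n)
    show ?case
      using norm_triangle_mono[OF Z_increment[OF \<eta> h4[of "Suc n"]] Suc] by (simp add: add.commute)
  qed
  also have "\<dots> = exp (2 * t^2) * (B * \<eta> * t^2 / 12 * (\<integral>x. Vs n x \<partial>M) + (B / (12 * \<eta>) + 1 / 8) * t ^ 4 * lyapunov n)"
    unfolding Vs by (simp only: sum_distrib_left[symmetric] sum.distrib)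
  also have "\<dots> \<le> exp (2 * t^2) * (B * \<eta> * t^2 / 12 * 2 + (B / (12 * \<eta>) + 1 / 8) * t ^ 4 * lyapunov n)"
  proof (intro mult_left_mono add_right_mono)
    show "(\<integral>x. Vs n x \<partial>M) \<le> 2"
      using stopped Vs_nonneg by (intro P.P.integral_le_const P.P.integrable_const_bound[where B = 2]) auto
  qed (use B_ge_1 \<eta> in auto)
  finally show ?thesis
    by (simp add: mult.assoc)
qed

text \<open>\<open>gauss t * Z\<close> differs from the exponential of the unstopped martingale only
  as far as the variation differs from 1, and \<open>Z\<close> has mean close to 1. \<open>W\<close>
  is a positive bound for the L2 distance of \<open>V\<close> from 1.\<close>

theorem char_martingale_bound:
  assumes \<eta>: "\<eta> > 0" and h4: "\<And>k. integrable M (\<lambda>x. h k x ^ 4)"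
    and V2: "integrable M (\<lambda>x. (V n x - 1)^2)" and W: "(\<integral>x. (V n x - 1)^2 \<partial>M) \<le> W^2" "W > 0"
  shows "cmod ((\<integral>x. iexp (t * T n x) \<partial>M) - gauss t)
    \<le> exp (2 * t^2) * (B * \<eta> * t^2 / 6 + (B / (12 * \<eta>) + 1 / 8) * t ^ 4 * lyapunov n)
      + (2 + t^2 / 2 * exp (t^2 / 2)) * W"
proof -
  let ?E = "exp (2 * t^2) * (B * \<eta> * t^2 / 6 + (B / (12 * \<eta>) + 1 / 8) * t ^ 4 * lyapunov n)"
  let ?c = "2 + t^2 / 2 * exp (t^2 / 2)"
  have int: "integrable M (\<lambda>x. iexp (t * T n x))"
    by (rule P.P.integrable_const_bound[where B = 1]) auto
  have pw: "cmod (iexp (t * T n x) - gauss t * Z n x) \<le> ?c * ((W + (V n x - 1)^2 * (1 / W)) / 2)" for x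
  proof -
    have "exp (- (t^2 / 2)) * exp (t^2 * Vs n x / 2) = exp (t^2 / 2 * (Vs n x - 1))"
      by (simp add: right_diff_distrib flip: exp_add)
    then have eq: "gauss t * Z n x = iexp (t * Ts n x) * complex_of_real (exp (t^2 / 2 * (Vs n x - 1)))"
      unfolding Z_def mult.left_commute[of "gauss t"] by (simp only: of_real_mult[symmetric])
    have 1: "\<bar>Vs n x - 1\<bar> \<le> 1"
      using stopped[of n x] Vs_nonneg[of n x] by auto
    \<comment> \<open>Where stopping has an effect, \<open>V\<close> exceeds 2, so
      \<open>V - 1\<close> is above 1 and dominates \<open>Vs - 1\<close>. The same fact then pays
      for replacing \<open>T\<close> by \<open>Ts\<close>.\<close>
    have 2: "\<bar>Vs n x - 1\<bar> \<le> \<bar>V n x - 1\<bar>"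
      using stopped[of n x] 1 by (cases "V n x \<le> 2") auto
    have 3: "cmod (iexp (t * T n x) - iexp (t * Ts n x)) \<le> 2 * \<bar>V n x - 1\<bar>"
    proof (cases "V n x \<le> 2")
      case False
      have "cmod (iexp (t * T n x) - iexp (t * Ts n x)) \<le> cmod (iexp (t * T n x)) + cmod (iexp (t * Ts n x))"
        by (rule norm_triangle_ineq4)
      then show ?thesis
        using False by simp
    qed (use stopped[of n x] in simp)
    have "cmod (iexp (t * Ts n x) - gauss t * Z n x) = cmod (iexp (t * Ts n x) * of_real (1 - exp (t^2 / 2 * (Vs n x - 1))))"
      unfolding eq by (simp add: algebra_simps)
    also have "\<dots> = \<bar>exp (t^2 / 2 * (Vs n x - 1)) - 1\<bar>"
      unfolding norm_mult norm_of_real by (simp add: abs_minus_commute)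
    also have "\<dots> \<le> \<bar>t^2 / 2 * (Vs n x - 1)\<bar> * exp \<bar>t^2 / 2 * (Vs n x - 1)\<bar>"
      by (rule abs_exp_minus_one_le)
    also have "\<dots> \<le> (t^2 / 2 * \<bar>V n x - 1\<bar>) * exp (t^2 / 2)"
    proof (intro mult_mono)
      show "\<bar>t^2 / 2 * (Vs n x - 1)\<bar> \<le> t^2 / 2 * \<bar>V n x - 1\<bar>"
        unfolding abs_mult using 2 by (simp add: mult_left_mono)
      show "exp \<bar>t^2 / 2 * (Vs n x - 1)\<bar> \<le> exp (t^2 / 2)"
        using mult_left_mono[OF 1, of "t^2 / 2"] by (simp add: abs_mult)
    qed auto
    finally have 4: "cmod (iexp (t * Ts n x) - gauss t * Z n x) \<le> t^2 / 2 * exp (t^2 / 2) * \<bar>V n x - 1\<bar>"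
      by (simp add: mult_ac)
    have "cmod (iexp (t * T n x) - gauss t * Z n x) \<le> ?c * \<bar>V n x - 1\<bar>"
      using norm_triangle_mono[OF 3 4] by (simp add: algebra_simps)
    also have "\<dots> \<le> ?c * ((W + (V n x - 1)^2 * (1 / W)) / 2)"
      by (intro mult_left_mono abs_le_mean_square W(2)) (auto intro!: add_nonneg_nonneg)
    finally show ?thesis .
  qed
  have "cmod ((\<integral>x. iexp (t * T n x) \<partial>M) - gauss t * (\<integral>x. Z n x \<partial>M))
      = cmod (\<integral>x. iexp (t * T n x) - gauss t * Z n x \<partial>M)"
    using int integrable_Z by simp
  also have "\<dots> \<le> (\<integral>x. ?c * ((W + (V n x - 1)^2 * (1 / W)) / 2) \<partial>M)"
    by (rule norm_integral_le) (use int integrable_Z V2 pw in auto)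
  also have "\<dots> = ?c * ((W + (\<integral>x. (V n x - 1)^2 \<partial>M) * (1 / W)) / 2)"
    using V2 P.P.prob_space by simp
  also have "\<dots> \<le> ?c * ((W + W^2 * (1 / W)) / 2)"
    using W by (intro mult_left_mono divide_right_mono add_left_mono mult_right_mono) (auto intro!: add_nonneg_nonneg)
  also have "\<dots> = ?c * W"
    using W(2) by (simp add: power2_eq_square)
  finally have 1: "cmod ((\<integral>x. iexp (t * T n x) \<partial>M) - gauss t * (\<integral>x. Z n x \<partial>M)) \<le> ?c * W" .
  have "cmod (gauss t * (\<integral>x. Z n x \<partial>M) - gauss t) = exp (- (t^2 / 2)) * cmod ((\<integral>x. Z n x \<partial>M) - 1)"
  proof -
    have "gauss t * (\<integral>x. Z n x \<partial>M) - gauss t = gauss t * ((\<integral>x. Z n x \<partial>M) - 1)"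
      by (simp add: algebra_simps)
    then show ?thesis
      by (simp only: norm_mult norm_of_real abs_exp_cancel)
  qed
  also have "\<dots> \<le> 1 * ?E"
    by (intro mult_mono integral_Z_bound \<eta> h4) auto
  finally have 2: "cmod (gauss t * (\<integral>x. Z n x \<partial>M) - gauss t) \<le> ?E"
    by simp
  show ?thesis
    using norm_triangle_mono[OF 1 2] by (simp add: add.commute)
qed

end

section \<open>The quadratic variation\<close>

text \<open>Edges directed from the smaller to the larger end. Thanks to the zeros all sums run over
  the full vertex set and can be interchanged.\<close>

definition low :: "(nat \<Rightarrow> nat \<Rightarrow> real) \<Rightarrow> nat \<Rightarrow> nat \<Rightarrow> real" where
  "low a i k = (if i < k then a k i else 0)"

definition updeg :: "(nat \<Rightarrow> nat \<Rightarrow> real) \<Rightarrow> nat \<Rightarrow> nat \<Rightarrow> real" where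
  "updeg a n i = (\<Sum>k\<in>{1..<n}. low a i k)"

text \<open>Number of common later neighbours. The zero diagonal makes it admissible as the weights
  of a quadratic form.\<close>

definition upcodeg :: "(nat \<Rightarrow> nat \<Rightarrow> real) \<Rightarrow> nat \<Rightarrow> nat \<Rightarrow> nat \<Rightarrow> real" where
  "upcodeg a n i j = (if i = j then 0 else \<Sum>k\<in>{1..<n}. low a i k * low a j k)"

lemma sum_low:
  assumes "k < n"
  shows "(\<Sum>i\<in>{1..<n}. low a i k * f i) = (\<Sum>i\<in>{1..<k}. a k i * f i)"
  by (rule sum.mono_neutral_cong_right) (use assms in \<open>auto simp: low_def\<close>)

lemma low_power: "adj a \<Longrightarrow> (low a i k)^2 = low a i k"
  by (simp add: low_def adj_power)

lemma low_nonneg: "adj a \<Longrightarrow> 0 \<le> low a i k"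
  by (simp add: low_def adj_nonneg)

lemma low_le: "adj a \<Longrightarrow> low a i k \<le> a i k"
  using weights_sym[OF adj_weights, of a i k] by (simp add: low_def adj_nonneg)

lemma sum_squared_split:
  fixes f :: "nat \<Rightarrow> real"
  shows "(\<Sum>k\<in>{1..<Suc n}. f k)^2 = (\<Sum>k\<in>{1..<Suc n}. (f k)^2) + 2 * (\<Sum>k\<in>{1..<Suc n}. f k * (\<Sum>l\<in>{1..<k}. f l))"
proof (induction n)
  case (Suc n)
  have S: "sum g {1..<Suc (Suc n)} = sum g {1..<Suc n} + g (Suc n)" for g :: "nat \<Rightarrow> real"
    by simp
  show ?case
    unfolding S power2_sum Suc by (simp add: distrib_left mult_ac)
qed simp

lemma sum_updeg:
  assumes "weights a"
  shows "(\<Sum>i\<in>{1..<Suc n}. updeg a (Suc n) i) = nedges a (Suc n)"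
proof -
  have "(\<Sum>i\<in>{1..<Suc n}. updeg a (Suc n) i) = (\<Sum>k\<in>{1..<Suc n}. \<Sum>i\<in>{1..<Suc n}. low a i k * 1)"
    unfolding updeg_def by (subst sum.swap) simp
  also have "\<dots> = (\<Sum>k\<in>{1..<Suc n}. lowdeg a k)"
    by (intro sum.cong refl) (subst sum_low, auto simp: lowdeg_def)
  finally show ?thesis
    by (simp only: nedges_eq_sum_lowdeg[OF assms])
qed

text \<open>The square of \<open>updeg\<close> counts ordered pairs of later neighbours of
  \<open>i\<close>. Equal ones are edges; distinct ones form a path centred at \<open>i\<close> that
  ends in its largest vertex, hence a cherry, in two orders.\<close>

lemma sum_updeg_squared_le:
  assumes "adj a"
  shows "(\<Sum>i\<in>{1..<Suc n}. (updeg a (Suc n) i)^2) \<le> nedges a (Suc n) + 2 * cherries a (Suc n)"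
proof -
  let ?I = "{1..<Suc n}"
  have "(\<Sum>i\<in>?I. (updeg a (Suc n) i)^2)
      = (\<Sum>i\<in>?I. updeg a (Suc n) i) + 2 * (\<Sum>i\<in>?I. \<Sum>k\<in>?I. low a i k * (\<Sum>l\<in>{1..<k}. low a i l))"
    unfolding updeg_def sum_squared_split low_power[OF assms] by (simp only: sum.distrib sum_distrib_left)
  also have "(\<Sum>i\<in>?I. \<Sum>k\<in>?I. low a i k * (\<Sum>l\<in>{1..<k}. low a i l))
      = (\<Sum>k\<in>?I. \<Sum>i\<in>{1..<k}. a k i * (\<Sum>l\<in>{1..<k}. low a i l))"
    by (subst sum.swap, intro sum.cong refl sum_low) auto
  also have "\<dots> \<le> cherries a (Suc n)"
    unfolding cherries_def using assms by (intro sum_mono mult_left_mono low_le adj_nonneg)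
  finally show ?thesis
    using sum_updeg[OF adj_weights[OF assms]] by simp
qed

text \<open>The square of \<open>upcodeg\<close> counts ordered pairs of common later neighbours of
  \<open>i\<close> and \<open>j\<close>. Equal ones are bounded through \<open>lowdeg_sq\<close>;
  distinct ones close a 4-cycle whose largest vertex is the larger of the two.\<close>

lemma sum_upcodeg_squared_le:
  assumes "adj a"
  shows "(\<Sum>i\<in>{1..<Suc n}. \<Sum>j\<in>{1..<Suc n}. (upcodeg a (Suc n) i j)^2) \<le> lowdeg_sq a (Suc n) + 2 * four_cycles a (Suc n)"
proof -
  let ?I = "{1..<Suc n}"
  define X where "X k i j = low a i k * low a j k" for k i j
  define Y where "Y k i j = (if i = j then 0 else \<Sum>l\<in>{1..<k}. X l i j)" for k i j
  have X0: "0 \<le> X k i j" for k i j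
    by (simp add: X_def low_nonneg assms)
  have "(upcodeg a (Suc n) i j)^2 \<le> (\<Sum>k\<in>?I. X k i j) + 2 * (\<Sum>k\<in>?I. X k i j * Y k i j)" for i j
  proof (cases "i = j")
    case True
    then show ?thesis
      by (auto simp: upcodeg_def Y_def simp del: sum.op_ivl_Suc intro!: sum_nonneg X0)
  next
    case False
    have "(upcodeg a (Suc n) i j)^2 = (\<Sum>k\<in>?I. (X k i j)^2) + 2 * (\<Sum>k\<in>?I. X k i j * (\<Sum>l\<in>{1..<k}. X l i j))"
      using False unfolding upcodeg_def X_def by (simp only: sum_squared_split if_False)
    then show ?thesis
      using False by (simp add: X_def Y_def power_mult_distrib low_power[OF assms])
  qed
  then have "(\<Sum>i\<in>?I. \<Sum>j\<in>?I. (upcodeg a (Suc n) i j)^2)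
     \<le> (\<Sum>i\<in>?I. \<Sum>j\<in>?I. (\<Sum>k\<in>?I. X k i j) + 2 * (\<Sum>k\<in>?I. X k i j * Y k i j))"
    by (intro sum_mono)
  also have "\<dots> = (\<Sum>i\<in>?I. \<Sum>j\<in>?I. \<Sum>k\<in>?I. X k i j + 2 * (X k i j * Y k i j))"
    by (simp only: sum.distrib sum_distrib_left)
  also have "\<dots> = (\<Sum>i\<in>?I. \<Sum>k\<in>?I. \<Sum>j\<in>?I. X k i j + 2 * (X k i j * Y k i j))"
    by (intro sum.cong refl sum.swap)
  also have "\<dots> = (\<Sum>k\<in>?I. \<Sum>i\<in>?I. \<Sum>j\<in>?I. X k i j + 2 * (X k i j * Y k i j))"
    by (rule sum.swap)
  also have "\<dots> = (\<Sum>k\<in>?I. \<Sum>i\<in>?I. low a i k * (\<Sum>j\<in>?I. low a j k * (1 + 2 * Y k i j)))"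
    by (simp add: X_def sum_distrib_left algebra_simps)
  also have "\<dots> = (\<Sum>k\<in>?I. \<Sum>i\<in>{1..<k}. a k i * (\<Sum>j\<in>{1..<k}. a k j * (1 + 2 * Y k i j)))"
  proof (rule sum.cong[OF refl])
    fix k assume "k \<in> ?I"
    then have k: "k < Suc n" by simp
    show "(\<Sum>i\<in>?I. low a i k * (\<Sum>j\<in>?I. low a j k * (1 + 2 * Y k i j)))
        = (\<Sum>i\<in>{1..<k}. a k i * (\<Sum>j\<in>{1..<k}. a k j * (1 + 2 * Y k i j)))"
      unfolding sum_low[OF k] ..
  qed
  also have "\<dots> = (\<Sum>k\<in>?I. (lowdeg a k)^2) + 2 * (\<Sum>k\<in>?I. \<Sum>i\<in>{1..<k}. \<Sum>j\<in>{1..<k}. a k i * a k j * Y k i j)"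
    by (simp add: lowdeg_def power2_eq_square sum_product sum.distrib sum_distrib_left algebra_simps del: sum.op_ivl_Suc One_nat_def)
  also have "(\<Sum>k\<in>?I. \<Sum>i\<in>{1..<k}. \<Sum>j\<in>{1..<k}. a k i * a k j * Y k i j) \<le> four_cycles a (Suc n)"
    unfolding four_cycles_def
  proof (intro sum_mono)
    fix k i j
    have "Y k i j \<le> (\<Sum>l\<in>{1..<k}. a i l * a j l)" if "i \<noteq> j"
      unfolding Y_def X_def using that by (auto intro!: sum_mono mult_mono low_le[OF assms] low_nonneg[OF assms] adj_nonneg[OF assms])
    then show "a k i * a k j * Y k i j \<le> (if i = j then 0 else a k i * a k j * (\<Sum>l\<in>{1..<k}. a i l * a j l))"
      using adj_nonneg[OF assms] by (auto simp: Y_def intro!: mult_left_mono)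
  qed
  finally show ?thesis
    by (simp add: lowdeg_sq_def)
qed

context std_iid
begin

text \<open>The variables \<open>(x i)^2 - 1\<close> are centred and independent, with variance
  \<open>mu 4 - 1\<close>.\<close>

lemma hbi_sum_sq_minus_1:
  assumes "finite I"
  shows "hbi M (\<lambda>x. (\<Sum>i\<in>I. ((x i)^2 - 1) * u i)^2) ((mu 4 - 1) * (\<Sum>i\<in>I. (u i)^2))"
  using assms
proof (induction I rule: finite_induct)
  case empty
  show ?case by (simp add: hbi_zero)
next
  case (insert k I)
  let ?W = "\<lambda>x. \<Sum>i\<in>I. ((x i)^2 - 1) * u i"
  have p1: "hbi D (\<lambda>y. y^2 - 1) 0"
    using hbi_diff[OF hbi_mu[of 2] hbi_mu[of 0]] by simp
  have n: "nodep k (\<lambda>x. ?W x * c)" for c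
    using insert by (auto simp: nodep_def intro!: arg_cong[where f = "\<lambda>s. s * c"] sum.cong)
  have W: "hbi M (\<lambda>x. ?W x * (2 * u k)) (0 * (2 * u k))"
  proof (intro hbi_mult_left)
    have "hbi M ?W (\<Sum>i\<in>I. 0 * u i)"
      by (intro hbi_sum hbi_mult_left hbi_coord p1)
    then show "hbi M ?W 0" by simp
  qed
  have *: "hbi M (\<lambda>x. (?W x)^2 + ((x k)^2 - 1) * (?W x * (2 * u k)) + ((x k)^2 - 1)^2 * (u k)^2)
     ((mu 4 - 1) * (\<Sum>i\<in>I. (u i)^2) + 0 * (0 * (2 * u k)) + (mu 4 - 1) * (u k)^2)"
    by (intro hbi_add insert hbi_nodep[OF p1 W n] hbi_mult_left hbi_coord[OF hbi_sq_minus_1])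
  show ?case
    by (rule hbi_eqI[OF *]) (use insert in \<open>simp_all add: power2_eq_square algebra_simps\<close>)
qed

text \<open>Collecting the squared increments by pairs \<open>(i, j)\<close> gives
  \<open>updeg\<close> on the diagonal and \<open>upcodeg\<close> off it. The values of
  \<open>updeg\<close> sum to the number of edges, which centres the diagonal; the factor 2 undoes
  the half in \<open>qf\<close>.\<close>

lemma quadratic_variation_eq:
  assumes "adj a"
  shows "(\<Sum>k\<in>{1..<Suc n}. (lin (a k) {1..<k} x)^2) - nedges a (Suc n)
    = (\<Sum>i\<in>{1..<Suc n}. ((x i)^2 - 1) * updeg a (Suc n) i) + 2 * qf (upcodeg a (Suc n)) {1..<Suc n} x"
proof -
  let ?I = "{1..<Suc n}"
  have lin: "lin (a k) {1..<k} x = (\<Sum>i\<in>?I. low a i k * x i)" if "k \<in> ?I" for k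
    unfolding lin_def by (rule sum_low[symmetric]) (use that in auto)
  have "(\<Sum>k\<in>?I. (lin (a k) {1..<k} x)^2) = (\<Sum>k\<in>?I. \<Sum>i\<in>?I. \<Sum>j\<in>?I. (low a i k * low a j k) * (x i * x j))"
    by (intro sum.cong refl) (simp only: lin power2_eq_square sum_product mult_ac)
  also have "\<dots> = (\<Sum>i\<in>?I. \<Sum>k\<in>?I. \<Sum>j\<in>?I. (low a i k * low a j k) * (x i * x j))"
    by (rule sum.swap)
  also have "\<dots> = (\<Sum>i\<in>?I. \<Sum>j\<in>?I. \<Sum>k\<in>?I. (low a i k * low a j k) * (x i * x j))"
    by (intro sum.cong refl sum.swap)
  also have "\<dots> = (\<Sum>i\<in>?I. \<Sum>j\<in>?I. (if i = j then updeg a (Suc n) i * (x i)^2 else 0) + upcodeg a (Suc n) i j * x i * x j)"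
  proof (intro sum.cong refl)
    fix i j
    show "(\<Sum>k\<in>?I. (low a i k * low a j k) * (x i * x j))
        = (if i = j then updeg a (Suc n) i * (x i)^2 else 0) + upcodeg a (Suc n) i j * x i * x j"
    proof (cases "i = j")
      case True
      have "low a j k * low a j k = low a j k" for k
        using low_power[OF assms, of j k] by (simp add: power2_eq_square)
      then show ?thesis
        using True by (simp only: updeg_def upcodeg_def sum_distrib_right if_True power2_eq_square) simp
    next
      case False
      then show ?thesis
        by (simp only: upcodeg_def sum_distrib_right if_False mult.assoc add_0_left)
    qed
  qed
  also have "\<dots> = (\<Sum>i\<in>?I. updeg a (Suc n) i * (x i)^2) + (\<Sum>i\<in>?I. \<Sum>j\<in>?I. upcodeg a (Suc n) i j * x i * x j)"
    by (simp add: sum.distrib sum.delta' del: sum.op_ivl_Suc)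
  finally show ?thesis
    unfolding sum_updeg[OF adj_weights[OF assms], symmetric] qf_def
    by (simp add: left_diff_distrib sum_subtractf mult.commute[of "updeg a (Suc n) _"] del: sum.op_ivl_Suc)
qed

lemma weights_upcodeg: "weights (upcodeg a n)"
  by (auto simp: weights_def upcodeg_def mult.commute)

text \<open>The square of the sum is split by \<open>(u + 2 * q)^2 \<le> 2 * u^2 + 8 * q^2\<close>,
  so no mixed moment of the diagonal and the off-diagonal part has to be computed.\<close>

lemma quadratic_variation_variance:
  assumes "adj a"
  shows "integrable M (\<lambda>x. ((\<Sum>k\<in>{1..<Suc n}. (lin (a k) {1..<k} x)^2) - nedges a (Suc n))^2)" (is ?int)
    and "(\<integral>x. ((\<Sum>k\<in>{1..<Suc n}. (lin (a k) {1..<k} x)^2) - nedges a (Suc n))^2 \<partial>M)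
      \<le> 2 * ((mu 4 - 1) * (nedges a (Suc n) + 2 * cherries a (Suc n))) + 4 * (lowdeg_sq a (Suc n) + 2 * four_cycles a (Suc n))" (is ?le)
proof -
  let ?I = "{1..<Suc n}"
  let ?U = "\<lambda>x. \<Sum>i\<in>?I. ((x i)^2 - 1) * updeg a (Suc n) i" and ?Q = "qf (upcodeg a (Suc n)) ?I"
  have U: "hbi M (\<lambda>x. (?U x)^2) ((mu 4 - 1) * (\<Sum>i\<in>?I. (updeg a (Suc n) i)^2))"
    by (rule hbi_sum_sq_minus_1) simp
  have Q: "hbi M (\<lambda>x. (?Q x)^2) ((\<Sum>i\<in>?I. \<Sum>j\<in>?I. (upcodeg a (Suc n) i j)^2) / 2)"
    by (rule hbi_qf2) (auto simp: weights_upcodeg)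
  have UQ: "hbi M (\<lambda>x. 2 * (?U x)^2 + 8 * (?Q x)^2)
    (2 * ((mu 4 - 1) * (\<Sum>i\<in>?I. (updeg a (Suc n) i)^2)) + 8 * ((\<Sum>i\<in>?I. \<Sum>j\<in>?I. (upcodeg a (Suc n) i j)^2) / 2))"
    by (intro hbi_add hbi_mult_right U Q)
  have pw: "(?U x + 2 * ?Q x)^2 \<le> 2 * (?U x)^2 + 8 * (?Q x)^2" for x
  proof -
    have "(u + 2 * q)^2 \<le> 2 * u^2 + 8 * q^2" for u q :: real
    proof -
      have "2 * u^2 + 8 * q^2 - (u + 2 * q)^2 = (u - 2 * q)^2"
        by algebra
      then show ?thesis
        using zero_le_power2[of "u - 2 * q"] by linarith
    qed
    then show ?thesis .
  qed
  have int: "integrable M (\<lambda>x. (?U x + 2 * ?Q x)^2)"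
  proof (rule integrable_bound)
    show "integrable M (\<lambda>x. 2 * (?U x)^2 + 8 * (?Q x)^2)"
      using UQ by (simp add: hbi_iff)
    show "AE x in M. norm ((?U x + 2 * ?Q x)^2) \<le> norm (2 * (?U x)^2 + 8 * (?Q x)^2)"
      unfolding real_norm_def abs_power2 by (intro AE_I2 order_trans[OF pw abs_ge_self])
  qed measurable
  show ?int
    unfolding quadratic_variation_eq[OF assms] by (rule int)
  have "(\<integral>x. (?U x + 2 * ?Q x)^2 \<partial>M) \<le> (\<integral>x. 2 * (?U x)^2 + 8 * (?Q x)^2 \<partial>M)"
    by (rule integral_mono[OF int _ pw]) (use UQ in \<open>simp add: hbi_iff\<close>)
  also have "\<dots> = 2 * ((mu 4 - 1) * (\<Sum>i\<in>?I. (updeg a (Suc n) i)^2)) + 4 * (\<Sum>i\<in>?I. \<Sum>j\<in>?I. (upcodeg a (Suc n) i j)^2)"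
    using hbi_integral_eq[OF UQ] by (simp del: sum.op_ivl_Suc)
  also have "\<dots> \<le> 2 * ((mu 4 - 1) * (nedges a (Suc n) + 2 * cherries a (Suc n))) + 4 * (lowdeg_sq a (Suc n) + 2 * four_cycles a (Suc n))"
    using mu4_ge_1 by (intro add_mono mult_left_mono sum_updeg_squared_le sum_upcodeg_squared_le assms) auto
  finally show ?le
    unfolding quadratic_variation_eq[OF assms] .
qed

end

lemma qf_eq_sum:
  assumes "weights a"
  shows "qf a {1..<Suc n} x = (\<Sum>k\<in>{1..n}. x k * lin (a k) {1..<k} x)"
proof (induction n)
  case (Suc n)
  have "qf a {1..<Suc (Suc n)} x = qf a {1..<Suc n} x + x (Suc n) * lin (a (Suc n)) {1..<Suc n} x"
    by (subst insert_interval) (use assms in \<open>auto simp: qf_insert\<close>)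
  then show ?case
    using Suc by simp
qed simp

locale bounded_graph_seq = std_graph_seq D G + bounded_std D B for D G B
begin

text \<open>Bounds the sum of the fourth moments of the increments; \<open>mu 4\<close> in place of
  \<open>mu 4 - 3\<close> keeps it positive.\<close>

definition lindeberg_err where
  "lindeberg_err n = 3 * (lowdeg_sq (a n) (Suc n) / (m n)^2) + mu 4 / m n"

text \<open>The root of the variance bound. The summand \<open>1 / m n\<close> makes it strictly
  positive, as it will be divided by, and \<open>mu 4 - 1\<close> stays attached to
  \<open>cherry_ratio\<close> because only their product is going to be assumed small.\<close>

definition variation_err where
  "variation_err n = sqrt (2 * ((mu 4 - 1) / m n + 2 * ((mu 4 - 1) * cherry_ratio n))
      + 4 * (lowdeg_sq (a n) (Suc n) / (m n)^2 + 2 * cycle_ratio n) + 1 / m n)"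

lemma char_S_bound:
  assumes m: "m n > 0"
  shows "cmod ((\<integral>x. iexp (t * S n x) \<partial>M) - gauss t)
    \<le> exp (2 * t^2) * (B * sqrt (lindeberg_err n) * t^2 / 6 + (B / 12 * sqrt (lindeberg_err n) + lindeberg_err n / 8) * t ^ 4)
      + (2 + t^2 / 2 * exp (t^2 / 2)) * variation_err n"
proof -
  let ?Y = "lindeberg_err n" and ?W = "variation_err n"
  let ?l = "\<lambda>k x. lin (a n k) {1..<k} x" and ?I = "{1..<Suc n}"
  let ?h = "\<lambda>k x. ?l k x / sqrt (m n)"
  interpret predictable D B ?h t
    by unfold_locales (auto simp: nodep_def)
  have I: "{1..n} = ?I" by auto
  have sm4: "sqrt (m n) ^ 4 = (m n)^2"
    using power_mult[of "sqrt (m n)" 2 2] m by simp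
  have V: "V n x = (\<Sum>k\<in>?I. (?l k x)^2) / m n" for x
    unfolding V_def I sum_divide_distrib using m by (intro sum.cong refl) (simp add: power_divide)
  have T: "T n x = S n x" for x
    unfolding T_def S_eq qf_eq_sum[OF weights_a] by (simp add: sum_divide_distrib)
  have h4: "hbi M (\<lambda>x. ?h k x ^ 4) ((3 * (lowdeg (a n) k)^2 + (mu 4 - 3) * lowdeg (a n) k) / (m n)^2)" for k
    using hbi_divide[OF hbi_lin4[of "{1..<k}" "a n k"], of "(m n)^2"]
    by (simp add: power_divide sm4 adj_power[OF adj_a] lowdeg_def)
  have "(\<Sum>k\<in>{1..n}. \<integral>x. ?h k x ^ 4 \<partial>M) = (\<Sum>k\<in>?I. (3 * (lowdeg (a n) k)^2 + (mu 4 - 3) * lowdeg (a n) k) / (m n)^2)"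
    unfolding I by (intro sum.cong refl hbi_integral_eq h4)
  also have "\<dots> = (3 * lowdeg_sq (a n) (Suc n) + (mu 4 - 3) * m n) / (m n)^2"
    unfolding lowdeg_sq_def m_def nedges_eq_sum_lowdeg[OF weights_a]
    by (simp only: sum_divide_distrib[symmetric] sum.distrib sum_distrib_left)
  also have "\<dots> \<le> (3 * lowdeg_sq (a n) (Suc n) + mu 4 * m n) / (m n)^2"
    using m by (intro divide_right_mono add_left_mono mult_right_mono) auto
  also have "\<dots> = ?Y"
    using m by (simp add: lindeberg_err_def power2_eq_square field_simps)
  finally have sum4: "(\<Sum>k\<in>{1..n}. \<integral>x. ?h k x ^ 4 \<partial>M) \<le> ?Y" .
  have "0 \<le> lowdeg_sq (a n) (Suc n) / (m n)^2"
    by (simp add: lowdeg_sq_nonneg)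
  then have Y: "?Y > 0"
    unfolding lindeberg_err_def using mu4_ge_1 m by (intro add_nonneg_pos) auto
  have V1: "(V n x - 1)^2 = ((\<Sum>k\<in>?I. (?l k x)^2) - nedges (a n) (Suc n))^2 / (m n)^2" for x
    unfolding V using m by (simp add: m_def[symmetric] power_divide[symmetric] diff_divide_distrib del: sum.op_ivl_Suc)
  have W0: "2 * ((mu 4 - 1) / m n + 2 * ((mu 4 - 1) * cherry_ratio n))
      + 4 * (lowdeg_sq (a n) (Suc n) / (m n)^2 + 2 * cycle_ratio n) \<ge> 0"
    using m mu4_ge_1 by (intro add_nonneg_nonneg mult_nonneg_nonneg divide_nonneg_nonneg)
      (auto simp: cherry_ratio_nonneg cycle_ratio_nonneg lowdeg_sq_nonneg)
  have W: "?W > 0"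
    unfolding variation_err_def using m W0 by (simp only: real_sqrt_gt_0_iff) (intro add_nonneg_pos, auto)
  have "(\<integral>x. (V n x - 1)^2 \<partial>M) = (\<integral>x. ((\<Sum>k\<in>?I. (?l k x)^2) - nedges (a n) (Suc n))^2 \<partial>M) / (m n)^2"
    unfolding V1 by (rule integral_divide_zero)
  also have "\<dots> \<le> (2 * ((mu 4 - 1) * (nedges (a n) (Suc n) + 2 * cherries (a n) (Suc n)))
      + 4 * (lowdeg_sq (a n) (Suc n) + 2 * four_cycles (a n) (Suc n))) / (m n)^2"
    by (intro divide_right_mono quadratic_variation_variance adj_a) simp
  also have "\<dots> = 2 * ((mu 4 - 1) / m n + 2 * ((mu 4 - 1) * cherry_ratio n))
      + 4 * (lowdeg_sq (a n) (Suc n) / (m n)^2 + 2 * cycle_ratio n)"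
    unfolding m_def[symmetric] cherry_ratio_def cycle_ratio_def using m by (simp add: power2_eq_square field_simps)
  also have "\<dots> \<le> ?W^2"
    unfolding variation_err_def using W0 m by (subst real_sqrt_pow2) auto
  finally have VW: "(\<integral>x. (V n x - 1)^2 \<partial>M) \<le> ?W^2" .
  \<comment> \<open>The parameter \<eta> is the root of the bound on the fourth moments, so \<eta>
    itself and the bound divided by \<eta> are of the same size.\<close>
  have "cmod ((\<integral>x. iexp (t * T n x) \<partial>M) - gauss t)
    \<le> exp (2 * t^2) * (B * sqrt ?Y * t^2 / 6 + (B / (12 * sqrt ?Y) + 1 / 8) * t ^ 4 * (\<Sum>k\<in>{1..n}. \<integral>x. ?h k x ^ 4 \<partial>M))
      + (2 + t^2 / 2 * exp (t^2 / 2)) * ?W"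
  proof (rule char_martingale_bound)
    show "integrable M (\<lambda>x. ?h k x ^ 4)" for k
      using h4 by (simp only: hbi_iff)
    show "integrable M (\<lambda>x. (V n x - 1)^2)"
      unfolding V1 by (intro integrable_divide_zero quadratic_variation_variance adj_a)
  qed (use Y W VW in auto)
  also have "\<dots> \<le> exp (2 * t^2) * (B * sqrt ?Y * t^2 / 6 + (B / (12 * sqrt ?Y) + 1 / 8) * t ^ 4 * ?Y)
      + (2 + t^2 / 2 * exp (t^2 / 2)) * ?W"
    using B_ge_1 Y by (intro add_right_mono mult_left_mono add_left_mono sum4) auto
  also have "(B / (12 * sqrt ?Y) + 1 / 8) * t ^ 4 * ?Y = (B / 12 * sqrt ?Y + ?Y / 8) * t ^ 4"
  proof -
    have "?Y / sqrt ?Y = sqrt ?Y"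
      using Y by (simp add: real_div_sqrt)
    moreover have "B / (12 * sqrt ?Y) * ?Y = B / 12 * (?Y / sqrt ?Y)"
      by simp
    ultimately have "B / (12 * sqrt ?Y) * ?Y = B / 12 * sqrt ?Y"
      by (simp only:)
    moreover have "(c + 1 / 8) * t ^ 4 * ?Y = (c * ?Y + ?Y / 8) * t ^ 4" for c
      by (simp add: algebra_simps)
    ultimately show ?thesis
      by (simp only:)
  qed
  finally show ?thesis
    unfolding T .
qed

theorem char_S_tendsto:
  assumes "(\<lambda>n. (mu 4 - 1) * cherry_ratio n) \<longlonglongrightarrow> 0" "cycle_ratio \<longlonglongrightarrow> 0"
  shows "(\<lambda>n. \<integral>x. iexp (t * S n x) \<partial>M) \<longlonglongrightarrow> gauss t"
proof -
  let ?E = "\<lambda>n. exp (2 * t^2) * (B * sqrt (lindeberg_err n) * t^2 / 6 + (B / 12 * sqrt (lindeberg_err n) + lindeberg_err n / 8) * t ^ 4)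
      + (2 + t^2 / 2 * exp (t^2 / 2)) * variation_err n"
  have "lindeberg_err \<longlonglongrightarrow> 3 * 0 + 0"
    unfolding lindeberg_err_def[abs_def] by (intro tendsto_intros lowdeg_sq_ratio_tendsto inverse_m_tendsto)
  then have Y: "lindeberg_err \<longlonglongrightarrow> 0" by simp
  have "variation_err \<longlonglongrightarrow> sqrt (2 * (0 + 2 * 0) + 4 * (0 + 2 * 0) + 0)"
    unfolding variation_err_def[abs_def] by (intro tendsto_intros lowdeg_sq_ratio_tendsto inverse_m_tendsto assms)
  then have W: "variation_err \<longlonglongrightarrow> 0" by simp
  have "?E
    \<longlonglongrightarrow> exp (2 * t^2) * (B * sqrt 0 * t^2 / 6 + (B / 12 * sqrt 0 + 0 / 8) * t ^ 4)
      + (2 + t^2 / 2 * exp (t^2 / 2)) * 0"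
    by (intro tendsto_intros Y W) auto
  then have lim: "?E \<longlonglongrightarrow> 0"
    by simp
  have "(\<lambda>n. (\<integral>x. iexp (t * S n x) \<partial>M) - gauss t) \<longlonglongrightarrow> 0"
  proof (rule Lim_null_comparison[OF _ lim])
    show "\<forall>\<^sub>F n in sequentially. cmod ((\<integral>x. iexp (t * S n x) \<partial>M) - gauss t)
      \<le> ?E n"
      using eventually_m_pos by eventually_elim (rule char_S_bound)
  qed
  then show ?thesis
    by (rule Lim_null[THEN iffD2])
qed

end

section \<open>Square integrable variables\<close>

lemma abs_mult_le_sum_squares: "\<bar>u * v\<bar> \<le> \<bar>u^2 + v^2\<bar>" for u v :: real
proof -
  have "2 * \<bar>u * v\<bar> \<le> u^2 + v^2"
    using zero_le_power2[of "\<bar>u\<bar> - \<bar>v\<bar>"] by (simp add: power2_diff abs_mult)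
  then show ?thesis
    using abs_ge_zero[of "u * v"] by linarith
qed

locale l2_graph_seq = iid_seq D + graph_seq G for D G +
  assumes integrable_2: "integrable D (\<lambda>x. x^2)"
    and mean_D: "(\<integral>x. x \<partial>D) = 0"
    and variance_D: "(\<integral>x. x^2 \<partial>D) = 1"
begin

lemma indep_coords: "P.P.indep_vars (\<lambda>_. borel) (\<lambda>i x. x i) {1..}"
proof -
  have sp: "sets (PiM {1..} (\<lambda>_. D)) = sets (PiM {1..} (\<lambda>_. borel))"
    by (intro sets_PiM_cong) auto
  have d: "distr M borel (\<lambda>x. x i) = D" for i
    using P.PiM_component[of i] by (simp cong: distr_cong)
  have "distr M (PiM {1..} (\<lambda>_. borel)) (\<lambda>x. \<lambda>i\<in>{1..}. x i) = distr M (PiM {1..} (\<lambda>_. D)) (\<lambda>x. \<lambda>i\<in>{1..}. x i)"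
    by (intro distr_cong) (auto simp: sp simp del: One_nat_def)
  also have "\<dots> = PiM {1..} (\<lambda>_. D)"
    using distr_PiM_reindex[of UNIV "\<lambda>_. D" "\<lambda>i. i" "{1..}"] D.prob_space_axioms by (simp del: One_nat_def)
  finally show ?thesis
    by (subst P.P.indep_vars_iff_distr_eq_PiM') (auto simp: d simp del: One_nat_def)
qed

lemma measurable_S': "w \<in> borel_measurable borel \<Longrightarrow> (\<lambda>x. Sf w n x) \<in> borel_measurable M"
proof -
  assume w: "w \<in> borel_measurable borel"
  have [measurable]: "(\<lambda>x. w (x u)) \<in> borel_measurable M" for u
    by (rule measurable_compose[OF measurable_coord w])
  show ?thesis
    unfolding S_def S_G_def by measurable
qed

text \<open>Transformed coordinates are again independent with a common law. This lets theorems
  about the plain form under a bounded law be applied to truncated variables.\<close>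

lemma distr_S_comp:
  assumes [measurable]: "w \<in> borel_measurable borel"
  shows "distr M borel (\<lambda>x. Sf w n x) = distr (PiM UNIV (\<lambda>_. distr D borel w)) borel (S n)"
proof (rule distr_iid_eq[where X = "\<lambda>u x. w (x u)"])
  show "P.P.indep_vars (\<lambda>_. borel) (\<lambda>u x. w (x u)) {1..}"
    by (rule P.P.indep_vars_compose2[OF indep_coords]) measurable
  show "distr M borel (\<lambda>x. w (x i)) = distr D borel w" for i
  proof -
    have "distr M borel (\<lambda>x. w (x i)) = distr (distr M D (\<lambda>x. x i)) borel w"
      by (subst distr_distr) (auto simp: comp_def)
    then show ?thesis
      using P.PiM_component[of i] by simp
  qed
qed (auto simp: measurable_S S_restrict P.P.prob_space_axioms simp del: One_nat_def)

lemma integral_S_comp: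
  fixes f :: "real \<Rightarrow> 'b :: {banach, second_countable_topology}"
  assumes [measurable]: "w \<in> borel_measurable borel" "f \<in> borel_measurable borel"
  shows "(\<integral>x. f (Sf w n x) \<partial>M) = (\<integral>x. f (S n x) \<partial>PiM UNIV (\<lambda>_. distr D borel w))"
proof -
  have "S n \<in> borel_measurable (PiM UNIV (\<lambda>_. distr D borel w))"
    unfolding S_def[abs_def] S_G_def[abs_def] by measurable
  then show ?thesis
    using integral_distr[OF measurable_S'[OF assms(1)] assms(2), of n] integral_distr[of "S n" "PiM UNIV (\<lambda>_. distr D borel w)" borel f]
    by (simp add: distr_S_comp)
qed

section \<open>Covariances of forms in transformed variables\<close>

definition L2 :: "((nat \<Rightarrow> real) \<Rightarrow> real) \<Rightarrow> bool" where
  "L2 f \<longleftrightarrow> f \<in> borel_measurable M \<and> integrable M (\<lambda>x. (f x)^2)"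

lemma integrable_L2_mult: assumes "L2 f" "L2 g" shows "integrable M (\<lambda>x. f x * g x)"
proof (rule integrable_bound)
  show "integrable M (\<lambda>x. (f x)^2 + (g x)^2)"
    using assms by (auto simp: L2_def)
  show "AE x in M. norm (f x * g x) \<le> norm ((f x)^2 + (g x)^2)"
    unfolding real_norm_def by (intro AE_I2 abs_mult_le_sum_squares)
qed (use assms in \<open>auto simp: L2_def\<close>)

lemma L2_add: assumes "L2 f" "L2 g" shows "L2 (\<lambda>x. f x + g x)"
proof -
  have "integrable M (\<lambda>x. (f x)^2 + 2 * (f x * g x) + (g x)^2)"
    using assms integrable_L2_mult[OF assms] by (auto simp: L2_def)
  then show ?thesis
    using assms by (auto simp: L2_def power2_sum algebra_simps)
qed

lemma L2_coord_mult:
  assumes v: "v \<in> borel_measurable borel" "integrable D (\<lambda>x. (v x)^2)" and f: "L2 f" "nodep k f"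
  shows "L2 (\<lambda>x. v (x k) * f x)"
proof -
  have "hbi M (\<lambda>x. (v (x k))^2 * (f x)^2) ((\<integral>x. (v x)^2 \<partial>D) * (\<integral>x. (f x)^2 \<partial>M))"
    using v f by (intro hbi_nodep hbi_integral) (auto simp: L2_def nodep_def)
  then show ?thesis
    using v f by (auto simp: L2_def hbi_iff power_mult_distrib)
qed

lemma L2_const: "L2 (\<lambda>_. c)"
  by (auto simp: L2_def)

definition centered :: "(real \<Rightarrow> real) \<Rightarrow> bool" where
  "centered v \<longleftrightarrow> v \<in> borel_measurable borel \<and> integrable D (\<lambda>x. (v x)^2) \<and> (\<integral>x. v x \<partial>D) = 0"

lemma integrable_of_square:
  assumes "v \<in> borel_measurable borel" "integrable D (\<lambda>x. (v x)^2)"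
  shows "integrable D (v :: real \<Rightarrow> real)"
  by (rule D.square_integrable_imp_integrable) (use assms in auto)

lemma centered_id: "centered (\<lambda>x. x)"
  using integrable_2 mean_D by (simp add: centered_def)

lemma integrable_centered_mult:
  assumes "centered v" "centered w" shows "integrable D (\<lambda>x. v x * w x)"
proof (rule integrable_bound)
  show "integrable D (\<lambda>x. (v x)^2 + (w x)^2)"
    using assms by (auto simp: centered_def)
  show "AE x in D. norm (v x * w x) \<le> norm ((v x)^2 + (w x)^2)"
    unfolding real_norm_def by (intro AE_I2 abs_mult_le_sum_squares)
qed (use assms in \<open>auto simp: centered_def\<close>)

lemma L2_lin: assumes "centered v" "finite I" shows "L2 (\<lambda>x. lin b I (\<lambda>u. v (x u)))"
  using assms(2)
proof (induction I rule: finite_induct)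
  case (insert k I)
  have "L2 (\<lambda>x. lin b I (\<lambda>u. v (x u)) + v (x k) * b k)"
    using assms(1) by (intro L2_add insert L2_coord_mult L2_const) (auto simp: centered_def nodep_def)
  then show ?case
    using insert by (simp add: lin_insert)
qed (simp add: L2_const)

lemma nodep_lin: "k \<notin> I \<Longrightarrow> nodep k (\<lambda>x. lin b I (\<lambda>u. v (x u)))"
  by (auto simp: nodep_def lin_def intro!: sum.cong)

lemma nodep_qf: "k \<notin> I \<Longrightarrow> nodep k (\<lambda>x. qf b I (\<lambda>u. v (x u)))"
  by (auto simp: nodep_def qf_def intro!: sum.cong)

lemma nodep_mult: "nodep k f \<Longrightarrow> nodep k g \<Longrightarrow> nodep k (\<lambda>x. f x * g x)"
  by (auto simp: nodep_def)

lemma L2_qf: assumes "centered v" "finite I" "weights b" shows "L2 (\<lambda>x. qf b I (\<lambda>u. v (x u)))"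
  using assms(2)
proof (induction I rule: finite_induct)
  case (insert k I)
  have "L2 (\<lambda>x. qf b I (\<lambda>u. v (x u)) + v (x k) * lin (b k) I (\<lambda>u. v (x u)))"
    using assms(1) insert by (intro L2_add insert L2_coord_mult L2_lin nodep_lin) (auto simp: centered_def)
  then show ?case
    using insert assms(3) by (simp add: qf_insert)
qed (simp add: L2_const)

lemma hbi_centered_mult:
  assumes "centered v" "L2 f" "L2 g" "nodep k f" "nodep k g"
  shows "hbi M (\<lambda>x. v (x k) * (f x * g x)) 0"
proof -
  have "hbi D v 0"
    using assms(1) by (auto simp: centered_def hbi_iff integrable_of_square)
  from hbi_nodep[OF this hbi_integral[OF integrable_L2_mult[OF assms(2,3)]] nodep_mult[OF assms(4,5)]]
  show ?thesis by simp
qed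

lemma hbi_lin_lin_centered:
  assumes v: "centered v" and w: "centered w" and "finite I"
  shows "hbi M (\<lambda>x. lin b I (\<lambda>u. v (x u)) * lin b I (\<lambda>u. w (x u))) ((\<integral>x. v x * w x \<partial>D) * (\<Sum>i\<in>I. (b i)^2))"
  using assms(3)
proof (induction I rule: finite_induct)
  case (insert k I)
  have vw: "hbi D (\<lambda>x. v x * w x) (\<integral>x. v x * w x \<partial>D)"
    by (intro hbi_integral integrable_centered_mult v w)
  let ?f = "\<lambda>x. lin b I (\<lambda>u. v (x u))" and ?g = "\<lambda>x. lin b I (\<lambda>u. w (x u))"
  have *: "hbi M (\<lambda>x. ?f x * ?g x + v (x k) * (?g x * b k) + w (x k) * (?f x * b k) + v (x k) * w (x k) * (b k)^2)
     ((\<integral>x. v x * w x \<partial>D) * (\<Sum>i\<in>I. (b i)^2) + 0 + 0 + (\<integral>x. v x * w x \<partial>D) * (b k)^2)"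
    by (intro hbi_add insert hbi_centered_mult v w L2_lin L2_const nodep_lin
          hbi_mult_left hbi_coord[OF vw]) (use insert in \<open>auto simp: nodep_def\<close>)
  show ?case
    by (rule hbi_eqI[OF *], unfold lin_insert[OF insert(1,2)], algebra) (use insert in \<open>simp add: distrib_left\<close>)
qed (simp add: hbi_zero)

text \<open>Different edges are uncorrelated even between the form in \<open>v\<close> and the form
  in \<open>w\<close>. An edge with itself contributes the covariance of \<open>v\<close> and
  \<open>w\<close> once for each of its two independent ends, hence the square.\<close>

lemma hbi_qf_qf_centered:
  assumes v: "centered v" and w: "centered w" and "finite I" and b: "weights b"
  shows "hbi M (\<lambda>x. qf b I (\<lambda>u. v (x u)) * qf b I (\<lambda>u. w (x u)))
    ((\<integral>x. v x * w x \<partial>D)^2 * ((\<Sum>i\<in>I. \<Sum>j\<in>I. (b i j)^2) / 2))"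
  using assms(3)
proof (induction I rule: finite_induct)
  case (insert k I)
  let ?r = "\<integral>x. v x * w x \<partial>D"
  have vw: "hbi D (\<lambda>x. v x * w x) ?r"
    by (intro hbi_integral integrable_centered_mult v w)
  let ?f = "\<lambda>x. lin (b k) I (\<lambda>u. v (x u))" and ?g = "\<lambda>x. lin (b k) I (\<lambda>u. w (x u))"
  let ?p = "\<lambda>x. qf b I (\<lambda>u. v (x u))" and ?q = "\<lambda>x. qf b I (\<lambda>u. w (x u))"
  have "hbi M (\<lambda>x. v (x k) * w (x k) * (?f x * ?g x)) (?r * (?r * (\<Sum>i\<in>I. (b k i)^2)))"
    by (intro hbi_nodep[OF vw] hbi_lin_lin_centered nodep_mult nodep_lin insert v w)
  then have *: "hbi M (\<lambda>x. ?p x * ?q x + v (x k) * (?f x * ?q x) + w (x k) * (?p x * ?g x) + v (x k) * w (x k) * (?f x * ?g x))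
     (?r^2 * ((\<Sum>i\<in>I. \<Sum>j\<in>I. (b i j)^2) / 2) + 0 + 0 + ?r * (?r * (\<Sum>i\<in>I. (b k i)^2)))"
    by (intro hbi_add insert hbi_centered_mult v w L2_lin L2_qf nodep_lin nodep_qf b)
  show ?case
  proof (rule hbi_eqI[OF *])
    show "?r^2 * ((\<Sum>i\<in>I. \<Sum>j\<in>I. (b i j)^2) / 2) + 0 + 0 + ?r * (?r * (\<Sum>i\<in>I. (b k i)^2))
       = ?r^2 * ((\<Sum>i\<in>insert k I. \<Sum>j\<in>insert k I. (b i j)^2) / 2)"
      using insert sum_sum_insert[of I k "\<lambda>i j. (b i j)^2"] b
      by (simp add: weights_def power2_eq_square[of ?r] distrib_left add_divide_distrib)
  qed (unfold qf_insert[OF insert(1,2) b], algebra)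
qed (simp add: hbi_zero)

lemma hbi_S_S:
  assumes "centered v" "centered w" "m n > 0"
  shows "hbi M (\<lambda>x. Sf v n x * Sf w n x) ((\<integral>x. v x * w x \<partial>D)^2)"
proof -
  have m: "(\<Sum>i\<in>{1..<Suc n}. \<Sum>j\<in>{1..<Suc n}. (a n i j)^2) / 2 = m n"
    unfolding m_def nedges_def by (simp only: adj_power[OF adj_a] zero_less_numeral)
  have "hbi M (\<lambda>x. qf (a n) {1..<Suc n} (\<lambda>u. v (x u)) * qf (a n) {1..<Suc n} (\<lambda>u. w (x u)) / m n)
      ((\<integral>x. v x * w x \<partial>D)^2 * m n / m n)"
    unfolding m[symmetric] by (intro hbi_divide hbi_qf_qf_centered assms weights_a) auto
  then show ?thesis
    using assms(3) by (simp add: S_eq)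
qed

lemma L2_S: assumes "centered v" shows "L2 (\<lambda>x. Sf v n x)"
proof -
  have "L2 (\<lambda>x. qf (a n) {1..<Suc n} (\<lambda>u. v (x u)))"
    by (intro L2_qf assms weights_a) auto
  then show ?thesis
    unfolding S_eq by (auto simp: L2_def power_divide)
qed

text \<open>The value does not depend on \<open>n\<close>, since normalisation cancels the graph.
  This uniformity allows the truncation level to be fixed before \<open>n\<close> tends to
  infinity.\<close>

lemma S_difference_second_moment:
  assumes "centered w" "m n > 0"
  shows "(\<integral>x. (S n x - Sf w n x)^2 \<partial>M) = 1 - 2 * (\<integral>x. x * w x \<partial>D)^2 + (\<integral>x. (w x)^2 \<partial>D)^2"
    and "integrable M (\<lambda>x. (S n x - Sf w n x)^2)"
proof -
  have *: "hbi M (\<lambda>x. S n x * S n x - 2 * (S n x * Sf w n x) + Sf w n x * Sf w n x)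
    ((\<integral>x. x * x \<partial>D)^2 - 2 * (\<integral>x. x * w x \<partial>D)^2 + (\<integral>x. w x * w x \<partial>D)^2)"
    by (intro hbi_add hbi_diff hbi_mult_right
        hbi_S_S[OF centered_id centered_id] hbi_S_S[OF centered_id assms(1)] hbi_S_S assms)
  have "hbi M (\<lambda>x. (S n x - Sf w n x)^2)
    (1 - 2 * (\<integral>x. x * w x \<partial>D)^2 + (\<integral>x. (w x)^2 \<partial>D)^2)"
    by (rule hbi_eqI[OF *], algebra) (simp only: power2_eq_square[symmetric] variance_D power_one)
  then show "(\<integral>x. (S n x - Sf w n x)^2 \<partial>M) = 1 - 2 * (\<integral>x. x * w x \<partial>D)^2 + (\<integral>x. (w x)^2 \<partial>D)^2"
    and "integrable M (\<lambda>x. (S n x - Sf w n x)^2)"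
    by (auto simp: hbi_iff)
qed

lemma char_S_difference:
  assumes w: "centered w" and m: "m n > 0" and \<delta>: "\<delta> > 0"
    and le: "1 - 2 * (\<integral>x. x * w x \<partial>D)^2 + (\<integral>x. (w x)^2 \<partial>D)^2 \<le> \<delta>^2"
  shows "cmod ((\<integral>x. iexp (t * S n x) \<partial>M) - (\<integral>x. iexp (t * Sf w n x) \<partial>M)) \<le> \<bar>t\<bar> * \<delta>"
proof -
  let ?d = "\<lambda>x. S n x - Sf w n x"
  have [measurable]: "(\<lambda>x. S n x) \<in> borel_measurable M" "(\<lambda>x. Sf w n x) \<in> borel_measurable M"
    using measurable_S'[of "\<lambda>x. x" n] measurable_S'[of w n] w by (auto simp: centered_def)
  have int: "integrable M (\<lambda>x. iexp (t * S n x))" "integrable M (\<lambda>x. iexp (t * Sf w n x))"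
    by (rule P.P.integrable_const_bound[where B = 1]; simp)+
  have pw: "cmod (iexp (t * S n x) - iexp (t * Sf w n x)) \<le> \<bar>t\<bar> * ((\<delta> + (?d x)^2 * (1 / \<delta>)) / 2)" for x
  proof -
    have "cmod (iexp (t * S n x) - iexp (t * Sf w n x)) \<le> \<bar>t * S n x - t * Sf w n x\<bar>"
    proof -
      have "cmod (iexp u - iexp v) \<le> \<bar>u - v\<bar>" for u v :: real
      proof -
        have "iexp u - iexp v = iexp v * (iexp (u - v) - 1)"
          by (simp add: algebra_simps flip: exp_add)
        then have "cmod (iexp u - iexp v) = cmod (iexp (u - v) - 1)"
          by (simp add: norm_mult)
        also have "\<dots> \<le> \<bar>u - v\<bar>"
          using iexp_approx1[of "u - v" 0] by simp
        finally show ?thesis .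
      qed
      then show ?thesis .
    qed
    also have "\<dots> = \<bar>t\<bar> * \<bar>?d x\<bar>"
      by (simp add: abs_mult flip: right_diff_distrib)
    also have "\<dots> \<le> \<bar>t\<bar> * ((\<delta> + (?d x)^2 * (1 / \<delta>)) / 2)"
      by (intro mult_left_mono abs_le_mean_square \<delta>) simp
    finally show ?thesis .
  qed
  have "cmod ((\<integral>x. iexp (t * S n x) \<partial>M) - (\<integral>x. iexp (t * Sf w n x) \<partial>M))
      = cmod (\<integral>x. iexp (t * S n x) - iexp (t * Sf w n x) \<partial>M)"
    using int by simp
  also have "\<dots> \<le> (\<integral>x. \<bar>t\<bar> * ((\<delta> + (?d x)^2 * (1 / \<delta>)) / 2) \<partial>M)"
    by (rule norm_integral_le) (use int pw S_difference_second_moment(2)[OF w m] in auto)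
  also have "\<dots> = \<bar>t\<bar> * ((\<delta> + (\<integral>x. (?d x)^2 \<partial>M) * (1 / \<delta>)) / 2)"
    using S_difference_second_moment(2)[OF w m] P.P.prob_space by simp
  also have "\<dots> \<le> \<bar>t\<bar> * ((\<delta> + \<delta>^2 * (1 / \<delta>)) / 2)"
    unfolding S_difference_second_moment(1)[OF w m]
    using le \<delta> by (intro mult_left_mono divide_right_mono add_left_mono mult_right_mono) auto
  also have "\<dots> = \<bar>t\<bar> * \<delta>"
    using \<delta> by (simp add: power2_eq_square)
  finally show ?thesis .
qed

end

section \<open>Necessity of the graph conditions\<close>

definition clamp :: "real \<Rightarrow> real \<Rightarrow> real" where
  "clamp R s = max (- R) (min R s)"

text \<open>Equal to s^4 for |s| <= R and to its tangents at R and - R outside, hence convex of linear growth.\<close>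

definition psi :: "real \<Rightarrow> real \<Rightarrow> real" where
  "psi R s = 4 * clamp R s ^ 3 * s - 3 * clamp R s ^ 4"

lemma tangent_identity: "p ^ 4 - (4 * q ^ 3 * p - 3 * q ^ 4) = (p - q)^2 * ((p + q)^2 + 2 * q^2)" for p q :: real
  by algebra

lemma tangent_le: "4 * q ^ 3 * p - 3 * q ^ 4 \<le> p ^ 4" for p q :: real
proof -
  have "0 \<le> (p - q)^2 * ((p + q)^2 + 2 * q^2)"
    by simp
  then show ?thesis
    unfolding tangent_identity[symmetric] by (simp only: diff_ge_0_iff_ge)
qed

lemma clamp_eq: "\<bar>s\<bar> \<le> R \<Longrightarrow> clamp R s = s"
  by (auto simp: clamp_def)

lemma psi_eq: "\<bar>s\<bar> \<le> R \<Longrightarrow> psi R s = s ^ 4"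
  using power_add[of s 3 1] by (simp add: psi_def clamp_eq mult.assoc)

lemma abs_clamp_le: "R \<ge> 0 \<Longrightarrow> \<bar>clamp R s\<bar> \<le> R"
  by (auto simp: clamp_def)

text \<open>Convexity of \<open>psi R\<close> made explicit. Beyond \<open>R\<close> it continues as
  its tangent, which is steeper than the tangent at \<open>q\<close> and starts above it by
  \<open>tangent_le\<close>; the left side is symmetric.\<close>

lemma psi_ge_tangent:
  assumes "\<bar>q\<bar> \<le> R" shows "4 * q ^ 3 * s - 3 * q ^ 4 \<le> psi R s"
proof -
  have R: "R \<ge> 0" using assms by simp
  have cube: "q ^ 3 \<le> R ^ 3" "(- R) ^ 3 \<le> q ^ 3"
    using assms by (intro power_mono_odd; simp)+
  consider "\<bar>s\<bar> \<le> R" | "s > R" | "s < - R"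
    by linarith
  then show ?thesis
  proof cases
    case 1
    then have "psi R s = s ^ 4"
      by (rule psi_eq)
    then show ?thesis
      using tangent_le[of q s] by simp
  next
    case 2
    then have "psi R s = 4 * R ^ 3 * s - 3 * R ^ 4"
      using R by (simp add: psi_def clamp_def)
    moreover have "0 \<le> (R ^ 3 - q ^ 3) * (s - R)"
      using 2 cube by (intro mult_nonneg_nonneg) auto
    moreover have "R ^ 3 * R = R ^ 4"
      by algebra
    ultimately show ?thesis
      using tangent_le[of q R] by (simp add: algebra_simps)
  next
    case 3
    then have "psi R s = 4 * (- R) ^ 3 * s - 3 * (- R) ^ 4"
      using R by (simp add: psi_def clamp_def)
    moreover have "0 \<le> (q ^ 3 - (- R) ^ 3) * (- R - s)"
      using 3 cube by (intro mult_nonneg_nonneg) auto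
    moreover have "(- R) ^ 3 * (- R) = (- R) ^ 4"
      by algebra
    ultimately show ?thesis
      using tangent_le[of q "- R"] by (simp only: left_diff_distrib right_diff_distrib)
  qed
qed

lemma psi_nonneg: "R \<ge> 0 \<Longrightarrow> 0 \<le> psi R s"
  using psi_ge_tangent[of 0 R s] by simp

lemma psi_le_power4: "psi R s \<le> s ^ 4"
  unfolding psi_def by (rule tangent_le)

lemma psi_le_linear:
  assumes "R \<ge> 0" shows "psi R s \<le> 4 * R ^ 3 * \<bar>s\<bar>"
proof -
  have "psi R s \<le> 4 * clamp R s ^ 3 * s"
    by (simp add: psi_def)
  also have "\<dots> \<le> 4 * \<bar>clamp R s\<bar> ^ 3 * \<bar>s\<bar>"
    using abs_ge_self[of "4 * clamp R s ^ 3 * s"] by (simp add: abs_mult power_abs)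
  also have "\<dots> \<le> 4 * R ^ 3 * \<bar>s\<bar>"
    using assms by (intro mult_right_mono mult_left_mono power_mono abs_clamp_le) auto
  finally show ?thesis .
qed

text \<open>Beyond \<open>R\<close> the fourth power is at most \<open>s^6 / R^2\<close>, so a
  bounded sixth moment makes the loss from \<open>psi\<close> small for large
  \<open>R\<close>.\<close>

lemma power4_le_psi:
  assumes "R > 0" shows "s ^ 4 \<le> psi R s + s ^ 6 / R^2"
proof (cases "\<bar>s\<bar> \<le> R")
  case True
  then have "psi R s = s ^ 4"
    by (rule psi_eq)
  then show ?thesis
    by simp
next
  case False
  then have "R^2 \<le> s^2"
    using assms by (simp add: abs_le_square_iff[symmetric])
  then have "s ^ 4 * R^2 \<le> s ^ 4 * s^2"
    by (intro mult_left_mono) auto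
  then have "s ^ 4 \<le> s ^ 6 / R^2"
    using assms by (simp add: field_simps flip: power_add)
  then show ?thesis
    using psi_nonneg[of R s] assms by simp
qed

lemma isCont_psi: "isCont (psi R) s"
  unfolding psi_def[abs_def] clamp_def by (intro continuous_intros)

lemma measurable_clamp [measurable]: "clamp R \<in> borel_measurable borel"
  unfolding clamp_def[abs_def] by measurable

lemma measurable_psi [measurable]: "psi R \<in> borel_measurable borel"
  unfolding psi_def[abs_def] by measurable

section \<open>Averaging the tail, and Jensen's inequality for the form\<close>

context l2_graph_seq
begin

definition tail_mean :: "real \<Rightarrow> real" where
  "tail_mean K = (\<integral>x. x * indicator {x. K < \<bar>x\<bar>} x \<partial>D) / measure D {x. K < \<bar>x\<bar>}"

text \<open>The conditional expectation of x with respect to the partition of the line into the points of [-K, K] and its complement; if |x| <= K almost surely, \<^term>\<open>tail_mean K\<close> is 0 (a division by 0).\<close>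

definition coarse :: "real \<Rightarrow> real \<Rightarrow> real" where
  "coarse K x = (if \<bar>x\<bar> \<le> K then x else tail_mean K)"

lemma measurable_coarse [measurable]: "coarse K \<in> borel_measurable borel"
  unfolding coarse_def[abs_def] by measurable

lemma abs_coarse_le: "\<bar>coarse K x\<bar> \<le> max \<bar>K\<bar> \<bar>tail_mean K\<bar>"
  by (auto simp: coarse_def)

lemma integrable_centered: "centered v \<Longrightarrow> integrable D v"
  using integrable_of_square by (auto simp only: centered_def)

lemma integrable_D_mult_indicator: "A \<in> sets borel \<Longrightarrow> integrable D (\<lambda>x. x * indicator A x)"
  using integrable_mult_indicator[of A D "\<lambda>x. x"] integrable_centered[OF centered_id]
  by (simp add: mult.commute)

text \<open>The defining property of a conditional expectation. The difference lives on the tail,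
  where \<open>coarse K\<close> is constant, and \<open>tail_mean\<close> is chosen so that it
  integrates to zero there.\<close>

lemma coarse_orthogonal:
  assumes [measurable]: "g \<in> borel_measurable borel"
  shows "(\<integral>x. g (coarse K x) * (x - coarse K x) \<partial>D) = 0"
proof -
  let ?A = "{x. K < \<bar>x\<bar>}" and ?c = "tail_mean K"
  have A [measurable]: "?A \<in> sets borel" by measurable
  have "g (coarse K x) * (x - coarse K x) = g ?c * (x * indicator ?A x - ?c * indicator ?A x)" for x
    by (auto simp: coarse_def indicator_def)
  then have "(\<integral>x. g (coarse K x) * (x - coarse K x) \<partial>D) = g ?c * (\<integral>x. x * indicator ?A x - ?c * indicator ?A x \<partial>D)"
    by simp
  also have "(\<integral>x. x * indicator ?A x - ?c * indicator ?A x \<partial>D) = (\<integral>x. x * indicator ?A x \<partial>D) - (\<integral>x. ?c * indicator ?A x \<partial>D)"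
    by (intro Bochner_Integration.integral_diff integrable_D_mult_indicator A integrable_mult_right)
       (simp add: integrable_indicator_iff less_top[symmetric])
  also have "(\<integral>x. ?c * indicator ?A x \<partial>D) = ?c * measure D ?A"
    by simp
  also have "(\<integral>x. x * indicator ?A x \<partial>D) - ?c * measure D ?A = 0"
  \<comment> \<open>On a null tail \<open>tail_mean\<close> is a division by zero, but the tail
    integral is zero as well.\<close>
  proof (cases "measure D ?A = 0")
    case True
    then have "AE x in D. x \<notin> ?A"
      by (subst (asm) D.prob_eq_0) auto
    then have "(\<integral>x. x * indicator ?A x \<partial>D) = 0"
      by (intro integral_eq_zero_AE) (auto elim: eventually_mono)
    then show ?thesis
      using True by simp
  qed (simp add: tail_mean_def)
  finally show ?thesis
    by simp
qed

lemma integrable_bounded: "f \<in> borel_measurable borel \<Longrightarrow> (\<And>x. \<bar>f x\<bar> \<le> C) \<Longrightarrow> integrable D (f :: real \<Rightarrow> real)"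
  by (rule D.integrable_const_bound[where B = C]) auto

lemma centered_coarse: "centered (coarse K)"
proof -
  have "(coarse K x)^2 \<le> (max \<bar>K\<bar> \<bar>tail_mean K\<bar>)^2" for x
    using abs_coarse_le[of K x] by (simp add: abs_le_square_iff[symmetric])
  then have 1: "integrable D (\<lambda>x. (coarse K x)^2)"
    by (intro integrable_bounded) auto
  have "(\<integral>x. x - coarse K x \<partial>D) = 0"
    using coarse_orthogonal[of "\<lambda>_. 1" K] by simp
  also have "(\<integral>x. x - coarse K x \<partial>D) = (\<integral>x. x \<partial>D) - (\<integral>x. coarse K x \<partial>D)"
    by (intro Bochner_Integration.integral_diff integrable_centered[OF centered_id]
        integrable_of_square[OF measurable_coarse 1])
  finally have "(\<integral>x. coarse K x \<partial>D) = 0"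
    by (simp only: mean_D)
  then show ?thesis
    unfolding centered_def by (intro conjI measurable_coarse 1)
qed

lemma centered_diff:
  assumes v: "centered v" and w: "centered w" shows "centered (\<lambda>x. v x - w x)"
  unfolding centered_def
proof (intro conjI)
  show "(\<lambda>x. v x - w x) \<in> borel_measurable borel"
    using v w by (auto simp only: centered_def intro!: borel_measurable_diff)
  have "integrable D (\<lambda>x. (v x)^2 + (w x)^2 - 2 * (v x * w x))"
    using v w by (intro Bochner_Integration.integrable_diff Bochner_Integration.integrable_add
        integrable_mult_right integrable_centered_mult) (auto simp only: centered_def)
  then show "integrable D (\<lambda>x. (v x - w x)^2)"
    by (simp only: power2_diff mult.assoc)
  have "(\<integral>x. v x - w x \<partial>D) = (\<integral>x. v x \<partial>D) - (\<integral>x. w x \<partial>D)"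
    by (intro Bochner_Integration.integral_diff integrable_centered v w)
  then show "(\<integral>x. v x - w x \<partial>D) = 0"
    using v w by (simp only: centered_def)
qed

lemma L2_coord: "centered v \<Longrightarrow> L2 (\<lambda>x. v (x k))"
  using L2_coord_mult[of v "\<lambda>_. 1" k] by (auto simp: centered_def L2_const nodep_def)

lemma integrable_bounded_mult:
  assumes [measurable]: "r \<in> borel_measurable borel" and r: "\<And>s. \<bar>r s\<bar> \<le> C"
    and [measurable]: "Z \<in> borel_measurable M" and f: "integrable M f"
  shows "integrable M (\<lambda>x. r (Z x) * (f x :: real))"
proof (rule integrable_bound)
  show "integrable M (\<lambda>x. C * f x)"
    using f by simp
  show "AE x in M. norm (r (Z x) * f x) \<le> norm (C * f x)"
    using r by (auto simp: abs_mult intro!: mult_right_mono AE_I2 order_trans[OF r abs_ge_self])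
qed (use f in measurable)

text \<open>With all coordinates but \<open>k\<close> frozen, the factor \<open>r\<close> depends on
  the free value \<open>y\<close> only through \<open>coarse K y\<close>, so the one-dimensional
  orthogonality applies. The value at \<open>l\<close> is frozen because \<open>k\<close> and
  \<open>l\<close> differ.\<close>

lemma coarse_term_orthogonal:
  assumes r [measurable]: "r \<in> borel_measurable borel" and C: "\<And>s. \<bar>r s\<bar> \<le> C" and v: "centered v" and kl: "k \<noteq> l"
  shows "(\<integral>x. r (Sf (coarse K) n x) * ((x k - coarse K (x k)) * v (x l)) \<partial>M) = 0"
proof (rule integral_eq_0_upd[where k = k])
  show "integrable M (\<lambda>x. r (Sf (coarse K) n x) * ((x k - coarse K (x k)) * v (x l)))"
    by (intro integrable_bounded_mult[OF r C] integrable_L2_mult L2_coord[where v = "\<lambda>x. x - coarse K x"]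
        L2_coord v centered_diff centered_id centered_coarse measurable_S' measurable_coarse)
next
  fix x
  let ?g = "\<lambda>y. r (S n ((\<lambda>u. coarse K (x u))(k := y)))"
  have "(\<lambda>y. S n ((\<lambda>u. coarse K (x u))(k := y))) \<in> borel_measurable borel"
    unfolding S_def S_G_def fun_upd_apply by measurable
  then have g: "?g \<in> borel_measurable borel"
    by measurable
  have upd: "(\<lambda>u. coarse K ((x(k := y)) u)) = (\<lambda>u. coarse K (x u))(k := coarse K y)" for y
    by auto
  have "(\<integral>y. r (S n (\<lambda>u. coarse K ((x(k := y)) u))) * (((x(k := y)) k - coarse K ((x(k := y)) k)) * v ((x(k := y)) l)) \<partial>D)
      = (\<integral>y. ?g (coarse K y) * (y - coarse K y) * v (x l) \<partial>D)"
    unfolding upd using kl by (simp add: mult.assoc)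
  also have "\<dots> = 0"
    using coarse_orthogonal[OF g, of K] by simp
  finally show "(\<integral>y. r (S n (\<lambda>u. coarse K ((x(k := y)) u))) * (((x(k := y)) k - coarse K ((x(k := y)) k)) * v ((x(k := y)) l)) \<partial>D) = 0" .
qed

text \<open>On each edge the variables are replaced one at a time: with \<open>c = coarse K\<close>,
  the difference of the products is
  \<open>(x i - c (x i)) * x j + (x j - c (x j)) * c (x i)\<close>.\<close>

lemma S_coarse_orthogonal:
  assumes r [measurable]: "r \<in> borel_measurable borel" and C: "\<And>s. \<bar>r s\<bar> \<le> C"
  shows "(\<integral>x. r (Sf (coarse K) n x) * (S n x - Sf (coarse K) n x) \<partial>M) = 0"
proof -
  let ?r = "\<lambda>x. r (Sf (coarse K) n x)" and ?c = "coarse K" and ?I = "{1..<Suc n}"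
  have mS: "(\<lambda>x. Sf (coarse K) n x) \<in> borel_measurable M"
    by (rule measurable_S'[OF measurable_coarse])
  note int = integrable_bounded_mult[OF r C mS integrable_L2_mult[OF L2_coord L2_coord]]
  have summand: "hbi M (\<lambda>x. a n i j * (?r x * (x i * x j - ?c (x i) * ?c (x j)))) 0" for i j
  proof (cases "i = j")
    case True
    then show ?thesis
      using weights_diag[OF weights_a, of n j] by (simp add: hbi_zero)
  next
    case False
    have 1: "hbi M (\<lambda>x. ?r x * ((x i - ?c (x i)) * x j)) 0"
      using coarse_term_orthogonal[OF r C centered_id False]
        int[OF centered_diff[OF centered_id centered_coarse] centered_id] by (simp add: hbi_iff)
    have 2: "hbi M (\<lambda>x. ?r x * ((x j - ?c (x j)) * ?c (x i))) 0"
      using coarse_term_orthogonal[OF r C centered_coarse False[symmetric]]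
        int[OF centered_diff[OF centered_id centered_coarse] centered_coarse] by (simp add: hbi_iff)
    have *: "hbi M (\<lambda>x. a n i j * (?r x * ((x i - ?c (x i)) * x j) + ?r x * ((x j - ?c (x j)) * ?c (x i)))) (a n i j * (0 + 0))"
      by (intro hbi_mult_right hbi_add 1 2)
    show ?thesis
      by (rule hbi_eqI[OF *], algebra) simp
  qed
  let ?s = "\<lambda>x. \<Sum>i\<in>?I. \<Sum>j\<in>?I. a n i j * (?r x * (x i * x j - ?c (x i) * ?c (x j)))"
  have *: "hbi M (\<lambda>x. ?s x / (2 * sqrt (m n)))
    ((\<Sum>i\<in>?I. \<Sum>j\<in>?I. 0) / (2 * sqrt (m n)))"
    by (intro hbi_divide hbi_sum summand)
  have "hbi M (\<lambda>x. ?r x * (S n x - Sf ?c n x)) 0"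
  proof (rule hbi_eqI[OF *])
    fix x
    have "?s x
       = ?r x * ((\<Sum>i\<in>?I. \<Sum>j\<in>?I. a n i j * x i * x j) - (\<Sum>i\<in>?I. \<Sum>j\<in>?I. a n i j * ?c (x i) * ?c (x j)))"
      by (simp only: sum_distrib_left sum_subtractf[symmetric]) (simp only: algebra_simps)
    then show "?s x / (2 * sqrt (m n)) = ?r x * (S n x - Sf ?c n x)"
      unfolding S_eq qf_def by (simp only: divide_divide_eq_left diff_divide_distrib[symmetric] times_divide_eq_right)
  qed (simp only: sum.neutral_const div_0)
  then show ?thesis
    by (simp only: hbi_iff)
qed

lemma integrable_S: "centered v \<Longrightarrow> integrable M (\<lambda>x. Sf v n x)"
  using integrable_L2_mult[OF L2_S L2_const[of 1]] by simp

lemma integrable_psi_S: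
  assumes "centered v" "R \<ge> 0"
  shows "integrable M (\<lambda>x. psi R (Sf v n x))"
proof (rule integrable_bound)
  show "integrable M (\<lambda>x. 4 * R ^ 3 * Sf v n x)"
    by (intro integrable_mult_right integrable_S assms)
  show "AE x in M. norm (psi R (Sf v n x)) \<le> norm (4 * R ^ 3 * Sf v n x)"
    using psi_nonneg[OF assms(2)] psi_le_linear[OF assms(2)] assms(2) by (simp add: abs_mult)
  show "(\<lambda>x. psi R (Sf v n x)) \<in> borel_measurable M"
    by (rule measurable_compose[OF measurable_S' measurable_psi]) (use assms in \<open>simp add: centered_def\<close>)
qed

text \<open>Jensen's inequality for the conditional expectation of S, through the tangents of psi.\<close>

lemma psi_S_coarse_le:
  assumes R: "R \<ge> 0"
  shows "(\<integral>x. psi R (Sf (coarse K) n x) \<partial>M) \<le> (\<integral>x. psi R (S n x) \<partial>M)"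
proof -
  let ?s = "\<lambda>x. Sf (coarse K) n x"
  let ?r = "\<lambda>s. 4 * clamp R s ^ 3"
  have r: "?r \<in> borel_measurable borel"
    by measurable
  have C: "\<bar>?r s\<bar> \<le> 4 * R ^ 3" for s
    using abs_clamp_le[OF R, of s] by (simp add: abs_mult power_abs power_mono)
  have int: "integrable M (\<lambda>x. ?r (?s x) * (S n x - ?s x))"
    by (intro integrable_bounded_mult[OF r C] measurable_S' measurable_coarse Bochner_Integration.integrable_diff
        integrable_S[OF centered_id] integrable_S centered_coarse)
  have "(\<integral>x. psi R (?s x) \<partial>M) = (\<integral>x. psi R (?s x) + ?r (?s x) * (S n x - ?s x) \<partial>M)"
    using int integrable_psi_S[OF centered_coarse R] S_coarse_orthogonal[OF r C] by simp
  also have "\<dots> \<le> (\<integral>x. psi R (S n x) \<partial>M)"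
  proof (rule integral_mono)
    fix x
    have "psi R (?s x) + ?r (?s x) * (S n x - ?s x) = 4 * clamp R (?s x) ^ 3 * S n x - 3 * clamp R (?s x) ^ 4"
      by (simp add: psi_def algebra_simps)
    also have "\<dots> \<le> psi R (S n x)"
      by (intro psi_ge_tangent abs_clamp_le R)
    finally show "psi R (?s x) + ?r (?s x) * (S n x - ?s x) \<le> psi R (S n x)" .
  qed (use int integrable_psi_S[OF centered_coarse R] integrable_psi_S[OF centered_id R] in auto)
  finally show ?thesis .
qed

lemma measurable_S_M [measurable]: "S n \<in> borel_measurable M"
  using measurable_S'[of "\<lambda>x. x" n] by simp

lemma real_distribution_S: "real_distribution (distr M borel (S n))"
  by (rule P.P.real_distribution_distr) measurable

text \<open>\<open>psi R\<close> is continuous but unbounded, so weak convergence applies only after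
  capping it. The limit is at most the fourth moment 3 of the normal law, as \<open>psi R\<close>
  lies below the fourth power.\<close>

lemma psi_S_limit:
  assumes conv: "weak_conv_m (\<lambda>n. distr M borel (S n)) std_normal_distribution" and R: "R > 0" and e: "e > 0"
  shows "\<forall>\<^sub>F n in sequentially. (\<integral>x. psi R (S n x) \<partial>M) < 3 + e"
proof -
  \<comment> \<open>As \<open>psi R\<close> grows linearly and the second moment of
    \<open>S n\<close> is 1, capping at \<open>T\<close> costs at most \<open>16 * R^6 / T\<close>,
    which is \<open>e / 2\<close> for this choice.\<close>
  define T where "T = 32 * R ^ 6 / e"
  have T: "T > 0"
    using R e by (simp add: T_def)
  let ?f = "\<lambda>s. min (psi R s) T"
  have f: "norm (?f s) \<le> T" for s
    using psi_nonneg[of R s] R T by auto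
  have lim: "(\<lambda>n. integral\<^sup>L (distr M borel (S n)) ?f) \<longlonglongrightarrow> integral\<^sup>L std_normal_distribution ?f"
    by (rule weak_conv_imp_integral_bdd_continuous_conv[OF real_distribution_S real_dist_normal_dist conv])
       (auto intro!: continuous_intros isCont_psi f[simplified])
  have "integral\<^sup>L std_normal_distribution ?f \<le> integral\<^sup>L std_normal_distribution (\<lambda>s. s ^ 4)"
  proof (rule integral_mono)
    have "integrable std_normal_distribution (\<lambda>s. s ^ (2 * 2))"
      using std_normal_moment_even[of 2] by (subst integrable_density) (auto simp: hbi_iff)
    then show "integrable std_normal_distribution (\<lambda>s. s ^ 4)"
      by simp
    interpret N: real_distribution std_normal_distribution
      by (rule real_dist_normal_dist)
    show "integrable std_normal_distribution ?f"
      by (rule N.integrable_const_bound[where B = T]) (use f in auto)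
    show "?f s \<le> s ^ 4" for s
      using psi_le_power4[of R s] by simp
  qed
  also have "\<dots> = 3"
    using std_normal_moment_even[of 2]
    by (subst integral_density) (auto simp: hbi_iff fact_numeral)
  finally have "integral\<^sup>L std_normal_distribution ?f < 3 + e / 2"
    using e by simp
  from order_tendstoD(2)[OF lim this] show ?thesis
    using eventually_m_pos
  proof eventually_elim
    case (elim n)
    have S2: "hbi M (\<lambda>x. S n x * S n x) 1"
      using hbi_S_S[OF centered_id centered_id elim(2)] variance_D by (simp add: power2_eq_square)
    have pw: "psi R s \<le> ?f s + 16 * R ^ 6 / T * (s * s)" for s
    proof (cases "psi R s \<le> T")
      case True
      have "0 \<le> 16 * R ^ 6 / T * (s * s)"
        using T R by simp
      then show ?thesis
        using True by simp
    next
      case False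
      have "psi R s * T \<le> psi R s * psi R s"
        using False psi_nonneg[of R s] R by (intro mult_left_mono) auto
      also have "\<dots> \<le> (4 * R ^ 3 * \<bar>s\<bar>) * (4 * R ^ 3 * \<bar>s\<bar>)"
        using psi_le_linear[of R s] psi_nonneg[of R s] R by (intro mult_mono) auto
      also have "\<dots> = 16 * R ^ 6 * (\<bar>s\<bar> * \<bar>s\<bar>)"
        by algebra
      finally have "psi R s \<le> 16 * R ^ 6 / T * (s * s)"
        using T by (simp add: field_simps)
      then show ?thesis
        using T False by simp
    qed
    have int: "integrable M (\<lambda>x. ?f (S n x))"
      by (rule P.P.integrable_const_bound[where B = T]) (use f in auto)
    have "(\<integral>x. psi R (S n x) \<partial>M) \<le> (\<integral>x. ?f (S n x) + 16 * R ^ 6 / T * (S n x * S n x) \<partial>M)"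
      by (rule integral_mono) (use int S2 pw integrable_psi_S[OF centered_id, of R n] R in \<open>auto simp: hbi_iff\<close>)
    also have "\<dots> = (\<integral>x. ?f (S n x) \<partial>M) + 16 * R ^ 6 / T"
      using int S2 by (simp add: hbi_iff)
    also have "(\<integral>x. ?f (S n x) \<partial>M) = integral\<^sup>L (distr M borel (S n)) ?f"
      by (rule integral_distr[symmetric]) auto
    also have "16 * R ^ 6 / T = e / 2"
      using R e by (simp add: T_def)
    finally show ?case
      using elim(1) by simp
  qed
qed

end

lemma (in graph_seq) S_scale: "S n (\<lambda>u. c * x u) = c^2 * S n x"
  unfolding S_eq qf_def by (simp add: sum_distrib_left power2_eq_square mult_ac del: sum.op_ivl_Suc)

locale bounded_graph_iid = bounded_iid D B + graph_seq G for D G B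
begin

lemma sixth_moment_S: assumes "m n > 0" shows "(\<integral>x. S n x ^ 6 \<partial>M) \<le> C6 * C6"
proof -
  have "sqrt (m n) ^ 6 = m n ^ 3"
    using power_mult[of "sqrt (m n)" 2 3] assms by simp
  then have "(\<integral>x. S n x ^ 6 \<partial>M) = (\<integral>x. qf (a n) {1..<Suc n} x ^ 6 \<partial>M) / m n ^ 3"
    by (simp add: S_eq power_divide)
  also have "\<dots> \<le> C6 * C6 * m n ^ 3 / m n ^ 3"
    using assms sixth_moment_qf[OF adj_a, of n n] by (intro divide_right_mono) (auto simp: m_def)
  finally show ?thesis
    using assms by simp
qed

end

section \<open>Bounded transformations, and from moment bounds to graph ratios\<close>

context l2_graph_seq
begin

definition bdd where
  "bdd v \<longleftrightarrow> centered v \<and> (\<exists>C. \<forall>x. \<bar>v x\<bar> \<le> C)"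

definition unit where
  "unit v \<longleftrightarrow> bdd v \<and> (\<integral>x. (v x)^2 \<partial>D) = 1"

text \<open>For a \<open>unit\<close> transformation this is the variance of \<open>(v x)^2\<close>,
  that is \<open>mu 4 - 1\<close> for the law of \<open>v\<close>.\<close>

definition kappa :: "(real \<Rightarrow> real) \<Rightarrow> real" where
  "kappa v = (\<integral>x. ((v x)^2 - 1)^2 \<partial>D)"

lemma iid_seq_distr: "v \<in> borel_measurable borel \<Longrightarrow> iid_seq (distr D borel v)"
  unfolding iid_seq_def by (intro D.real_distribution_distr) auto

lemma bdd_bounded_graph_iid:
  assumes "bdd v" obtains B where "bounded_graph_iid (distr D borel v) G B"
proof -
  have v [measurable]: "v \<in> borel_measurable borel"
    using assms by (simp add: bdd_def centered_def)
  have v0: "(\<integral>x. v x \<partial>D) = 0"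
    using assms unfolding bdd_def centered_def by blast
  obtain C where C: "\<And>x. \<bar>v x\<bar> \<le> C"
    using assms by (auto simp: bdd_def)
  interpret V: iid_seq "distr D borel v"
    by (rule iid_seq_distr[OF v])
  have "bounded_graph_iid (distr D borel v) G (max 1 C)"
  proof
    show "AE x in distr D borel v. \<bar>x\<bar> \<le> max 1 C"
      by (subst AE_distr_iff) (auto intro!: AE_I2 order_trans[OF C])
    show "(\<integral>x. x \<partial>distr D borel v) = 0"
      by (subst integral_distr) (auto simp: v0)
  qed simp
  then show ?thesis
    by (rule that)
qed

lemma unit_bounded_graph_seq:
  assumes "unit v" obtains B where "bounded_graph_seq (distr D borel v) G B"
proof -
  have bv: "bdd v" and var: "(\<integral>x. (v x)^2 \<partial>D) = 1"
    using assms by (auto simp only: unit_def)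
  have v [measurable]: "v \<in> borel_measurable borel"
    using bv by (simp add: bdd_def centered_def)
  obtain C where C: "\<And>x. \<bar>v x\<bar> \<le> C"
    using bv by (auto simp: bdd_def)
  obtain B where "bounded_graph_iid (distr D borel v) G B"
    by (rule bdd_bounded_graph_iid[OF bv])
  then interpret V: bounded_graph_iid "distr D borel v" G B .
  have "bounded_graph_seq (distr D borel v) G B"
  proof
    have "\<bar>v x ^ 4\<bar> \<le> C ^ 4" for x
      using power_mono[OF C[of x] abs_ge_zero, of 4] by (simp add: power_abs)
    then have "integrable D (\<lambda>x. v x ^ 4)"
      by (intro integrable_bounded) auto
    then show "integrable (distr D borel v) (\<lambda>x. x ^ 4)"
      by (subst integrable_distr_eq) auto
    show "(\<integral>x. x \<partial>distr D borel v) = 0"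
      by (rule V.mean_zero)
    show "(\<integral>x. x^2 \<partial>distr D borel v) = 1"
      by (subst integral_distr) (auto simp: var)
  qed
  then show ?thesis
    by (rule that)
qed

text \<open>The bounded theory lives on the product of copies of the law of \<open>v\<close>. Here
  its results return to the one space \<open>M\<close>, on which the graph ratios and all truncation
  levels are treated together.\<close>

lemma
  assumes "unit v"
  shows fourth_unit: "(\<lambda>n. (\<integral>x. Sf v n x ^ 4 \<partial>M) - (3 + 6 * kappa v * cherry_ratio n + 12 * cycle_ratio n)) \<longlonglongrightarrow> 0"
    and clt_unit: "(\<lambda>n. kappa v * cherry_ratio n) \<longlonglongrightarrow> 0 \<Longrightarrow> cycle_ratio \<longlonglongrightarrow> 0 \<Longrightarrow>
      (\<lambda>n. \<integral>x. iexp (t * Sf v n x) \<partial>M) \<longlonglongrightarrow> gauss t"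
proof -
  obtain B where "bounded_graph_seq (distr D borel v) G B"
    by (rule unit_bounded_graph_seq[OF assms])
  then interpret V: bounded_graph_seq "distr D borel v" G B .
  have v [measurable]: "v \<in> borel_measurable borel"
    using assms by (simp add: unit_def bdd_def centered_def)
  have mu: "V.mu 4 - 1 = kappa v"
    unfolding V.integral_sq_minus_1[symmetric] kappa_def by (subst integral_distr) auto
  have "(\<integral>x. Sf v n x ^ 4 \<partial>M) = (\<integral>x. S n x ^ 4 \<partial>PiM UNIV (\<lambda>_. distr D borel v))" for n
    by (rule integral_S_comp) auto
  then show "(\<lambda>n. (\<integral>x. Sf v n x ^ 4 \<partial>M) - (3 + 6 * kappa v * cherry_ratio n + 12 * cycle_ratio n)) \<longlonglongrightarrow> 0"
    using V.fourth_moment_asymptotics mu by simp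
  have "(\<integral>x. iexp (t * Sf v n x) \<partial>M) = (\<integral>x. iexp (t * S n x) \<partial>PiM UNIV (\<lambda>_. distr D borel v))" for n
    by (rule integral_S_comp) auto
  then show "(\<lambda>n. \<integral>x. iexp (t * Sf v n x) \<partial>M) \<longlonglongrightarrow> gauss t"
    if "(\<lambda>n. kappa v * cherry_ratio n) \<longlonglongrightarrow> 0" "cycle_ratio \<longlonglongrightarrow> 0"
    using V.char_S_tendsto mu that by simp
qed

lemma kappa_nonneg: "0 \<le> kappa v"
  by (simp add: kappa_def)

text \<open>Without a fourth moment of \<open>x\<close>, \<open>kappa (v K)\<close> need not
  converge. Capping the integrand at 1 makes dominated convergence applicable and still gives a
  positive limit unless \<open>x^2 = 1\<close> almost surely.\<close>

lemma kappa_eventually_ge: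
  assumes unit: "\<forall>\<^sub>F K in at_top. unit (v K)" and lim: "\<And>x. ((\<lambda>K. v K x) \<longlongrightarrow> x) (at_top :: real filter)"
    and meas [measurable]: "\<And>K. v K \<in> borel_measurable borel"
    and ne: "\<not> (AE x in D. x^2 = 1)"
  shows "\<exists>\<beta>>0. \<forall>\<^sub>F K in at_top. \<beta> \<le> kappa (v K)"
proof -
  define f where "f x = min 1 ((x^2 - 1)^2)" for x :: real
  have f01: "0 \<le> f x" "f x \<le> 1" for x
    by (auto simp: f_def)
  have [measurable]: "f \<in> borel_measurable borel"
    unfolding f_def[abs_def] by measurable
  have lim': "((\<lambda>K. \<integral>x. f (v K x) \<partial>D) \<longlongrightarrow> (\<integral>x. f x \<partial>D)) at_top"
  proof (rule integral_dominated_convergence_at_top[where w = "\<lambda>_. 1"])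
    show "AE x in D. ((\<lambda>K. f (v K x)) \<longlongrightarrow> f x) at_top"
      unfolding f_def by (intro AE_I2 tendsto_intros lim)
    show "\<forall>\<^sub>F K in at_top. AE x in D. norm (f (v K x)) \<le> 1"
      using f01 by auto
  qed auto
  have fint: "integrable D (\<lambda>x. f (w x))" if "w \<in> borel_measurable borel" for w
    using f01 that by (intro integrable_bounded[where C = 1]) auto
  have "(\<integral>x. f x \<partial>D) \<noteq> 0"
  proof
    assume "(\<integral>x. f x \<partial>D) = 0"
    then have "AE x in D. f x = 0"
      using integral_nonneg_eq_0_iff_AE[OF fint[of "\<lambda>x. x"]] f01 by auto
    then have "AE x in D. x^2 = 1"
      by eventually_elim (auto simp: f_def min_def split: if_splits)
    with ne show False ..
  qed
  moreover have "(\<integral>x. f x \<partial>D) \<ge> 0"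
    using f01 by simp
  ultimately have pos: "(\<integral>x. f x \<partial>D) > 0"
    by simp
  then have half: "(\<integral>x. f x \<partial>D) / 2 < (\<integral>x. f x \<partial>D)"
    by simp
  have "\<forall>\<^sub>F K in at_top. (\<integral>x. f x \<partial>D) / 2 \<le> kappa (v K)"
    using order_tendstoD(1)[OF lim' half] unit
  proof eventually_elim
    case (elim K)
    obtain C where C: "\<And>x. \<bar>v K x\<bar> \<le> C"
      using elim by (auto simp: unit_def bdd_def)
    have "(\<integral>x. f (v K x) \<partial>D) \<le> kappa (v K)"
      unfolding kappa_def
    proof (rule integral_mono)
      have "\<bar>((v K x)^2 - 1)^2\<bar> \<le> (C^2 + 1)^2" for x
      proof -
        have "(v K x)^2 \<le> C^2"
          using C[of x] by (simp add: abs_le_square_iff[symmetric])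
        then have "\<bar>(v K x)^2 - 1\<bar> \<le> C^2 + 1"
          using zero_le_power2[of "v K x"] by (simp add: abs_le_iff)
        then show ?thesis
          using power_mono[of "\<bar>(v K x)^2 - 1\<bar>" "C^2 + 1" 2] by simp
      qed
      then show "integrable D (\<lambda>x. ((v K x)^2 - 1)^2)"
        by (intro integrable_bounded) auto
      show "integrable D (\<lambda>x. f (v K x))"
        by (rule fint[OF meas])
    qed (simp add: f_def)
    then show ?case
      using elim by simp
  qed
  then show ?thesis
    using pos by (intro exI[of _ "(\<integral>x. f x \<partial>D) / 2"]) auto
qed

lemma tendsto_0_of_eventually_less:
  fixes f :: "nat \<Rightarrow> real"
  assumes "\<And>n. 0 \<le> f n" "\<And>e. e > 0 \<Longrightarrow> \<forall>\<^sub>F n in sequentially. f n < e"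
  shows "f \<longlonglongrightarrow> 0"
  using assms by (intro order_tendstoI) (auto intro: eventually_mono[OF always_eventually] order.strict_trans2)

text \<open>Both summands of the limit formula are nonnegative, so upper bounds suffice. The ratios
  do not involve \<open>K\<close>, hence \<open>K\<close> may be chosen for each \<open>e\<close>;
  for the cherries this requires a lower bound on \<open>kappa (v K)\<close> that is uniform in
  \<open>K\<close>.\<close>

lemma ratios_tendsto_0:
  assumes unit: "\<forall>\<^sub>F K in at_top. unit (v K)" and lim: "\<And>x. ((\<lambda>K. v K x) \<longlongrightarrow> x) (at_top :: real filter)"
    and meas: "\<And>K. v K \<in> borel_measurable borel"
    and bound: "\<And>e. e > 0 \<Longrightarrow> \<forall>\<^sub>F K in at_top. \<forall>\<^sub>F n in sequentially. (\<integral>x. Sf (v K) n x ^ 4 \<partial>M) < 3 + e"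
  shows "cycle_ratio \<longlonglongrightarrow> 0" "cherry_ratio \<longlonglongrightarrow> 0 \<or> (AE x in D. x^2 = 1)"
proof -
  let ?g = "\<lambda>K n. 6 * kappa (v K) * cherry_ratio n + 12 * cycle_ratio n"
  have sum: "\<forall>\<^sub>F K in at_top. \<forall>\<^sub>F n in sequentially. ?g K n < e" if e: "e > 0" for e
    using bound[OF half_gt_zero[OF e]] unit
  proof eventually_elim
    case (elim K)
    have "\<forall>\<^sub>F n in sequentially. - (e / 2) < (\<integral>x. Sf (v K) n x ^ 4 \<partial>M) - (3 + 6 * kappa (v K) * cherry_ratio n + 12 * cycle_ratio n)"
      using order_tendstoD(1)[OF fourth_unit[OF elim(2)], of "- (e / 2)"] e by simp
    moreover have "\<forall>\<^sub>F n in sequentially. (\<integral>x. Sf (v K) n x ^ 4 \<partial>M) < 3 + e / 2"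
      using elim(1) e by simp
    ultimately show ?case
      by eventually_elim linarith
  qed
  show "cycle_ratio \<longlonglongrightarrow> 0"
  proof (rule tendsto_0_of_eventually_less)
    fix e :: real assume e: "e > 0"
    obtain K where K: "\<forall>\<^sub>F n in sequentially. ?g K n < e"
      using eventually_happens'[OF _ sum[OF e]] by (auto simp: trivial_limit_at_top_linorder)
    from K show "\<forall>\<^sub>F n in sequentially. cycle_ratio n < e"
    proof eventually_elim
      case (elim n)
      have "0 \<le> 6 * kappa (v K) * cherry_ratio n"
        by (intro mult_nonneg_nonneg) (auto simp: kappa_nonneg cherry_ratio_nonneg)
      then show ?case
        using elim cycle_ratio_nonneg[of n] by linarith
    qed
  qed (rule cycle_ratio_nonneg)
  show "cherry_ratio \<longlonglongrightarrow> 0 \<or> (AE x in D. x^2 = 1)"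
  proof (cases "AE x in D. x^2 = 1")
    case False
    obtain \<beta> where \<beta>: "\<beta> > 0" "\<forall>\<^sub>F K in at_top. \<beta> \<le> kappa (v K)"
      using kappa_eventually_ge[OF unit lim meas False] by auto
    have "cherry_ratio \<longlonglongrightarrow> 0"
    proof (rule tendsto_0_of_eventually_less)
      fix e :: real assume e: "e > 0"
      have "6 * \<beta> * e > 0"
        using e \<beta> by simp
      then obtain K where K: "\<forall>\<^sub>F n in sequentially. ?g K n < 6 * \<beta> * e" "\<beta> \<le> kappa (v K)"
        using eventually_happens'[OF trivial_limit_at_top_linorder eventually_conj[OF sum[OF \<open>6 * \<beta> * e > 0\<close>] \<beta>(2)]] by blast
      from K(1) show "\<forall>\<^sub>F n in sequentially. cherry_ratio n < e"
      proof eventually_elim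
        case (elim n)
        have "6 * \<beta> * cherry_ratio n \<le> 6 * kappa (v K) * cherry_ratio n"
          using K(2) cherry_ratio_nonneg[of n] by (intro mult_right_mono) auto
        then have "6 * \<beta> * cherry_ratio n < 6 * \<beta> * e"
          using elim cycle_ratio_nonneg[of n] by linarith
        then show ?case
          using \<beta> by simp
      qed
    qed (rule cherry_ratio_nonneg)
    then show ?thesis ..
  qed simp
qed

section \<open>Necessity through tail-averaged variables, sufficiency through approximation\<close>

definition coarse_var where "coarse_var K = (\<integral>x. (coarse K x)^2 \<partial>D)"

definition coarse_std where "coarse_std K x = (1 / sqrt (coarse_var K)) * coarse K x"

lemma integral_id_coarse: "(\<integral>x. x * coarse K x \<partial>D) = coarse_var K"
proof -
  have *: "hbi D (\<lambda>x. x * coarse K x - coarse K x * coarse K x)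
     ((\<integral>x. x * coarse K x \<partial>D) - (\<integral>x. coarse K x * coarse K x \<partial>D))"
    by (intro hbi_diff hbi_integral
        integrable_centered_mult[OF centered_id centered_coarse] integrable_centered_mult centered_coarse)
  have "hbi D (\<lambda>x. coarse K x * (x - coarse K x)) ((\<integral>x. x * coarse K x \<partial>D) - coarse_var K)"
    by (rule hbi_eqI[OF *], algebra) (simp add: coarse_var_def power2_eq_square)
  then show ?thesis
    using coarse_orthogonal[of "\<lambda>x. x" K] by (simp add: hbi_iff)
qed

lemma truncated_second_moment_tendsto:
  "((\<lambda>K. \<integral>x. (x * indicator {y. \<bar>y\<bar> \<le> K} x)^2 \<partial>D) \<longlongrightarrow> 1) at_top"
proof -
  have "((\<lambda>K. \<integral>x. (x * indicator {y. \<bar>y\<bar> \<le> K} x)^2 \<partial>D) \<longlongrightarrow> (\<integral>x. x^2 \<partial>D)) at_top"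
  proof (rule integral_dominated_convergence_at_top[where w = "\<lambda>x. x^2"])
    show "AE x in D. ((\<lambda>K. (x * indicator {y. \<bar>y\<bar> \<le> K} x)^2) \<longlongrightarrow> x^2) at_top"
    proof (intro AE_I2)
      fix x :: real
      have "\<forall>\<^sub>F K in at_top. x^2 = (x * indicator {y. \<bar>y\<bar> \<le> K} x)^2"
        using eventually_ge_at_top[of "\<bar>x\<bar>"] by eventually_elim (simp add: indicator_def)
      then show "((\<lambda>K. (x * indicator {y. \<bar>y\<bar> \<le> K} x)^2) \<longlongrightarrow> x^2) at_top"
        by (rule Lim_transform_eventually[OF tendsto_const])
    qed
    show "\<forall>\<^sub>F K in at_top. AE x in D. norm ((x * indicator {y. \<bar>y\<bar> \<le> K} x)^2) \<le> x^2"
      by (auto simp: indicator_def intro!: always_eventually AE_I2)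
  qed (use integrable_2 in auto)
  then show ?thesis
    by (simp only: variance_D)
qed

text \<open>From below, averaging the tail keeps all values on \<open>[-K, K]\<close>; from above,
  \<open>1 - coarse_var K\<close> is the second moment of \<open>x - coarse K x\<close>.\<close>

lemma coarse_var_tendsto: "(coarse_var \<longlongrightarrow> 1) at_top"
proof (rule tendsto_sandwich[OF _ _ truncated_second_moment_tendsto tendsto_const[of 1]])
  have "(\<integral>x. (x * indicator {y. \<bar>y\<bar> \<le> K} x)^2 \<partial>D) \<le> coarse_var K" for K
    unfolding coarse_var_def
  proof (rule integral_mono)
    show "integrable D (\<lambda>x. (x * indicator {y. \<bar>y\<bar> \<le> K} x)^2)"
      by (rule integrable_bound[OF integrable_2]) (auto simp: indicator_def)
    show "integrable D (\<lambda>x. (coarse K x)^2)"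
      using centered_coarse by (auto simp only: centered_def)
  qed (auto simp: indicator_def coarse_def)
  then show "\<forall>\<^sub>F K in at_top. (\<integral>x. (x * indicator {y. \<bar>y\<bar> \<le> K} x)^2 \<partial>D) \<le> coarse_var K"
    by simp
  have "coarse_var K \<le> 1" for K
  proof -
    have *: "hbi D (\<lambda>x. x * x - 2 * (x * coarse K x) + coarse K x * coarse K x)
       ((\<integral>x. x * x \<partial>D) - 2 * (\<integral>x. x * coarse K x \<partial>D) + (\<integral>x. coarse K x * coarse K x \<partial>D))"
      by (intro hbi_add hbi_diff hbi_mult_right hbi_integral
          integrable_centered_mult[OF centered_id centered_id]
          integrable_centered_mult[OF centered_id centered_coarse] integrable_centered_mult centered_coarse)
    have "hbi D (\<lambda>x. (x - coarse K x)^2) (1 - 2 * coarse_var K + coarse_var K)"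
      by (rule hbi_eqI[OF *], algebra)
         (unfold integral_id_coarse, simp only: power2_eq_square[symmetric] variance_D coarse_var_def)
    then have "(\<integral>x. (x - coarse K x)^2 \<partial>D) = 1 - 2 * coarse_var K + coarse_var K"
      by (simp only: hbi_iff)
    moreover have "0 \<le> (\<integral>x. (x - coarse K x)^2 \<partial>D)"
      by simp
    ultimately show ?thesis
      by simp
  qed
  then show "\<forall>\<^sub>F K in at_top. coarse_var K \<le> 1"
    by simp
qed

lemma eventually_coarse_var_pos: "\<forall>\<^sub>F K in at_top. coarse_var K > 0"
  using order_tendstoD(1)[OF coarse_var_tendsto, of 0] by simp

lemma bdd_coarse: "bdd (coarse K)"
  using centered_coarse abs_coarse_le by (auto simp only: bdd_def)

lemma centered_scale: "centered v \<Longrightarrow> centered (\<lambda>x. c * v x)"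
  by (auto simp: centered_def power_mult_distrib)

lemma unit_coarse_std: assumes "coarse_var K > 0" shows "unit (coarse_std K)"
proof -
  have "\<bar>coarse_std K x\<bar> \<le> \<bar>1 / sqrt (coarse_var K)\<bar> * max \<bar>K\<bar> \<bar>tail_mean K\<bar>" for x
    unfolding coarse_std_def abs_mult by (intro mult_left_mono abs_coarse_le) auto
  moreover have "centered (coarse_std K)"
    unfolding coarse_std_def[abs_def] by (intro centered_scale centered_coarse)
  moreover have "(\<integral>x. (coarse_std K x)^2 \<partial>D) = 1"
    using assms by (simp add: coarse_std_def power_divide flip: coarse_var_def)
  ultimately show ?thesis
    unfolding unit_def bdd_def by blast
qed

lemma eventually_unit_coarse_std: "\<forall>\<^sub>F K in at_top. unit (coarse_std K)"
  using eventually_coarse_var_pos by eventually_elim (rule unit_coarse_std)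

lemma coarse_std_tendsto: "((\<lambda>K. coarse_std K x) \<longlongrightarrow> x) at_top"
proof -
  have "\<forall>\<^sub>F K in at_top. (1 / sqrt (coarse_var K)) * x = coarse_std K x"
    using eventually_ge_at_top[of "\<bar>x\<bar>"] by eventually_elim (simp add: coarse_std_def coarse_def)
  moreover have "((\<lambda>K. (1 / sqrt (coarse_var K)) * x) \<longlongrightarrow> (1 / sqrt 1) * x) at_top"
    by (intro tendsto_intros coarse_var_tendsto) auto
  ultimately show ?thesis
    using Lim_transform_eventually by fastforce
qed

text \<open>\<open>K\<close> is fixed while \<open>n\<close> grows, so the dependence of the sixth
  moment bound on \<open>K\<close> does no harm: the level \<open>R\<close> of \<open>psi\<close> is
  chosen after \<open>K\<close>.\<close>

lemma S_coarse_fourth_le: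
  assumes conv: "weak_conv_m (\<lambda>n. distr M borel (S n)) std_normal_distribution" and e: "e > 0"
  shows "\<forall>\<^sub>F n in sequentially. (\<integral>x. Sf (coarse K) n x ^ 4 \<partial>M) < 3 + e"
proof -
  obtain B where "bounded_graph_iid (distr D borel (coarse K)) G B"
    by (rule bdd_bounded_graph_iid[OF bdd_coarse])
  then interpret C: bounded_graph_iid "distr D borel (coarse K)" G B .
  define A where "A = C.C6 * C.C6 + 1"
  have A: "A > 0"
    using C.C6_nonneg by (simp add: A_def add_nonneg_pos)
  \<comment> \<open>Makes the loss \<open>A / R^2\<close> equal to \<open>e / 2\<close>; the summand
    1 in \<open>A\<close> ensures that \<open>R\<close> is positive.\<close>
  define R where "R = sqrt (2 * A / e)"
  have R: "R > 0" "R^2 = 2 * A / e"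
    using A e by (auto simp: R_def)
  have "\<forall>\<^sub>F n in sequentially. (\<integral>x. psi R (S n x) \<partial>M) < 3 + e / 2"
    using psi_S_limit[OF conv R(1), of "e / 2"] e by simp
  then show ?thesis
    using eventually_m_pos
  proof eventually_elim
    case (elim n)
    let ?s = "\<lambda>x. Sf (coarse K) n x"
    have ls: "C.Linf (S n)"
      unfolding S_eq[abs_def] divide_inverse by (intro C.Linf_mult C.Linf_qf C.Linf_const)
    have mS: "S n \<in> borel_measurable (PiM UNIV (\<lambda>_. distr D borel (coarse K)))"
      using ls by (simp add: C.Linf_def)
    have i: "integrable M (\<lambda>x. ?s x ^ p)" for p :: nat
    proof -
      have "integrable (PiM UNIV (\<lambda>_. distr D borel (coarse K))) (\<lambda>x. S n x ^ p)"
        by (intro C.Linf_integrable C.Linf_power ls)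
      then have "integrable (distr (PiM UNIV (\<lambda>_. distr D borel (coarse K))) borel (S n)) (\<lambda>y. y ^ p)"
        using mS by (subst integrable_distr_eq) auto
      then show ?thesis
        unfolding distr_S_comp[OF measurable_coarse, symmetric]
        by (subst (asm) integrable_distr_eq) (auto intro: measurable_S'[OF measurable_coarse])
    qed
    have "(\<integral>x. ?s x ^ 6 \<partial>M) = (\<integral>x. S n x ^ 6 \<partial>PiM UNIV (\<lambda>_. distr D borel (coarse K)))"
      by (rule integral_S_comp) auto
    also have "\<dots> \<le> A"
      using C.sixth_moment_S[OF elim(2)] by (simp add: A_def)
    finally have s6: "(\<integral>x. ?s x ^ 6 \<partial>M) \<le> A" .
    have "(\<integral>x. ?s x ^ 4 \<partial>M) \<le> (\<integral>x. psi R (?s x) + ?s x ^ 6 * (1 / R^2) \<partial>M)"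
      using R i integrable_psi_S[OF centered_coarse, of R n K] power4_le_psi[OF R(1)]
      by (intro integral_mono Bochner_Integration.integrable_add integrable_mult_left) auto
    also have "\<dots> = (\<integral>x. psi R (?s x) \<partial>M) + (\<integral>x. ?s x ^ 6 \<partial>M) * (1 / R^2)"
      using R i integrable_psi_S[OF centered_coarse, of R n K] by simp
    also have "\<dots> \<le> (\<integral>x. psi R (S n x) \<partial>M) + A * (1 / R^2)"
      using R s6 A e by (intro add_mono psi_S_coarse_le mult_right_mono) auto
    also have "A * (1 / R^2) = e / 2"
      using A e by (simp add: R(2))
    finally show ?case
      using elim(1) by simp
  qed
qed

theorem necessity:
  assumes conv: "weak_conv_m (\<lambda>n. distr M borel (S n)) std_normal_distribution"
  shows "cycle_ratio \<longlonglongrightarrow> 0" "cherry_ratio \<longlonglongrightarrow> 0 \<or> (AE x in D. x^2 = 1)"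
proof -
  have bound: "\<forall>\<^sub>F K in at_top. \<forall>\<^sub>F n in sequentially. (\<integral>x. Sf (coarse_std K) n x ^ 4 \<partial>M) < 3 + e" if e: "e > 0" for e
  proof -
    \<comment> \<open>The form is quadratic: dividing \<open>coarse K\<close> by its standard
      deviation divides the form by \<open>coarse_var K\<close>, and the fourth moment by its fourth
      power.\<close>
    have "((\<lambda>K. 3 / coarse_var K ^ 4) \<longlongrightarrow> 3 / 1 ^ 4) at_top"
      by (intro tendsto_intros coarse_var_tendsto) auto
    then have "\<forall>\<^sub>F K in at_top. 3 / coarse_var K ^ 4 < 3 + e / 2"
      by (rule order_tendstoD) (use e in simp)
    then show ?thesis
      using eventually_coarse_var_pos
    proof eventually_elim
      case (elim K)
      let ?c = "coarse_var K"
      have "\<forall>\<^sub>F n in sequentially. (\<integral>x. Sf (coarse K) n x ^ 4 \<partial>M) < 3 + e / 2 * ?c ^ 4"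
        using elim e by (intro S_coarse_fourth_le conv) auto
      then show ?case
      proof eventually_elim
        case (elim n)
        have "Sf (coarse_std K) n x = Sf (coarse K) n x / ?c" for x
          unfolding coarse_std_def S_scale using \<open>?c > 0\<close> by (simp add: power_divide)
        then have "(\<integral>x. Sf (coarse_std K) n x ^ 4 \<partial>M) = (\<integral>x. Sf (coarse K) n x ^ 4 \<partial>M) / ?c ^ 4"
          by (simp add: power_divide)
        also have "\<dots> < (3 + e / 2 * ?c ^ 4) / ?c ^ 4"
          using elim \<open>?c > 0\<close> by (intro divide_strict_right_mono) auto
        also have "\<dots> = 3 / ?c ^ 4 + e / 2"
          using \<open>?c > 0\<close> by (simp add: add_divide_distrib)
        also have "\<dots> < 3 + e"
          using \<open>3 / ?c ^ 4 < 3 + e / 2\<close> by simp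
        finally show ?case .
      qed
    qed
  qed
  have meas: "coarse_std K \<in> borel_measurable borel" for K
    unfolding coarse_std_def[abs_def] by measurable
  show "cycle_ratio \<longlonglongrightarrow> 0" "cherry_ratio \<longlonglongrightarrow> 0 \<or> (AE x in D. x^2 = 1)"
    by (rule ratios_tendsto_0[OF eventually_unit_coarse_std coarse_std_tendsto meas bound]; assumption)+
qed

text \<open>The mean square distance between the forms in \<open>x\<close> and in
  \<open>v K x\<close> depends only on the correlation of \<open>x\<close> and \<open>v K x\<close>.
  So \<open>K\<close> is fixed by the required precision, and the bounded limit theorem is used for
  this \<open>K\<close> alone.\<close>

theorem sufficiency:
  assumes unit: "\<forall>\<^sub>F K in at_top. unit (v K)" and corr: "((\<lambda>K. \<integral>x. x * v K x \<partial>D) \<longlongrightarrow> 1) (at_top :: real filter)"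
    and ratios: "cycle_ratio \<longlonglongrightarrow> 0" "\<forall>\<^sub>F K in at_top. (\<lambda>n. kappa (v K) * cherry_ratio n) \<longlonglongrightarrow> 0"
  shows "weak_conv_m (\<lambda>n. distr M borel (S n)) std_normal_distribution"
proof (rule levy_continuity[OF real_distribution_S real_dist_normal_dist])
  fix t :: real
  let ?\<phi> = "gauss t"
  have char: "char (distr M borel (S n)) t = (\<integral>x. iexp (t * S n x) \<partial>M)" for n
    unfolding char_def by (subst integral_distr) auto
  have "(\<lambda>n. \<integral>x. iexp (t * S n x) \<partial>M) \<longlonglongrightarrow> ?\<phi>"
  proof (rule tendstoI)
    fix e :: real assume e: "e > 0"
    \<comment> \<open>The added 1 covers \<open>t = 0\<close>.\<close>
    define \<delta> where "\<delta> = e / (2 * (\<bar>t\<bar> + 1))"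
    have \<delta>: "\<delta> > 0"
      using e by (simp add: \<delta>_def add_nonneg_pos)
    have "\<bar>t\<bar> * \<delta> \<le> (\<bar>t\<bar> + 1) * \<delta>"
      using \<delta> by (intro mult_right_mono) auto
    also have "\<dots> = e / 2"
      using abs_ge_zero[of t] by (simp add: \<delta>_def field_simps add_eq_0_iff)
    finally have t\<delta>: "\<bar>t\<bar> * \<delta> \<le> e / 2" .
    \<comment> \<open>Here \<open>1^2\<close> is the squared second moment of \<open>v K\<close>, so
      the expression is the mean square distance of the two forms; it tends to
      \<open>1 - 2 + 1 = 0\<close>.\<close>
    have "((\<lambda>K. 1 - 2 * (\<integral>x. x * v K x \<partial>D)^2 + 1^2) \<longlongrightarrow> 1 - 2 * 1^2 + 1^2) at_top"
      by (intro tendsto_intros corr)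
    then have "\<forall>\<^sub>F K in at_top. 1 - 2 * (\<integral>x. x * v K x \<partial>D)^2 + 1^2 < \<delta>^2"
      by (rule order_tendstoD) (use \<delta> in simp)
    from eventually_happens'[OF _ eventually_conj[OF this eventually_conj[OF unit ratios(2)]]]
    obtain K where K: "1 - 2 * (\<integral>x. x * v K x \<partial>D)^2 + 1^2 < \<delta>^2" "unit (v K)" "(\<lambda>n. kappa (v K) * cherry_ratio n) \<longlonglongrightarrow> 0"
      by (auto simp: trivial_limit_at_top_linorder)
    have c: "centered (v K)" and var: "(\<integral>x. (v K x)^2 \<partial>D) = 1"
      using K(2) by (auto simp only: unit_def bdd_def)
    have "\<forall>\<^sub>F n in sequentially. dist (\<integral>x. iexp (t * Sf (v K) n x) \<partial>M) ?\<phi> < e / 2"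
      by (rule tendstoD[OF clt_unit[OF K(2,3) ratios(1)] half_gt_zero[OF e]])
    then show "\<forall>\<^sub>F n in sequentially. dist (\<integral>x. iexp (t * S n x) \<partial>M) ?\<phi> < e"
      using eventually_m_pos
    proof eventually_elim
      case (elim n)
      have "dist (\<integral>x. iexp (t * S n x) \<partial>M) (\<integral>x. iexp (t * Sf (v K) n x) \<partial>M) \<le> \<bar>t\<bar> * \<delta>"
        unfolding dist_norm by (rule char_S_difference[OF c elim(2) \<delta>]) (use K(1) var in simp)
      then show ?case
        using elim(1) t\<delta>
          dist_triangle[of "\<integral>x. iexp (t * S n x) \<partial>M" ?\<phi> "\<integral>x. iexp (t * Sf (v K) n x) \<partial>M"] by linarith
    qed
  qed
  then show "(\<lambda>n. char (distr M borel (S n)) t) \<longlonglongrightarrow> char std_normal_distribution t"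
    by (simp add: char char_std_normal_distribution)
qed

end

section \<open>The truncated fourth moment\<close>

context l2_graph_seq
begin

text \<open>The truncation of the statement as a function of a single value, so that it becomes one
  of the general transformations \<open>v\<close>.\<close>

definition cut :: "real \<Rightarrow> real \<Rightarrow> real" where "cut K x = x * indicator {y. \<bar>y\<bar> \<le> K} x"
definition cut_mean where "cut_mean K = (\<integral>x. cut K x \<partial>D)"
definition cut_var where "cut_var K = (\<integral>x. (cut K x - cut_mean K)^2 \<partial>D)"
definition cut_std where "cut_std K x = (cut K x - cut_mean K) / sqrt (cut_var K)"

lemma measurable_cut [measurable]: "cut K \<in> borel_measurable borel"
  unfolding cut_def[abs_def] by measurable

lemma measurable_cut_std [measurable]: "cut_std K \<in> borel_measurable borel"
  unfolding cut_std_def[abs_def] by measurable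

lemma cut_eq: "\<bar>x\<bar> \<le> K \<Longrightarrow> cut K x = x"
  by (simp add: cut_def)

lemma abs_cut_le: "\<bar>cut K x\<bar> \<le> \<bar>K\<bar>"
  by (auto simp: cut_def indicator_def)

lemma integrable_cut: "integrable D (cut K)"
  by (rule integrable_bounded[OF _ abs_cut_le]) measurable

lemma hbi_cut_centered: "hbi D (\<lambda>x. cut K x - cut_mean K) 0"
  using hbi_diff[OF hbi_integral[OF integrable_cut[of K]], of "\<lambda>_. cut_mean K" "cut_mean K"]
    D.prob_space by (simp add: hbi_iff cut_mean_def)

lemma hbi_cut_square: "hbi D (\<lambda>x. (cut K x)^2) (\<integral>x. (cut K x)^2 \<partial>D)"
proof -
  have "\<bar>(cut K x)^2\<bar> \<le> \<bar>K\<bar>^2" for x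
    using power_mono[OF abs_cut_le abs_ge_zero, of K x 2] by simp
  then show ?thesis
    by (intro hbi_integral integrable_bounded) auto
qed

lemma hbi_cut_var: "hbi D (\<lambda>x. (cut K x - cut_mean K)^2) ((\<integral>x. (cut K x)^2 \<partial>D) - (cut_mean K)^2)"
proof -
  have *: "hbi D (\<lambda>x. (cut K x)^2 - cut K x * (2 * cut_mean K) + (cut_mean K)^2)
    ((\<integral>x. (cut K x)^2 \<partial>D) - cut_mean K * (2 * cut_mean K) + (cut_mean K)^2)"
    using D.prob_space
    by (intro hbi_add hbi_diff hbi_mult_left hbi_cut_square)
       (auto simp: hbi_iff cut_mean_def integrable_cut)
  show ?thesis
    by (rule hbi_eqI[OF *], algebra) (simp add: power2_eq_square)
qed

lemma cut_mean_tendsto: "(cut_mean \<longlongrightarrow> 0) at_top"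
proof -
  have "((\<lambda>K. \<integral>x. cut K x \<partial>D) \<longlongrightarrow> (\<integral>x. x \<partial>D)) at_top"
  proof (rule integral_dominated_convergence_at_top[where w = "\<lambda>x. \<bar>x\<bar>"])
    show "AE x in D. ((\<lambda>K. cut K x) \<longlongrightarrow> x) at_top"
    proof (intro AE_I2)
      fix x :: real
      have "\<forall>\<^sub>F K in at_top. x = cut K x"
        using eventually_ge_at_top[of "\<bar>x\<bar>"] by eventually_elim (simp add: cut_eq)
      then show "((\<lambda>K. cut K x) \<longlongrightarrow> x) at_top"
        by (rule Lim_transform_eventually[OF tendsto_const])
    qed
    show "\<forall>\<^sub>F K in at_top. AE x in D. norm (cut K x) \<le> \<bar>x\<bar>"
      by (auto simp: cut_def indicator_def intro!: always_eventually AE_I2)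
    show "integrable D (\<lambda>x. \<bar>x\<bar>)"
      by (intro integrable_abs integrable_centered centered_id)
    show "cut K \<in> borel_measurable D" for K
      by (simp add: measurable_cut measurable_cong_sets[OF D.events_eq_borel refl])
  qed simp
  then show ?thesis
    by (simp only: cut_mean_def[abs_def] mean_D)
qed

lemma cut_second_moment_tendsto: "((\<lambda>K. \<integral>x. (cut K x)^2 \<partial>D) \<longlongrightarrow> 1) at_top"
  unfolding cut_def by (rule truncated_second_moment_tendsto)

lemma cut_var_eq: "cut_var K = (\<integral>x. (cut K x)^2 \<partial>D) - (cut_mean K)^2"
  unfolding cut_var_def by (rule hbi_integral_eq[OF hbi_cut_var])

lemma cut_var_tendsto: "(cut_var \<longlongrightarrow> 1) at_top"
proof -
  have "((\<lambda>K. (\<integral>x. (cut K x)^2 \<partial>D) - (cut_mean K)^2) \<longlongrightarrow> 1 - 0^2) at_top"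
    by (intro tendsto_intros cut_second_moment_tendsto cut_mean_tendsto)
  then show ?thesis
    unfolding cut_var_eq[abs_def] by simp
qed

lemma eventually_cut_var_pos: "\<forall>\<^sub>F K in at_top. cut_var K > 0"
  using order_tendstoD(1)[OF cut_var_tendsto, of 0] by simp

lemma unit_cut_std: assumes "cut_var K > 0" shows "unit (cut_std K)"
proof -
  have "\<bar>cut_std K x\<bar> \<le> (\<bar>K\<bar> + \<bar>cut_mean K\<bar>) / sqrt (cut_var K)" for x
    unfolding cut_std_def abs_divide using assms abs_cut_le[of K x]
    by (auto intro!: divide_right_mono)
  moreover have "hbi D (cut_std K) (0 / sqrt (cut_var K))"
    unfolding cut_std_def[abs_def] by (intro hbi_divide hbi_cut_centered)
  moreover have "hbi D (\<lambda>x. (cut_std K x)^2) 1"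
    using hbi_divide[OF hbi_cut_var, of K "cut_var K"] assms
    by (simp add: cut_std_def power_divide cut_var_eq[symmetric])
  ultimately show ?thesis
    unfolding unit_def bdd_def centered_def hbi_iff using measurable_cut_std by auto
qed

lemma eventually_unit_cut_std: "\<forall>\<^sub>F K in at_top. unit (cut_std K)"
  using eventually_cut_var_pos by eventually_elim (rule unit_cut_std)

lemma cut_std_tendsto: "((\<lambda>K. cut_std K x) \<longlongrightarrow> x) at_top"
proof -
  have "\<forall>\<^sub>F K in at_top. (x - cut_mean K) / sqrt (cut_var K) = cut_std K x"
    using eventually_ge_at_top[of "\<bar>x\<bar>"] by eventually_elim (simp add: cut_std_def cut_eq)
  moreover have "((\<lambda>K. (x - cut_mean K) / sqrt (cut_var K)) \<longlongrightarrow> (x - 0) / sqrt 1) at_top"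
    by (intro tendsto_intros cut_mean_tendsto cut_var_tendsto) auto
  ultimately show ?thesis
    using Lim_transform_eventually by fastforce
qed

text \<open>Multiplying \<open>cut K x\<close> by \<open>x\<close> squares it, and the centring
  constant drops out because \<open>x\<close> has mean zero.\<close>

lemma integral_id_cut_std_tendsto: "((\<lambda>K. \<integral>x. x * cut_std K x \<partial>D) \<longlongrightarrow> 1) at_top"
proof -
  have "(\<integral>x. x * cut_std K x \<partial>D) = (\<integral>x. (cut K x)^2 \<partial>D) / sqrt (cut_var K)" for K
  proof -
    have *: "hbi D (\<lambda>x. ((cut K x)^2 - x * cut_mean K) / sqrt (cut_var K))
      (((\<integral>x. (cut K x)^2 \<partial>D) - 0 * cut_mean K) / sqrt (cut_var K))"
      using integrable_centered[OF centered_id] mean_D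
      by (intro hbi_divide hbi_diff hbi_mult_left hbi_cut_square)
         (simp add: hbi_iff)
    have "hbi D (\<lambda>x. x * cut_std K x) ((\<integral>x. (cut K x)^2 \<partial>D) / sqrt (cut_var K))"
      by (rule hbi_eqI[OF *]) (auto simp: cut_std_def cut_def indicator_def power2_eq_square right_diff_distrib)
    then show ?thesis
      by (simp add: hbi_iff)
  qed
  moreover have "((\<lambda>K. (\<integral>x. (cut K x)^2 \<partial>D) / sqrt (cut_var K)) \<longlongrightarrow> 1 / sqrt 1) at_top"
    by (intro tendsto_intros cut_second_moment_tendsto cut_var_tendsto) auto
  ultimately show ?thesis
    by simp
qed

text \<open>From \<open>K = 1\<close> on truncation does not touch the symmetric two-point law. An
  exact zero is needed, since nothing is known about \<open>cherry_ratio\<close> in this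
  case.\<close>

lemma kappa_cut_std_eq_0:
  assumes ae: "AE x in D. x^2 = 1" and K: "K \<ge> 1"
  shows "kappa (cut_std K) = 0"
proof -
  have cut: "AE x in D. cut K x = x"
    using ae
  proof eventually_elim
    case (elim x)
    then have "\<bar>x\<bar> = 1"
      by (auto simp: power2_eq_1_iff)
    then show ?case
      using K by (intro cut_eq) simp
  qed
  have "cut_mean K = (\<integral>x. x \<partial>D)"
    unfolding cut_mean_def by (rule integral_cong_AE[OF _ _ cut]) auto
  then have a: "cut_mean K = 0"
    by (simp only: mean_D)
  have "(\<integral>x. (cut K x)^2 \<partial>D) = (\<integral>x. x^2 \<partial>D)"
    by (rule integral_cong_AE) (use cut in auto)
  then have b: "cut_var K = 1"
    unfolding cut_var_eq a variance_D by simp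
  have "AE x in D. ((cut_std K x)^2 - 1)^2 = 0"
    using ae cut by eventually_elim (simp add: cut_std_def a b)
  then show ?thesis
    unfolding kappa_def by (rule integral_eq_zero_AE)
qed

lemma eventually_kappa_cherry_tendsto:
  assumes "cherry_ratio \<longlonglongrightarrow> 0 \<or> (AE x in D. x^2 = 1)"
  shows "\<forall>\<^sub>F K in at_top. (\<lambda>n. kappa (cut_std K) * cherry_ratio n) \<longlonglongrightarrow> 0"
  using eventually_ge_at_top[of 1]
proof eventually_elim
  case (elim K)
  then show ?case
    using assms tendsto_mult_right_zero[of cherry_ratio sequentially "kappa (cut_std K)"] kappa_cut_std_eq_0[of K]
    by auto
qed

section \<open>The three criteria reduced to the same graph conditions\<close>

lemma weak_conv_iff_ratios:
  "weak_conv_m (\<lambda>n. distr M borel (S n)) std_normal_distribution \<longleftrightarrow>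
    cycle_ratio \<longlonglongrightarrow> 0 \<and> (cherry_ratio \<longlonglongrightarrow> 0 \<or> (AE x in D. x^2 = 1))"
  using necessity sufficiency[OF eventually_unit_cut_std integral_id_cut_std_tendsto _ eventually_kappa_cherry_tendsto]
  by blast

text \<open>From left to right only the upper bounds implied by the limits are used. In the other
  direction the inner limit is 3 for every large \<open>K\<close>, so the constant function serves
  as \<open>L\<close>.\<close>

lemma truncated_fourth_moment_iff_ratios:
  "(\<exists>L :: real \<Rightarrow> real. (\<forall>\<^sub>F K in at_top. (\<lambda>n. \<integral>x. Sf (cut_std K) n x ^ 4 \<partial>M) \<longlonglongrightarrow> L K) \<and> (L \<longlongrightarrow> 3) at_top)
    \<longleftrightarrow> cycle_ratio \<longlonglongrightarrow> 0 \<and> (cherry_ratio \<longlonglongrightarrow> 0 \<or> (AE x in D. x^2 = 1))" (is "?lhs \<longleftrightarrow> ?rhs")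
proof
  assume ?lhs
  then obtain L where L: "\<forall>\<^sub>F K in at_top. (\<lambda>n. \<integral>x. Sf (cut_std K) n x ^ 4 \<partial>M) \<longlonglongrightarrow> L K" "(L \<longlongrightarrow> 3) at_top"
    by blast
  have "\<forall>\<^sub>F K in at_top. \<forall>\<^sub>F n in sequentially. (\<integral>x. Sf (cut_std K) n x ^ 4 \<partial>M) < 3 + e" if "e > 0" for e
  proof -
    have "\<forall>\<^sub>F K in at_top. L K < 3 + e"
      by (rule order_tendstoD(2)[OF L(2)]) (use that in simp)
    then show ?thesis
      using L(1) by eventually_elim (rule order_tendstoD(2))
  qed
  from ratios_tendsto_0[OF eventually_unit_cut_std cut_std_tendsto measurable_cut_std this] show ?rhs
    by blast
next
  assume rhs: ?rhs
  have "\<forall>\<^sub>F K in at_top. (\<lambda>n. \<integral>x. Sf (cut_std K) n x ^ 4 \<partial>M) \<longlonglongrightarrow> 3"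
    using eventually_unit_cut_std eventually_kappa_cherry_tendsto[OF conjunct2[OF rhs]]
  proof eventually_elim
    case (elim K)
    have "(\<lambda>n. ((\<integral>x. Sf (cut_std K) n x ^ 4 \<partial>M) - (3 + 6 * kappa (cut_std K) * cherry_ratio n + 12 * cycle_ratio n))
        + (3 + 6 * (kappa (cut_std K) * cherry_ratio n) + 12 * cycle_ratio n)) \<longlonglongrightarrow> 0 + (3 + 6 * 0 + 12 * 0)"
      using rhs by (intro tendsto_intros fourth_unit elim) auto
    then show ?case
      by (simp add: mult.assoc)
  qed
  then show ?lhs
    by (intro exI[of _ "\<lambda>_. 3"]) auto
qed

text \<open>The limit 3 means that a sum of two nonnegative terms vanishes. The cherry term has the
  fixed factor \<open>c\<close>, the variance of \<open>x^2\<close>: either it can be divided out,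
  or it is zero and \<open>x^2 = 1\<close> almost surely.\<close>

lemma fourth_moment_iff_ratios:
  assumes "integrable D (\<lambda>x. x ^ 4)"
  shows "(\<lambda>n. \<integral>x. S n x ^ 4 \<partial>M) \<longlonglongrightarrow> 3
    \<longleftrightarrow> cycle_ratio \<longlonglongrightarrow> 0 \<and> (cherry_ratio \<longlonglongrightarrow> 0 \<or> (AE x in D. x^2 = 1))" (is "?lhs \<longleftrightarrow> ?rhs")
proof -
  have "std_graph_seq D G"
    by unfold_locales (rule assms mean_D variance_D)+
  then interpret E: std_graph_seq D G .
  define c where "c = E.mu 4 - 1"
  let ?g = "\<lambda>n. 6 * c * cherry_ratio n + 12 * cycle_ratio n"
  have c0: "c \<ge> 0"
    using E.mu4_ge_1 by (simp add: c_def)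
  have c_int: "(\<integral>x. (x^2 - 1)^2 \<partial>D) = c"
    unfolding c_def by (rule E.integral_sq_minus_1)
  have lim: "(\<lambda>n. (\<integral>x. S n x ^ 4 \<partial>M) - (3 + 6 * c * cherry_ratio n + 12 * cycle_ratio n)) \<longlonglongrightarrow> 0"
    unfolding c_def by (rule E.fourth_moment_asymptotics)
  have "?lhs \<longleftrightarrow> ?g \<longlonglongrightarrow> 0"
  proof
    assume ?lhs
    from tendsto_diff[OF tendsto_diff[OF this lim] tendsto_const[of 3]]
    show "?g \<longlonglongrightarrow> 0"
      by (simp add: algebra_simps)
  next
    assume "?g \<longlonglongrightarrow> 0"
    from tendsto_add[OF lim tendsto_add[OF tendsto_const[of 3] this]] show ?lhs
      by (simp add: add.assoc)
  qed
  also have "\<dots> \<longleftrightarrow> ?rhs"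
  proof
    assume sum: "?g \<longlonglongrightarrow> 0"
    have nn: "0 \<le> 6 * c * cherry_ratio n" for n
      using c0 cherry_ratio_nonneg[of n] by simp
    have "(\<lambda>n. 12 * cycle_ratio n) \<longlonglongrightarrow> 0"
      by (rule tendsto_sandwich[OF _ _ tendsto_const[of 0] sum])
         (use nn cycle_ratio_nonneg in \<open>auto intro!: always_eventually\<close>)
    then have cycle: "cycle_ratio \<longlonglongrightarrow> 0"
      by simp
    show ?rhs
    proof (cases "c = 0")
      case True
      have int: "integrable D (\<lambda>x. (x^2 - 1)^2)"
      proof -
        have "integrable D (\<lambda>x. x ^ 4 - 2 * x^2 + 1)"
          using assms integrable_2 by auto
        moreover have "(\<lambda>x. x ^ 4 - 2 * x^2 + 1) = (\<lambda>x :: real. (x^2 - 1)^2)"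
          by (rule ext) algebra
        ultimately show ?thesis by simp
      qed
      have "AE x in D. (x^2 - 1)^2 = 0"
        using integral_nonneg_eq_0_iff_AE[OF int] c_int True by simp
      then show ?thesis
        using cycle by (auto elim: eventually_mono)
    next
      case False
      have "(\<lambda>n. 6 * c * cherry_ratio n) \<longlonglongrightarrow> 0"
        by (rule tendsto_sandwich[OF _ _ tendsto_const[of 0] sum])
           (use nn cycle_ratio_nonneg in \<open>auto intro!: always_eventually\<close>)
      from tendsto_mult[OF tendsto_const[of "1 / (6 * c)"] this] show ?thesis
        using cycle False by simp
    qed
  next
    assume rhs: ?rhs
    have "(\<lambda>n. c * cherry_ratio n) \<longlonglongrightarrow> 0"
    proof (cases "AE x in D. x^2 = 1")
      case True
      then have "AE x in D. (x^2 - 1)^2 = 0"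
        by eventually_elim simp
      then have "(\<integral>x. (x^2 - 1)^2 \<partial>D) = 0"
        by (rule integral_eq_zero_AE)
      then show ?thesis
        by (simp add: c_int)
    next
      case False
      then show ?thesis
        using rhs by (auto intro: tendsto_mult_right_zero)
    qed
    then have "(\<lambda>n. 6 * (c * cherry_ratio n) + 12 * cycle_ratio n) \<longlonglongrightarrow> 6 * 0 + 12 * 0"
      using rhs by (intro tendsto_intros) auto
    then show "?g \<longlonglongrightarrow> 0"
      by (simp add: mult.assoc)
  qed
  finally show ?thesis .
qed

end

text \<open>What remains is a change of space: laws and fourth moments of the forms are carried to
  the product of copies of the law of \<open>X 1\<close>, where all criteria have the same
  right-hand side.\<close>

theorem theorem1p3:
  fixes P :: "'a measure" and X :: "nat \<Rightarrow> 'a \<Rightarrow> real"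
    and G :: "nat \<Rightarrow> nat \<Rightarrow> nat \<Rightarrow> bool"
  assumes prob: "prob_space P"
    and rv: "\<And>i. i \<ge> 1 \<Longrightarrow> X i \<in> borel_measurable P"
    and indep: "prob_space.indep_vars P (\<lambda>_. borel) X {1..}"
    and ident: "\<And>i. i \<ge> 1 \<Longrightarrow> distr P borel (X i) = distr P borel (X 1)"
    and int1: "integrable P (X 1)"
    and mean0: "integral\<^sup>L P (X 1) = 0"
    and int2: "integrable P (\<lambda>w. (X 1 w)\<^sup>2)"
    and var1: "integral\<^sup>L P (\<lambda>w. (X 1 w)\<^sup>2) = 1"
    and graphs: "\<And>n. graph_class n (G n)"
    and edges_inf: "filterlim (\<lambda>n. card (edges n (G n))) at_top sequentially"
  shows
    "(weak_conv_m (\<lambda>n. distr P borel (\<lambda>w. S_G n (G n) (\<lambda>u. X u w))) std_normal_distribution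
        \<longleftrightarrow>
      (\<exists>L :: real \<Rightarrow> real.
         (\<forall>\<^sub>F K in at_top.
            (\<lambda>n. integral\<^sup>L P (\<lambda>w. (S_G n (G n) (\<lambda>u. trunc_X P X K u w)) ^ 4)) \<longlonglongrightarrow> L K)
         \<and> (L \<longlongrightarrow> 3) at_top))
     \<and>
     (integrable P (\<lambda>w. (X 1 w) ^ 4) \<longrightarrow>
       (weak_conv_m (\<lambda>n. distr P borel (\<lambda>w. S_G n (G n) (\<lambda>u. X u w))) std_normal_distribution
        \<longleftrightarrow>
        (\<lambda>n. integral\<^sup>L P (\<lambda>w. (S_G n (G n) (\<lambda>u. X u w)) ^ 4)) \<longlonglongrightarrow> 3))"
proof -
  define D where "D = distr P borel (X 1)"
  interpret P: prob_space P by (rule prob)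
  have X1 [measurable]: "X 1 \<in> borel_measurable P"
    by (rule rv) simp
  have "l2_graph_seq D G"
    unfolding l2_graph_seq_def l2_graph_seq_axioms_def iid_seq_def graph_seq_def D_def
  proof (intro conjI allI)
    show "real_distribution (distr P borel (X 1))"
      by (rule P.real_distribution_distr[OF X1])
    show "integrable (distr P borel (X 1)) (\<lambda>x. x^2)"
      by (subst integrable_distr_eq[OF X1]) (use int2 in \<open>simp_all del: One_nat_def\<close>)
    show "(\<integral>x. x \<partial>distr P borel (X 1)) = 0"
      by (subst integral_distr[OF X1]) (use mean0 in \<open>simp_all del: One_nat_def\<close>)
    show "(\<integral>x. x^2 \<partial>distr P borel (X 1)) = 1"
      by (subst integral_distr[OF X1]) (use var1 in \<open>simp_all del: One_nat_def\<close>)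
  qed (rule graphs edges_inf)+
  then interpret E: l2_graph_seq D G .
  \<comment> \<open>With \<open>v\<close> the identity this concerns the form in the given
    variables, with \<open>v = cut_std K\<close> the truncated one.\<close>
  have law: "distr P borel (\<lambda>w. E.S n (\<lambda>u. v (X u w))) = distr (PiM UNIV (\<lambda>_. distr D borel v)) borel (E.S n)"
    if v [measurable]: "v \<in> borel_measurable borel" for v n
  proof (rule distr_iid_eq[where X = "\<lambda>u w. v (X u w)", OF prob])
    show "P.indep_vars (\<lambda>_. borel) (\<lambda>u w. v (X u w)) {1..}"
      by (rule P.indep_vars_compose2[OF indep]) measurable
    show "(\<lambda>w. v (X i w)) \<in> borel_measurable P" if "i \<ge> 1" for i
      by (rule measurable_compose[OF rv[OF that] v])
    show "distr P borel (\<lambda>w. v (X i w)) = distr D borel v" if "i \<ge> 1" for i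
    proof -
      have "distr P borel (\<lambda>w. v (X i w)) = distr (distr P borel (X i)) borel v"
        using rv[OF that] by (subst distr_distr) (auto simp: comp_def)
      then show ?thesis
        by (simp only: ident[OF that] D_def)
    qed
  qed (rule E.measurable_S E.S_restrict)+
  have same_law: "distr P borel (\<lambda>w. E.S n (\<lambda>u. v (X u w))) = distr E.M borel (\<lambda>x. E.Sf v n x)"
    if "v \<in> borel_measurable borel" for v n
    unfolding law[OF that] E.distr_S_comp[OF that] ..
  have meas: "(\<lambda>w. E.S n (\<lambda>u. v (X u w))) \<in> borel_measurable P" if v: "v \<in> borel_measurable borel" for v n
  proof -
    have "(\<lambda>w. v (X u w)) \<in> borel_measurable P" if "u \<ge> 1" for u
      by (rule measurable_compose[OF rv[OF that] v])
    then show ?thesis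
      unfolding E.S_def S_G_def by (intro borel_measurable_times borel_measurable_sum borel_measurable_const) auto
  qed
  have fourth: "(\<integral>w. E.S n (\<lambda>u. v (X u w)) ^ 4 \<partial>P) = (\<integral>x. E.Sf v n x ^ 4 \<partial>E.M)"
    if v: "v \<in> borel_measurable borel" for v n
    using integral_distr[OF meas[OF v], of "\<lambda>y. y ^ 4" n] integral_distr[OF E.measurable_S'[OF v], of "\<lambda>y. y ^ 4" n]
    by (simp add: same_law[OF v])
  have mean: "trunc_mean P X K = E.cut_mean K" for K
    unfolding trunc_mean_def E.cut_mean_def E.cut_def unfolding D_def by (subst integral_distr[OF X1]) auto
  have var: "trunc_var P X K = E.cut_var K" for K
    unfolding trunc_var_def E.cut_var_def mean E.cut_def unfolding D_def by (subst integral_distr[OF X1]) auto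
  have trunc: "trunc_X P X K u w = E.cut_std K (X u w)" for K u w
    unfolding trunc_X_def E.cut_std_def E.cut_def mean var ..
  have 1: "weak_conv_m (\<lambda>n. distr P borel (\<lambda>w. S_G n (G n) (\<lambda>u. X u w))) std_normal_distribution
      \<longleftrightarrow> weak_conv_m (\<lambda>n. distr E.M borel (E.S n)) std_normal_distribution"
  proof -
    have "E.S n = S_G n (G n)" for n
      by (rule ext) (simp add: E.S_def)
    then show ?thesis
      using same_law[of "\<lambda>x. x"] by simp
  qed
  have 2: "(\<integral>w. S_G n (G n) (\<lambda>u. trunc_X P X K u w) ^ 4 \<partial>P) = (\<integral>x. E.Sf (E.cut_std K) n x ^ 4 \<partial>E.M)" for n K
    unfolding trunc E.S_def[symmetric] by (rule fourth[OF E.measurable_cut_std])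
  have 3: "(\<integral>w. S_G n (G n) (\<lambda>u. X u w) ^ 4 \<partial>P) = (\<integral>x. E.S n x ^ 4 \<partial>E.M)" for n
    using fourth[of "\<lambda>x. x" n] by (simp add: E.S_def)
  have 4: "integrable D (\<lambda>x. x ^ 4)" if "integrable P (\<lambda>w. X 1 w ^ 4)"
    unfolding D_def by (subst integrable_distr_eq[OF X1]) (use that in \<open>simp_all del: One_nat_def\<close>)
  show ?thesis
    unfolding 1 2 3 E.weak_conv_iff_ratios E.truncated_fourth_moment_iff_ratios
    using E.fourth_moment_iff_ratios[OF 4] by blast
qed

end
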